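(* Fix $d\geq 1$. Let $\Omega\subset\mathbb{R}^d$ be an open subset and $P$ a Borel probability measure on $\mathbb{R}^d$. Assume that $P$ admits a density $f_\Omega\in L^1(\Omega)$ over $\Omega$ with respect to the Lebesgue measure. If $f_\Omega\in\mathcal{C}^{k,\beta}_{\mathrm{loc}}(\Omega)$ for some $k\in\mathbb{N}$ and $\beta\in(0,1)$, then $F_P^{\mathrm g}\in\mathcal{C}^{d+k,\beta}_{\mathrm{loc}}(\Omega)$ and $$f_\Omega(x)=(\mathcal{L}_dF_P^{\mathrm g})(x)\quad\text{for all }x\in\Omega .$$
   Context: $\mathbb{N}=\{0,1,2,\dots\}$. $P$ admits the density $f_\Omega$ over $\Omega$ if $P(E)=\int_Ef_\Omega(z)\,dz$ for all Borel $E\subset\Omega$ (nothing is assumed outside $\Omega$). $u\in\mathcal{C}^{k,\beta}_{\mathrm{loc}}(\Omega)$ means $u\in\mathcal{C}^k(\Omega)$ and, on every compact subset of $\Omega$, all $\partial^\alpha u$ with $|\alpha|\le k$ are bounded and those with $|\alpha|=k$ are $\beta$-Hölder continuous (componentwise for vector fields). Geometric cdf: with $Z$ a random vector with law $P$, $F_P^{\mathrm g}:\mathbb{R}^d\to\mathbb{R}^d$ is $F_P^{\mathrm g}(x)=\mathbb{E}\big[\frac{x-Z}{\|x-Z\|}\mathbb{I}[Z\neq x]\big]$; it is bounded by $1$ in norm. Fourier transform: $(\mathcal{F}u)(\xi)=\int_{\mathbb{R}^d}u(x)e^{-2i\pi\langle x,\xi\rangle}dx$. For $s>0$ and $\psi\in\mathcal{S}(\mathbb{R}^d)$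 (complex-valued Schwartz class), $(-\Delta)^s\psi:=(2\pi)^{2s}\mathcal{F}^{-1}(\|\xi\|^{2s}(\mathcal{F}\psi)(\xi))$. Let $\mathcal{S}_{1/2}(\mathbb{R}^d)$ be the space of $\psi\in\mathcal{C}^\infty(\mathbb{R}^d)$ with $\sup_x|(1+\|x\|^{d+1})\partial^\alpha\psi(x)|<\infty$ for all $\alpha\in\mathbb{N}^d$, with the topology given by these seminorms, and $\mathcal{S}_{1/2}(\mathbb{R}^d)'$ the space of continuous linear maps $\mathcal{S}_{1/2}(\mathbb{R}^d)\to\mathbb{C}$. This space contains $L^\infty(\mathbb{R}^d)$ and is closed under distributional differentiation, and $(-\Delta)^{1/2}$ maps $\mathcal{S}(\mathbb{R}^d)$ continuously into $\mathcal{S}_{1/2}(\mathbb{R}^d)$. For $T\in\mathcal{S}_{1/2}(\mathbb{R}^d)'$, $(-\Delta)^{1/2}T$ is the tempered distribution $\psi\mapsto\langle T,(-\Delta)^{1/2}\psi\rangle$, $\psi\in\mathcal{S}(\mathbb{R}^d)$. For $T$ a bounded measurable vector field on $\mathbb{R}^d$ (derivatives in the sense of distributions), the tempered distribution $\mathcal{L}_dT$ is $$\mathcal{L}_dT:=\gamma_d\,(-\Delta)^{\frac{d-1}{2}}(\nabla\cdot T),\qquad \gamma_d^{-1}=2^d\pi^{\frac{d-1}{2}}\Gamma\big(\tfrac{d+1}{2}\big),$$ where, for $d$ odd, $(-\Delta)^{(d-1)/2}$ is $-\Delta$ iterated $(d-1)/2$ times, and, for $d$ even, $(-\Delta)^{(d-1)/2}:=(-\Delta)^{1/2}(-\Delta)^{(d-2)/2}$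 with $(-\Delta)^{(d-2)/2}$ being $-\Delta$ iterated $(d-2)/2$ times. The pointwise equality on $\Omega$ means that the restriction to $\Omega$ of the distribution $\mathcal{L}_dF_P^{\mathrm g}$ is (represented by) a continuous function on $\Omega$ which equals $f_\Omega$ at every point of $\Omega$. *)

theory Defs
  imports "HOL-Probability.Probability"
begin

section \<open>Partial derivatives and spaces of differentiable functions\<close>

definition partial_deriv ::
    "'n::finite \<Rightarrow> (real^'n \<Rightarrow> 'b::real_normed_vector) \<Rightarrow> real^'n \<Rightarrow> 'b" where
  "partial_deriv i u x = vector_derivative (\<lambda>t. u (x + t *\<^sub>R axis i 1)) (at 0)"

text \<open>Higher partial derivatives are indexed by words of coordinates instead of multi-indices:
  \<open>iter_partial [i\<^sub>1, \<dots>, i\<^sub>m] u\<close> is the partial derivative of \<open>u\<close> with respect to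
  \<open>i\<^sub>m\<close>, then \<dots>, then \<open>i\<^sub>1\<close>.  All words of length at most \<open>k\<close> are quantified over below, so
  for functions of class \<open>C\<^sup>k\<close> (where the order of differentiation is irrelevant) these are
  exactly the derivatives with multi-index of order at most \<open>k\<close>.\<close>

primrec iter_partial ::
    "'n::finite list \<Rightarrow> (real^'n \<Rightarrow> 'b::real_normed_vector) \<Rightarrow> real^'n \<Rightarrow> 'b" where
  "iter_partial [] u = u"
| "iter_partial (i # \<alpha>) u = partial_deriv i (iter_partial \<alpha> u)"

definition Ck_on ::
    "nat \<Rightarrow> (real^'n::finite) set \<Rightarrow> (real^'n \<Rightarrow> 'b::real_normed_vector) \<Rightarrow> bool" where
  "Ck_on k \<Omega> u \<longleftrightarrow>
     (\<forall>\<alpha> i. length \<alpha> < k \<longrightarrow>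
        (\<forall>x\<in>\<Omega>. (\<lambda>t. iter_partial \<alpha> u (x + t *\<^sub>R axis i 1)) differentiable (at 0))) \<and>
     (\<forall>\<alpha>. length \<alpha> \<le> k \<longrightarrow> continuous_on \<Omega> (iter_partial \<alpha> u))"

definition smooth :: "(real^'n::finite \<Rightarrow> 'b::real_normed_vector) \<Rightarrow> bool" where
  "smooth u \<longleftrightarrow> (\<forall>k. Ck_on k UNIV u)"

definition holder_on ::
    "real \<Rightarrow> (real^'n::finite) set \<Rightarrow> (real^'n \<Rightarrow> 'b::real_normed_vector) \<Rightarrow> bool" where
  "holder_on \<beta> K u \<longleftrightarrow> (\<exists>C. \<forall>x\<in>K. \<forall>y\<in>K. norm (u x - u y) \<le> C * norm (x - y) powr \<beta>)"

definition Ck_holder_loc ::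
    "nat \<Rightarrow> real \<Rightarrow> (real^'n::finite) set \<Rightarrow> (real^'n \<Rightarrow> 'b::real_normed_vector) \<Rightarrow> bool" where
  "Ck_holder_loc k \<beta> \<Omega> u \<longleftrightarrow>
     Ck_on k \<Omega> u \<and>
     (\<forall>K. compact K \<and> K \<subseteq> \<Omega> \<longrightarrow>
        (\<forall>\<alpha>. length \<alpha> \<le> k \<longrightarrow> bounded (iter_partial \<alpha> u ` K)) \<and>
        (\<forall>\<alpha>. length \<alpha> = k \<longrightarrow> holder_on \<beta> K (iter_partial \<alpha> u)))"

section \<open>Densities over a subset and the geometric cdf\<close>

text \<open>Nothing is required of \<open>f\<close>, nor of \<open>P\<close>, outside \<open>\<Omega>\<close>.\<close>

definition has_L1_density_over ::
    "(real^'n::finite) measure \<Rightarrow> (real^'n) set \<Rightarrow> (real^'n \<Rightarrow> real) \<Rightarrow> bool" where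
  "has_L1_density_over P \<Omega> f \<longleftrightarrow>
     set_integrable lborel \<Omega> f \<and>
     (\<forall>E\<in>sets borel. E \<subseteq> \<Omega> \<longrightarrow> measure P E = (LINT z:E|lborel. f z))"

definition geometric_cdf :: "(real^'n::finite) measure \<Rightarrow> real^'n \<Rightarrow> real^'n" where
  "geometric_cdf P x = (LINT z|P. indicat_real {z. z \<noteq> x} z *\<^sub>R ((x - z) /\<^sub>R norm (x - z)))"

section \<open>Test functions\<close>

definition schwartz :: "(real^'n::finite \<Rightarrow> complex) set" where
  "schwartz = {\<psi>. smooth \<psi> \<and>
     (\<forall>N \<alpha>. bounded (range (\<lambda>x. (1 + norm x) ^ N *\<^sub>R iter_partial \<alpha> \<psi> x)))}"

definition S_half :: "(real^'n::finite \<Rightarrow> complex) set" where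
  "S_half = {\<psi>. smooth \<psi> \<and>
     (\<forall>\<alpha>. bounded (range (\<lambda>x. (1 + norm x ^ (CARD('n) + 1)) *\<^sub>R iter_partial \<alpha> \<psi> x)))}"

definition test_fun_on :: "(real^'n::finite) set \<Rightarrow> (real^'n \<Rightarrow> complex) set" where
  "test_fun_on \<Omega> = {\<psi>. smooth \<psi> \<and> compact (closure {x. \<psi> x \<noteq> 0}) \<and> closure {x. \<psi> x \<noteq> 0} \<subseteq> \<Omega>}"

section \<open>Fourier transform and fractional Laplacian on Schwartz functions\<close>

definition fourier :: "(real^'n::finite \<Rightarrow> complex) \<Rightarrow> real^'n \<Rightarrow> complex" where
  "fourier u \<xi> = (LINT x|lborel. u x * exp (- 2 * \<i> * of_real pi * of_real (x \<bullet> \<xi>)))"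

definition inv_fourier :: "(real^'n::finite \<Rightarrow> complex) \<Rightarrow> real^'n \<Rightarrow> complex" where
  "inv_fourier v x = (LINT \<xi>|lborel. v \<xi> * exp (2 * \<i> * of_real pi * of_real (x \<bullet> \<xi>)))"

definition frac_laplacian ::
    "real \<Rightarrow> (real^'n::finite \<Rightarrow> complex) \<Rightarrow> real^'n \<Rightarrow> complex" where
  "frac_laplacian s \<psi> x =
     of_real ((2 * pi) powr (2 * s)) *
     inv_fourier (\<lambda>\<xi>. of_real (norm \<xi> powr (2 * s)) * fourier \<psi> \<xi>) x"

section \<open>Distributions\<close>

text \<open>The elements of the dual of \<^term>\<open>S_half\<close> (resp. tempered distributions) are functionals
  that are undefined off \<^term>\<open>S_half\<close> (resp. off \<^term>\<open>schwartz\<close>).  The operations below are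
  given by the usual transposition formulas; linearity and continuity of the functionals
  produced here are consequences and are not built in.\<close>

type_synonym 'n distr = "(real^'n \<Rightarrow> complex) \<Rightarrow> complex"

definition distr_of_fun :: "(real^'n::finite \<Rightarrow> real) \<Rightarrow> 'n distr" where
  "distr_of_fun u = (\<lambda>\<phi>\<in>S_half. LINT x|lborel. of_real (u x) * \<phi> x)"

definition distr_deriv :: "'n::finite \<Rightarrow> 'n distr \<Rightarrow> 'n distr" where
  "distr_deriv i T = (\<lambda>\<phi>\<in>S_half. - T (partial_deriv i \<phi>))"

definition distr_divergence :: "(real^'n::finite \<Rightarrow> real^'n) \<Rightarrow> 'n distr" where
  "distr_divergence V = (\<lambda>\<phi>\<in>S_half. \<Sum>i\<in>UNIV. distr_deriv i (distr_of_fun (\<lambda>x. V x $ i)) \<phi>)"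

definition distr_neg_laplacian :: "'n::finite distr \<Rightarrow> 'n distr" where
  "distr_neg_laplacian T = (\<lambda>\<phi>\<in>S_half. - (\<Sum>i\<in>UNIV. distr_deriv i (distr_deriv i T) \<phi>))"

definition distr_half_laplacian :: "'n::finite distr \<Rightarrow> 'n distr" where
  "distr_half_laplacian T = (\<lambda>\<psi>\<in>schwartz. T (frac_laplacian (1/2) \<psi>))"

definition gamma_const :: "nat \<Rightarrow> real" where
  "gamma_const d =
     inverse (2 ^ d * pi powr ((real d - 1) / 2) * Gamma ((real d + 1) / 2))"

definition L_op :: "(real^'n::finite \<Rightarrow> real^'n) \<Rightarrow> 'n distr" where
  "L_op V = (\<lambda>\<psi>\<in>schwartz. of_real (gamma_const CARD('n)) *
     (if odd CARD('n)
      then (distr_neg_laplacian ^^ ((CARD('n) - 1) div 2)) (distr_divergence V)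
      else distr_half_laplacian
             ((distr_neg_laplacian ^^ ((CARD('n) - 2) div 2)) (distr_divergence V))) \<psi>)"

definition represented_on ::
    "(real^'n::finite) set \<Rightarrow> 'n distr \<Rightarrow> (real^'n \<Rightarrow> complex) \<Rightarrow> bool" where
  "represented_on \<Omega> T g \<longleftrightarrow>
     continuous_on \<Omega> g \<and> (\<forall>\<psi>\<in>test_fun_on \<Omega>. T \<psi> = (LINT x:\<Omega>|lborel. g x * \<psi> x))"

end

theory Submission
  imports Defs
begin

text \<open>
  \<^bold>\<open>Regularity.\<close>  Fix a function \<open>H(x) = x\<^sub>j (1 - \<parallel>x\<parallel>\<^sup>2)\<^sub>+\<^sup>N\<close>; it is compactly supported and of class
  \<open>C\<close> to any prescribed order.  Up to a constant, \<open>x\<^sub>j / \<parallel>x\<parallel>\<close> is the integral of \<open>H(s x) / s\<close> over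
  \<open>s > 0\<close>.  The layers with \<open>s\<close> small add up to a smooth kernel with bounded derivatives, and those with
  \<open>s\<close> large only see the density \<open>f\<close> near the point.  After \<open>k\<close> derivatives have been put on \<open>f\<close>,
  a further derivative of order \<open>m \<ge> 1\<close> falls on \<open>H\<close>, where it has mean zero; subtracting the value of
  the \<open>\<beta>\<close>-Hoelder function at the point bounds the layer by a multiple of \<open>s\<close> to the power
  \<open>m - 1 - d - \<beta>\<close>.  This is integrable at infinity for \<open>m \<le> d\<close>, and the Hoelder bound for \<open>m = d\<close>
  follows by splitting the integral at the inverse distance of the two points.

  \<^bold>\<open>Identity.\<close>  By Fubini it suffices to pair \<open>x\<^sub>j / \<parallel>x\<parallel>\<close> with derivatives of an inverse Fourier
  transform.  The Gamma integral writes \<open>x\<^sub>j / \<parallel>x\<parallel>\<close> as a superposition of the functions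
  \<open>x\<^sub>j exp(- t \<parallel>x\<parallel>\<^sup>2)\<close>, whose Fourier transforms are explicit; integrating over \<open>t\<close> again yields
  a power of \<open>\<parallel>\<xi>\<parallel>\<close> that cancels the symbol of the operator and leaves the Fourier inversion formula.
  For even \<open>d\<close> one also needs that the half Laplacian of a test function decays like \<open>\<parallel>x\<parallel>\<close> to the
  power \<open>- d - 1\<close>, which comes from subordinating \<open>\<parallel>\<xi>\<parallel>\<close> to the heat semigroup.
\<close>

section \<open>Partial derivatives\<close>

text \<open>A derivative of order d of x_j / |x| is homogeneous of degree -d and in general not
  integrable at the origin, so it cannot be put under an integral against the density. A single
  layer is compactly supported and as smooth as desired; every differentiation under an integral
  sign therefore happens layer by layer, without principal values. The layers with small s have to
  absorb the part of P outside Omega, where nothing is known about it; this works because their sum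
  has derivatives bounded on the whole space and P is finite. On the Fourier side the transform of
  x_i / |x| would be a multiple of xi_i / |xi|^(d+1), again homogeneous of degree -d. It is met only
  after multiplication by the symbols of the divergence and of the power of the Laplacian, which
  leaves (xi_i / |xi|)^2; the sum over i is 1, and the constant left over is, up to sign, the
  inverse of gamma_d. The operators on distributions have a meaningful value only on
  \<open>S_half\<close>, so each function to which they are applied has to be shown to lie there. In
  a word of coordinates the last letters act first: the derivatives meant for the density stand at
  the end.\<close>

definition has_partial ::
    "'n::finite \<Rightarrow> (real^'n \<Rightarrow> 'b::real_normed_vector) \<Rightarrow> real^'n \<Rightarrow> 'b \<Rightarrow> bool" where
  "has_partial i u x D \<longleftrightarrow> ((\<lambda>t. u (x + t *\<^sub>R axis i 1)) has_vector_derivative D) (at 0)"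

lemma partial_deriv_eq: "has_partial i u x D \<Longrightarrow> partial_deriv i u x = D"
  unfolding has_partial_def partial_deriv_def by (rule vector_derivative_at)

lemma differentiable_iff_has_partial:
  "(\<lambda>t. u (x + t *\<^sub>R axis i 1)) differentiable (at 0) \<longleftrightarrow> has_partial i u x (partial_deriv i u x)"
  unfolding has_partial_def partial_deriv_def by (rule vector_derivative_works)

text \<open>Moving the base point along a coordinate line amounts to moving the parameter. This
  makes the one-dimensional mean value inequality available along such a line.\<close>

lemma has_partial_shift:
  "has_partial i u (x + s *\<^sub>R axis i 1) D \<longleftrightarrow>
     ((\<lambda>t. u (x + t *\<^sub>R axis i 1)) has_vector_derivative D) (at s)"
proof -
  have "((\<lambda>t. u (x + t *\<^sub>R axis i 1)) has_vector_derivative D) (at s) \<longleftrightarrow>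
        ((\<lambda>t. u (x + t *\<^sub>R axis i 1)) \<circ> (\<lambda>t. s + t) has_vector_derivative D) (at 0)"
    (is "?A \<longleftrightarrow> ?B")
  proof
    assume ?A
    have "((\<lambda>t::real. s + t) has_vector_derivative 1) (at 0)"
      by (auto intro!: derivative_eq_intros)
    from vector_diff_chain_at[OF this, of "\<lambda>t. u (x + t *\<^sub>R axis i 1)" D] \<open>?A\<close> show ?B by simp
  next
    assume ?B
    have "((\<lambda>t::real. t - s) has_vector_derivative 1) (at s)"
      by (auto intro!: derivative_eq_intros)
    from vector_diff_chain_at[OF this, of "(\<lambda>t. u (x + t *\<^sub>R axis i 1)) \<circ> (\<lambda>t. s + t)" D] \<open>?B\<close>
    show ?A by (simp add: o_def)
  qed
  then show ?thesis by (simp add: has_partial_def o_def scaleR_add_left add.assoc)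
qed

lemma has_partial_cong:
  fixes x :: "real^'n::finite"
  assumes "open S" "x \<in> S" "\<And>y. y \<in> S \<Longrightarrow> u y = v y" "has_partial i u x D"
  shows "has_partial i v x D"
  unfolding has_partial_def
proof (rule has_vector_derivative_transform_within_open)
  have "continuous_on UNIV (\<lambda>t::real. x + t *\<^sub>R axis i 1)" by (intro continuous_intros)
  then show "open ((\<lambda>t::real. x + t *\<^sub>R axis i 1) -` S)"
    using assms(1) by (simp add: continuous_on_open_vimage)
  show "((\<lambda>t. u (x + t *\<^sub>R axis i 1)) has_vector_derivative D) (at 0)"
    using assms(4) by (simp add: has_partial_def)
  show "0 \<in> (\<lambda>t::real. x + t *\<^sub>R axis i 1) -` S" using assms(2) by simp
  show "u (x + t *\<^sub>R axis i 1) = v (x + t *\<^sub>R axis i 1)"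
    if "t \<in> (\<lambda>t::real. x + t *\<^sub>R axis i 1) -` S" for t
    using that by (intro assms(3)) simp
qed

text \<open>\<open>vector_derivative\<close> is a choice among all possible derivatives, and near x
  both functions admit the same ones; so the equality also covers points without a
  derivative.\<close>

lemma partial_deriv_cong:
  fixes x :: "real^'n::finite"
  assumes "open S" "x \<in> S" "\<And>y. y \<in> S \<Longrightarrow> u y = v y"
  shows "partial_deriv i u x = partial_deriv i v x"
proof -
  have "has_partial i u x D \<longleftrightarrow> has_partial i v x D" for D
  proof
    show "has_partial i u x D \<Longrightarrow> has_partial i v x D"
      by (rule has_partial_cong[OF assms(1,2)]) (rule assms(3))
    show "has_partial i v x D \<Longrightarrow> has_partial i u x D"
      by (rule has_partial_cong[OF assms(1,2)]) (rule assms(3)[symmetric])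
  qed
  then show ?thesis unfolding has_partial_def partial_deriv_def vector_derivative_def by simp
qed

lemma iter_partial_cong:
  assumes "open S" "x \<in> S" "\<And>y. y \<in> S \<Longrightarrow> u y = v y"
  shows "iter_partial \<alpha> u x = iter_partial \<alpha> v x"
  using assms(2)
proof (induction \<alpha> arbitrary: x)
  case (Cons i \<alpha>)
  show ?case unfolding iter_partial.simps
    by (rule partial_deriv_cong[OF assms(1) Cons.prems]) (rule Cons.IH)
qed (use assms in auto)

lemma iter_partial_append: "iter_partial (\<alpha> @ \<gamma>) u = iter_partial \<alpha> (iter_partial \<gamma> u)"
  by (induction \<alpha>) auto

lemma iter_partial_zero: "iter_partial \<alpha> (\<lambda>x. 0) = (\<lambda>x. 0)"
  by (induction \<alpha>) (auto simp: partial_deriv_def)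

lemma has_partial_add:
  "has_partial i u x D \<Longrightarrow> has_partial i v x E \<Longrightarrow> has_partial i (\<lambda>x. u x + v x) x (D + E)"
  unfolding has_partial_def by (intro derivative_eq_intros) auto

lemma has_partial_const: "has_partial i (\<lambda>x. c) x 0"
  unfolding has_partial_def by (intro derivative_eq_intros) auto

lemma has_partial_mult:
  fixes u v :: "real^'n::finite \<Rightarrow> 'b::real_normed_algebra"
  shows "has_partial i u x D \<Longrightarrow> has_partial i v x E \<Longrightarrow>
    has_partial i (\<lambda>x. u x * v x) x (u x * E + D * v x)"
  unfolding has_partial_def by (drule (1) has_vector_derivative_mult) simp

lemma has_partial_linear:
  "bounded_linear L \<Longrightarrow> has_partial i u x D \<Longrightarrow> has_partial i (\<lambda>x. L (u x)) x (L D)"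
  unfolding has_partial_def by (rule bounded_linear.has_vector_derivative)

lemma has_partial_nth: "has_partial i (\<lambda>x. x $ j) x (if i = j then 1 else 0)"
proof -
  have "((\<lambda>t. x $ j + t * c) has_vector_derivative c) (at 0)" for c :: real
    by (auto intro!: derivative_eq_intros)
  from this[of "axis i 1 $ j"] show ?thesis unfolding has_partial_def
    by (cases "i = j") (simp_all add: axis_def)
qed

lemma has_partial_real_comp:
  fixes u :: "real^'n::finite \<Rightarrow> real" and g :: "real \<Rightarrow> 'b::real_normed_vector"
  assumes "has_partial i u x D" "(g has_vector_derivative E) (at (u x))"
  shows "has_partial i (\<lambda>x. g (u x)) x (D *\<^sub>R E)"
  using vector_diff_chain_at[of "\<lambda>t. u (x + t *\<^sub>R axis i 1)" D 0 g E] assms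
  by (simp add: has_partial_def o_def)

lemma has_partial_scale:
  fixes u :: "real^'n::finite \<Rightarrow> 'b::real_normed_vector"
  assumes "has_partial i u (s *\<^sub>R x + a) D"
  shows "has_partial i (\<lambda>x. u (s *\<^sub>R x + a)) x (s *\<^sub>R D)"
proof -
  have "((\<lambda>t::real. s * t) has_vector_derivative s) (at 0)"
    by (auto intro!: derivative_eq_intros)
  from vector_diff_chain_at[OF this, of "\<lambda>t. u (s *\<^sub>R x + a + t *\<^sub>R axis i 1)" D] assms
  show ?thesis by (simp add: has_partial_def o_def scaleR_add_right algebra_simps)
qed

section \<open>The classes of k times continuously differentiable functions\<close>

lemma Ck_on_0: "Ck_on 0 S u \<longleftrightarrow> continuous_on S u"
  by (simp add: Ck_on_def)

text \<open>Peels off the last letter, that is, the derivative taken first, whereas the recursion of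
  \<open>iter_partial\<close> peels off the first letter.\<close>

lemma words_Suc:
  fixes Q :: "'a list \<Rightarrow> bool"
  shows "(\<forall>\<alpha>. length \<alpha> \<le> Suc k \<longrightarrow> Q \<alpha>) \<longleftrightarrow>
    Q [] \<and> (\<forall>i \<alpha>. length \<alpha> \<le> k \<longrightarrow> Q (\<alpha> @ [i]))"
proof (intro iffI conjI allI impI)
  fix \<alpha> :: "'a list" assume *: "Q [] \<and> (\<forall>i \<alpha>. length \<alpha> \<le> k \<longrightarrow> Q (\<alpha> @ [i]))" "length \<alpha> \<le> Suc k"
  show "Q \<alpha>" by (cases \<alpha> rule: rev_cases) (use * in auto)
qed auto

text \<open>Recursion on the innermost derivative: u is replaced by \<open>partial_deriv i u\<close>
  and the order drops by one. All inductions on k with arbitrary u rest on this form.\<close>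

lemma Ck_on_Suc:
  "Ck_on (Suc k) S u \<longleftrightarrow> continuous_on S u \<and>
     (\<forall>i. (\<forall>x\<in>S. has_partial i u x (partial_deriv i u x)) \<and> Ck_on k S (partial_deriv i u))"
proof -
  have "(\<forall>\<alpha>. length \<alpha> < Suc k \<longrightarrow> (\<forall>i. \<forall>x\<in>S. (\<lambda>t. iter_partial \<alpha> u (x + t *\<^sub>R axis i 1)) differentiable (at 0)))
    \<longleftrightarrow> (\<forall>i. \<forall>x\<in>S. has_partial i u x (partial_deriv i u x)) \<and>
    (\<forall>j \<alpha>. length \<alpha> < k \<longrightarrow> (\<forall>i. \<forall>x\<in>S. (\<lambda>t. iter_partial \<alpha> (partial_deriv j u) (x + t *\<^sub>R axis i 1)) differentiable (at 0)))"
    (is "(\<forall>\<alpha>. _ \<longrightarrow> ?Q \<alpha>) \<longleftrightarrow> _")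
  proof (cases k)
    case (Suc k')
    then show ?thesis using words_Suc[of k' ?Q]
      by (simp add: less_Suc_eq_le iter_partial_append differentiable_iff_has_partial)
  qed (simp add: differentiable_iff_has_partial)
  moreover have "(\<forall>\<alpha>. length \<alpha> \<le> Suc k \<longrightarrow> continuous_on S (iter_partial \<alpha> u)) \<longleftrightarrow> continuous_on S u \<and>
    (\<forall>j \<alpha>. length \<alpha> \<le> k \<longrightarrow> continuous_on S (iter_partial \<alpha> (partial_deriv j u)))"
    using words_Suc[of k "\<lambda>\<alpha>. continuous_on S (iter_partial \<alpha> u)"] by (simp add: iter_partial_append)
  ultimately show ?thesis unfolding Ck_on_def by blast
qed

lemma Ck_on_cong:
  assumes "open S" "\<And>x. x \<in> S \<Longrightarrow> u x = v x"
  shows "Ck_on k S u \<longleftrightarrow> Ck_on k S v"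
  using assms
proof (induction k arbitrary: u v)
  case 0 then show ?case by (simp add: Ck_on_0 cong: continuous_on_cong)
next
  case (Suc k)
  have "Ck_on k S (partial_deriv i u) = Ck_on k S (partial_deriv i v)" for i
    by (rule Suc.IH[OF Suc.prems(1)]) (rule partial_deriv_cong[OF Suc.prems(1)], use Suc.prems in auto)
  moreover have "has_partial i u x (partial_deriv i u x) \<longleftrightarrow> has_partial i v x (partial_deriv i v x)"
    if "x \<in> S" for i x
  proof
    have eq: "partial_deriv i u x = partial_deriv i v x"
      by (rule partial_deriv_cong[OF Suc.prems(1) that]) (rule Suc.prems(2))
    show "has_partial i u x (partial_deriv i u x) \<Longrightarrow> has_partial i v x (partial_deriv i v x)"
      unfolding eq by (rule has_partial_cong[OF Suc.prems(1) that]) (rule Suc.prems(2))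
    show "has_partial i v x (partial_deriv i v x) \<Longrightarrow> has_partial i u x (partial_deriv i u x)"
      unfolding eq by (rule has_partial_cong[OF Suc.prems(1) that]) (rule Suc.prems(2)[symmetric])
  qed
  moreover have "continuous_on S u = continuous_on S v" using Suc.prems by (simp cong: continuous_on_cong)
  ultimately show ?case by (simp add: Ck_on_Suc)
qed

text \<open>Explicit candidates D replace the chosen derivatives; S is open, so agreement on S
  carries over to all higher derivatives there.\<close>

lemma Ck_on_SucI:
  assumes "open S" "continuous_on S u" "\<And>i x. x \<in> S \<Longrightarrow> has_partial i u x (D i x)"
    "\<And>i. Ck_on k S (D i)"
  shows "Ck_on (Suc k) S u"
proof -
  have "Ck_on k S (partial_deriv i u)" for i
    using assms(4)[of i] by (subst Ck_on_cong[OF assms(1), of _ "D i"]) (auto intro: partial_deriv_eq assms)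
  then show ?thesis unfolding Ck_on_Suc using assms partial_deriv_eq by metis
qed

lemma Ck_on_mono: "Ck_on k S u \<Longrightarrow> j \<le> k \<Longrightarrow> T \<subseteq> S \<Longrightarrow> Ck_on j T u"
  unfolding Ck_on_def
  by (metis continuous_on_subset le_trans less_le_trans subsetD)

lemma Ck_on_local:
  assumes "\<And>x. x \<in> S \<Longrightarrow> \<exists>V. open V \<and> x \<in> V \<and> Ck_on k V u"
  shows "Ck_on k S u"
proof -
  have "continuous_on S (iter_partial \<alpha> u)" if "length \<alpha> \<le> k" for \<alpha>
    unfolding continuous_on_eq_continuous_within
  proof
    fix x assume "x \<in> S"
    with assms obtain V where "open V" "x \<in> V" "Ck_on k V u" by blast
    then show "continuous (at x within S) (iter_partial \<alpha> u)"
      using that by (meson Ck_on_def continuous_at_imp_continuous_at_within continuous_on_eq_continuous_at)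
  qed
  then show ?thesis unfolding Ck_on_def using assms unfolding Ck_on_def by meson
qed

lemma Ck_on_continuous: "Ck_on k S u \<Longrightarrow> length \<alpha> \<le> k \<Longrightarrow> continuous_on S (iter_partial \<alpha> u)"
  by (simp add: Ck_on_def)

lemma Ck_on_has_partial: "Ck_on k S u \<Longrightarrow> length \<alpha> < k \<Longrightarrow> x \<in> S \<Longrightarrow>
    has_partial i (iter_partial \<alpha> u) x (iter_partial (i # \<alpha>) u x)"
  by (simp add: Ck_on_def differentiable_iff_has_partial)

text \<open>Lets an order be split as k + d: k derivatives go to the density, and the resulting
  functions are then shown to be of class C^d.\<close>

lemma Ck_on_add_order:
  "Ck_on (k + l) S u \<longleftrightarrow> Ck_on k S u \<and> (\<forall>\<alpha>. length \<alpha> = k \<longrightarrow> Ck_on l S (iter_partial \<alpha> u))"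
proof (induction k arbitrary: u)
  case 0
  have "Ck_on l S u \<Longrightarrow> continuous_on S u"
    using Ck_on_continuous[of l S u "[]"] by simp
  then show ?case by (auto simp: Ck_on_0)
next
  case (Suc k)
  have *: "(\<forall>\<alpha>. length \<alpha> = Suc k \<longrightarrow> Q \<alpha>) \<longleftrightarrow> (\<forall>i \<alpha>. length \<alpha> = k \<longrightarrow> Q (\<alpha> @ [i]))"
    for Q :: "'a list \<Rightarrow> bool"
  proof (intro iffI allI impI)
    fix \<alpha> :: "'a list" assume *: "\<forall>i \<alpha>. length \<alpha> = k \<longrightarrow> Q (\<alpha> @ [i])" "length \<alpha> = Suc k"
    show "Q \<alpha>" by (cases \<alpha> rule: rev_cases) (use * in auto)
  qed auto
  show ?case by (auto simp: Ck_on_Suc Suc * iter_partial_append)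
qed

lemma Ck_on_iter: "Ck_on k S u \<Longrightarrow> length \<alpha> + l \<le> k \<Longrightarrow> Ck_on l S (iter_partial \<alpha> u)"
  using Ck_on_add_order[of "length \<alpha>" l S u] Ck_on_mono[of k S u "length \<alpha> + l" S] by auto

lemma Ck_on_const: "open S \<Longrightarrow> Ck_on k S (\<lambda>x. c)"
proof (induction k arbitrary: c)
  case (Suc k) then show ?case
    by (intro Ck_on_SucI[where D="\<lambda>i x. 0"]) (auto intro: has_partial_const)
qed (simp add: Ck_on_0)

lemma Ck_on_add:
  assumes "open S" "Ck_on k S u" "Ck_on k S v" shows "Ck_on k S (\<lambda>x. u x + v x)"
  using assms(2,3)
proof (induction k arbitrary: u v)
  case (Suc k) then show ?case
    by (intro Ck_on_SucI[where D="\<lambda>i x. partial_deriv i u x + partial_deriv i v x"])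
       (auto simp: Ck_on_Suc assms intro!: has_partial_add continuous_intros)
qed (auto simp: Ck_on_0 intro!: continuous_intros)

lemma iter_partial_add:
  assumes "open S" "Ck_on k S u" "Ck_on k S v" "length \<alpha> \<le> k" "x \<in> S"
  shows "iter_partial \<alpha> (\<lambda>x. u x + v x) x = iter_partial \<alpha> u x + iter_partial \<alpha> v x"
  using assms(4,5)
proof (induction \<alpha> arbitrary: x)
  case (Cons i \<alpha>)
  have "has_partial i (\<lambda>x. iter_partial \<alpha> u x + iter_partial \<alpha> v x) x
     (iter_partial (i # \<alpha>) u x + iter_partial (i # \<alpha>) v x)"
    using Cons.prems assms by (intro has_partial_add Ck_on_has_partial) auto
  then have "has_partial i (iter_partial \<alpha> (\<lambda>x. u x + v x)) x
     (iter_partial (i # \<alpha>) u x + iter_partial (i # \<alpha>) v x)"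
    by (rule has_partial_cong[OF assms(1) Cons.prems(2), rotated]) (use Cons in auto)
  then show ?case unfolding iter_partial.simps by (rule partial_deriv_eq)
qed auto

lemma Ck_on_mult:
  fixes u v :: "real^'n::finite \<Rightarrow> 'b::real_normed_algebra"
  assumes "open S" "Ck_on k S u" "Ck_on k S v" shows "Ck_on k S (\<lambda>x. u x * v x)"
  using assms(2,3)
proof (induction k arbitrary: u v)
  case (Suc k)
  from Suc.prems have "Ck_on k S u" "Ck_on k S v" by (auto intro: Ck_on_mono)
  with Suc show ?case
    by (intro Ck_on_SucI[where D="\<lambda>i x. u x * partial_deriv i v x + partial_deriv i u x * v x"])
       (auto simp: Ck_on_Suc assms intro!: has_partial_mult continuous_intros Ck_on_add)
qed (auto simp: Ck_on_0 intro!: continuous_intros)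

lemma iter_partial_linear:
  assumes "open S" "bounded_linear L" "Ck_on k S u" "length \<alpha> \<le> k" "x \<in> S"
  shows "iter_partial \<alpha> (\<lambda>x. L (u x)) x = L (iter_partial \<alpha> u x)"
  using assms(4,5)
proof (induction \<alpha> arbitrary: x)
  case (Cons i \<alpha>)
  have "has_partial i (\<lambda>x. L (iter_partial \<alpha> u x)) x (L (iter_partial (i # \<alpha>) u x))"
    using Cons.prems assms by (intro has_partial_linear[OF assms(2)] Ck_on_has_partial[of k S]) auto
  then have "has_partial i (iter_partial \<alpha> (\<lambda>x. L (u x))) x (L (iter_partial (i # \<alpha>) u x))"
    by (rule has_partial_cong[OF assms(1) Cons.prems(2), rotated]) (use Cons in auto)
  then show ?case unfolding iter_partial.simps by (rule partial_deriv_eq)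
qed auto

lemma Ck_on_linear:
  assumes "open S" "bounded_linear L" "Ck_on k S u" shows "Ck_on k S (\<lambda>x. L (u x))"
  using assms(3)
proof (induction k arbitrary: u)
  case 0 then show ?case
    unfolding Ck_on_0 by (rule bounded_linear.continuous_on[OF assms(2)])
next
  case (Suc k)
  show ?case
  proof (rule Ck_on_SucI[OF assms(1), where D="\<lambda>i x. L (partial_deriv i u x)"])
    show "continuous_on S (\<lambda>x. L (u x))"
      using Suc.prems unfolding Ck_on_Suc by (intro bounded_linear.continuous_on[OF assms(2)]) simp
    show "has_partial i (\<lambda>x. L (u x)) x (L (partial_deriv i u x))" if "x \<in> S" for i x
      using Suc.prems that unfolding Ck_on_Suc by (intro has_partial_linear[OF assms(2)]) simp
    show "Ck_on k S (\<lambda>x. L (partial_deriv i u x))" for i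
      using Suc.prems unfolding Ck_on_Suc by (intro Suc.IH) simp
  qed
qed

lemma Ck_on_nth: "open S \<Longrightarrow> Ck_on k S (\<lambda>x::real^'n::finite. x $ j)"
proof (cases k)
  case 0
  have "continuous_on S (\<lambda>x::real^'n. x $ j)"
    by (rule linear_continuous_on[OF bounded_linear_vec_nth])
  then show ?thesis by (simp add: 0 Ck_on_0)
next
  case (Suc l)
  assume S: "open S"
  show ?thesis unfolding Suc
  proof (rule Ck_on_SucI[OF S, where D="\<lambda>i x. if i = j then 1 else 0"])
    show "continuous_on S (\<lambda>x. x $ j)" by (rule linear_continuous_on[OF bounded_linear_vec_nth])
    show "has_partial i (\<lambda>x. x $ j) x (if i = j then 1 else 0)" for i x by (rule has_partial_nth)
    show "Ck_on l S (\<lambda>x. if i = j then 1 else 0::real)" for i by (rule Ck_on_const[OF S])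
  qed
qed

text \<open>The chain rule for dilations and translations. The powers of s gained here, together
  with the volume of the support, give the whole scale dependence of a layer.\<close>

lemma
  fixes u :: "real^'n::finite \<Rightarrow> 'b::real_normed_vector"
  assumes "Ck_on k UNIV u"
  shows Ck_on_scale: "Ck_on k UNIV (\<lambda>x. u (s *\<^sub>R x + a))"
    and iter_partial_scale: "length \<alpha> \<le> k \<Longrightarrow>
      iter_partial \<alpha> (\<lambda>x. u (s *\<^sub>R x + a)) x = s ^ length \<alpha> *\<^sub>R iter_partial \<alpha> u (s *\<^sub>R x + a)"
proof -
  have *: "iter_partial \<alpha> (\<lambda>x. u (s *\<^sub>R x + a)) = (\<lambda>x. s ^ length \<alpha> *\<^sub>R iter_partial \<alpha> u (s *\<^sub>R x + a))"
    if "length \<alpha> \<le> k" for \<alpha>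
    using that
  proof (induction \<alpha>)
    case (Cons i \<alpha>)
    then have IH: "iter_partial \<alpha> (\<lambda>x. u (s *\<^sub>R x + a)) =
        (\<lambda>x. s ^ length \<alpha> *\<^sub>R iter_partial \<alpha> u (s *\<^sub>R x + a))" by (intro Cons.IH) simp
    have "has_partial i (\<lambda>x. s ^ length \<alpha> *\<^sub>R iter_partial \<alpha> u (s *\<^sub>R x + a)) x
        (s ^ length \<alpha> *\<^sub>R s *\<^sub>R iter_partial (i # \<alpha>) u (s *\<^sub>R x + a))" for x
      using Cons.prems
      by (intro has_partial_linear[OF bounded_linear_scaleR_right, where u="\<lambda>x. iter_partial \<alpha> u (s *\<^sub>R x + a)"]
          has_partial_scale[of i "iter_partial \<alpha> u"] Ck_on_has_partial[OF assms]) simp_all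
    then have "partial_deriv i (\<lambda>x. s ^ length \<alpha> *\<^sub>R iter_partial \<alpha> u (s *\<^sub>R x + a)) x =
        (s ^ length \<alpha> *\<^sub>R s *\<^sub>R iter_partial (i # \<alpha>) u (s *\<^sub>R x + a))" for x
      by (rule partial_deriv_eq)
    then show ?case unfolding iter_partial.simps(2) IH by (simp add: fun_eq_iff mult.commute)
  qed simp
  show "length \<alpha> \<le> k \<Longrightarrow>
      iter_partial \<alpha> (\<lambda>x. u (s *\<^sub>R x + a)) x = s ^ length \<alpha> *\<^sub>R iter_partial \<alpha> u (s *\<^sub>R x + a)"
    by (simp add: *)
  show "Ck_on k UNIV (\<lambda>x. u (s *\<^sub>R x + a))"
    using assms
  proof (induction k arbitrary: u)
    case 0 then show ?case
      by (auto simp: Ck_on_0 intro!: continuous_on_compose2[of UNIV u] continuous_intros)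
  next
    case (Suc k)
    show ?case
    proof (rule Ck_on_SucI[where D="\<lambda>i x. s *\<^sub>R partial_deriv i u (s *\<^sub>R x + a)"])
      show "continuous_on UNIV (\<lambda>x. u (s *\<^sub>R x + a))"
        using Suc.prems by (auto simp: Ck_on_Suc intro!: continuous_on_compose2[of UNIV u] continuous_intros)
      show "has_partial i (\<lambda>x. u (s *\<^sub>R x + a)) x (s *\<^sub>R partial_deriv i u (s *\<^sub>R x + a))" for i x
        using Suc.prems by (intro has_partial_scale[of i u]) (simp add: Ck_on_Suc)
      show "Ck_on k UNIV (\<lambda>x. s *\<^sub>R partial_deriv i u (s *\<^sub>R x + a))" for i
        using Suc.prems unfolding Ck_on_Suc
        by (intro Ck_on_linear[OF open_UNIV bounded_linear_scaleR_right,
            where u="\<lambda>x. partial_deriv i u (s *\<^sub>R x + a)"] Suc.IH) simp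
    qed simp
  qed
qed

section \<open>Differentiation under the integral sign\<close>

lemma continuous_on_integral_dominated:
  fixes h :: "'a::metric_space \<Rightarrow> 'w \<Rightarrow> 'b::{banach, second_countable_topology}"
  assumes "\<And>x. x \<in> S \<Longrightarrow> h x \<in> borel_measurable M"
    and "\<And>w. w \<in> space M \<Longrightarrow> continuous_on S (\<lambda>x. h x w)"
    and "integrable M g" "\<And>x w. x \<in> S \<Longrightarrow> w \<in> space M \<Longrightarrow> norm (h x w) \<le> g w"
  shows "continuous_on S (\<lambda>x. \<integral>w. h x w \<partial>M)"
  unfolding continuous_on_sequentially comp_def
proof (intro allI ballI impI)
  fix X :: "nat \<Rightarrow> 'a" and a assume a: "a \<in> S" and X: "(\<forall>n. X n \<in> S) \<and> X \<longlonglongrightarrow> a"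
  show "(\<lambda>n. \<integral>w. h (X n) w \<partial>M) \<longlonglongrightarrow> (\<integral>w. h a w \<partial>M)"
  proof (rule integral_dominated_convergence[where w=g])
    show "AE w in M. (\<lambda>n. h (X n) w) \<longlonglongrightarrow> h a w"
      using assms(2) a X by (intro AE_I2) (auto simp: continuous_on_sequentially comp_def)
  qed (use assms a X in auto)
qed

lemma has_vector_derivative_iff_quotient:
  fixes f :: "real \<Rightarrow> 'b::real_normed_vector"
  shows "(f has_vector_derivative D) (at x) \<longleftrightarrow> ((\<lambda>t. (f t - f x) /\<^sub>R (t - x)) \<longlongrightarrow> D) (at x)"
proof -
  have "norm ((f t - f x) /\<^sub>R (t - x) - D) = norm (f t - f x - (t - x) *\<^sub>R D) / norm (t - x)"
    if "t \<noteq> x" for t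
  proof -
    have "(f t - f x) /\<^sub>R (t - x) - D = (f t - f x - (t - x) *\<^sub>R D) /\<^sub>R (t - x)"
      using that by (simp add: scaleR_diff_right)
    then show ?thesis by (simp add: divide_inverse_commute)
  qed
  then have "((\<lambda>t. norm (f t - f x - (t - x) *\<^sub>R D) / norm (t - x)) \<longlongrightarrow> 0) (at x) \<longleftrightarrow>
      ((\<lambda>t. norm ((f t - f x) /\<^sub>R (t - x) - D)) \<longlongrightarrow> 0) (at x)"
    by (intro Lim_cong_within) auto
  then show ?thesis
    by (simp add: has_vector_derivative_def has_derivative_iff_norm bounded_linear_scaleR_left
        tendsto_norm_zero_iff Lim_null[of _ D, symmetric])
qed

text \<open>Dominated convergence for difference quotients: by the mean value inequality they obey
  the same majorant g as the derivative.\<close>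

lemma has_partial_integral:
  fixes h :: "real^'n::finite \<Rightarrow> 'w \<Rightarrow> 'b::{banach, second_countable_topology}"
  assumes "open S" "x \<in> S" and int: "\<And>y. y \<in> S \<Longrightarrow> integrable M (h y)"
    and der: "\<And>y w. y \<in> S \<Longrightarrow> w \<in> space M \<Longrightarrow> has_partial i (\<lambda>x. h x w) y (h' y w)"
    and meas: "h' x \<in> borel_measurable M"
    and g: "integrable M g" "\<And>y w. y \<in> S \<Longrightarrow> w \<in> space M \<Longrightarrow> norm (h' y w) \<le> g w"
  shows "has_partial i (\<lambda>x. \<integral>w. h x w \<partial>M) x (\<integral>w. h' x w \<partial>M)"
proof -
  from assms(1,2) obtain e where e: "e > 0" "ball x e \<subseteq> S" by (meson open_contains_ball)
  have inS: "x + t *\<^sub>R axis i 1 \<in> S" if "\<bar>t\<bar> < e" for t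
    using subsetD[OF e(2)] that by (simp add: dist_norm)
  define q where "q = (\<lambda>t w. (1 / t) *\<^sub>R (h (x + t *\<^sub>R axis i 1) w - h x w))"
  have "((\<lambda>t. \<integral>w. q t w \<partial>M) \<longlongrightarrow> (\<integral>w. h' x w \<partial>M)) (at 0)"
    unfolding tendsto_at_iff_sequentially comp_def
  proof (intro allI impI)
    fix X :: "nat \<Rightarrow> real" assume X0: "\<forall>n. X n \<in> UNIV - {0}" and X: "X \<longlonglongrightarrow> 0"
    have "\<forall>\<^sub>F n in sequentially. \<bar>X n\<bar> < e"
      using tendstoD[OF X e(1)] by (simp add: dist_real_def)
    then obtain N where N: "\<And>n. n \<ge> N \<Longrightarrow> \<bar>X n\<bar> < e" by (auto simp: eventually_sequentially)
    \<comment> \<open>Domination holds only for increments shorter than e, so the limit is taken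
      along a tail of the sequence.\<close>
    have "(\<lambda>n. \<integral>w. q (X (n + N)) w \<partial>M) \<longlonglongrightarrow> (\<integral>w. h' x w \<partial>M)"
    proof (rule integral_dominated_convergence[where w=g])
      show "AE w in M. (\<lambda>n. q (X (n + N)) w) \<longlonglongrightarrow> h' x w"
      proof (intro AE_I2)
        fix w assume w: "w \<in> space M"
        have "((\<lambda>t. q t w) \<longlongrightarrow> h' x w) (at 0)"
          using der[OF assms(2) w] unfolding has_partial_def q_def has_vector_derivative_iff_quotient
          by (simp add: inverse_eq_divide)
        then have "(\<lambda>n. q (X n) w) \<longlonglongrightarrow> h' x w"
          using X0 X by (auto simp: tendsto_at_iff_sequentially comp_def)
        then show "(\<lambda>n. q (X (n + N)) w) \<longlonglongrightarrow> h' x w" by (rule LIMSEQ_ignore_initial_segment)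
      qed
      show "AE w in M. norm (q (X (n + N)) w) \<le> g w" for n
      proof (intro AE_I2)
        fix w assume w: "w \<in> space M"
        define s where "s = X (n + N)"
        have s: "\<bar>s\<bar> < e" "s \<noteq> 0" using N X0 by (auto simp: s_def)
        have "norm (h (x + s *\<^sub>R axis i 1) w - h (x + 0 *\<^sub>R axis i 1) w) \<le> g w * norm (s - 0)"
        proof (rule differentiable_bound[where S="closed_segment 0 s" and
              f="\<lambda>t. h (x + t *\<^sub>R axis i 1) w" and f'="\<lambda>t r. r *\<^sub>R h' (x + t *\<^sub>R axis i 1) w"])
          fix t assume "t \<in> closed_segment 0 s"
          then have t: "\<bar>t\<bar> < e" using s by (auto simp: closed_segment_eq_real_ivl split: if_splits)
          from der[OF inS[OF t] w] show "((\<lambda>t. h (x + t *\<^sub>R axis i 1) w) has_derivative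
              (\<lambda>r. r *\<^sub>R h' (x + t *\<^sub>R axis i 1) w)) (at t within closed_segment 0 s)"
            unfolding has_partial_shift has_vector_derivative_def by (rule has_derivative_at_withinI)
          show "onorm (\<lambda>r. r *\<^sub>R h' (x + t *\<^sub>R axis i 1) w) \<le> g w"
            using g(2)[OF inS[OF t] w] order_trans[OF norm_ge_zero g(2)[OF inS[OF t] w]] by (intro onorm_bound) (auto simp: mult.commute mult_left_mono)
        qed auto
        then show "norm (q (X (n + N)) w) \<le> g w"
          using s unfolding q_def s_def[symmetric] norm_scaleR by (simp add: field_simps)
      qed
      show "q (X (n + N)) \<in> borel_measurable M" for n
        using int[OF inS, of "X (n + N)"] int[OF assms(2)] N unfolding q_def
        by (intro borel_measurable_scaleR borel_measurable_diff) auto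
    qed (use g meas in auto)
    then show "(\<lambda>n. \<integral>w. q (X n) w \<partial>M) \<longlonglongrightarrow> (\<integral>w. h' x w \<partial>M)" by (rule LIMSEQ_offset)
  qed
  moreover have "\<forall>\<^sub>F t in at 0. (\<integral>w. q t w \<partial>M) =
      (1 / t) *\<^sub>R ((\<integral>w. h (x + t *\<^sub>R axis i 1) w \<partial>M) - (\<integral>w. h x w \<partial>M))"
    unfolding eventually_at
  proof (intro exI[of _ e] conjI ballI impI)
    fix t :: real assume "t \<noteq> 0 \<and> dist t 0 < e"
    then show "(\<integral>w. q t w \<partial>M) =
      (1 / t) *\<^sub>R ((\<integral>w. h (x + t *\<^sub>R axis i 1) w \<partial>M) - (\<integral>w. h x w \<partial>M))"
      unfolding q_def using int[OF inS, of t] int[OF assms(2)] by simp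
  qed (use e in auto)
  ultimately have "((\<lambda>t. (1 / t) *\<^sub>R ((\<integral>w. h (x + t *\<^sub>R axis i 1) w \<partial>M) - (\<integral>w. h x w \<partial>M)))
      \<longlongrightarrow> (\<integral>w. h' x w \<partial>M)) (at 0)"
    by (rule Lim_transform_eventually)
  then show ?thesis unfolding has_partial_def has_vector_derivative_iff_quotient
    by (simp add: inverse_eq_divide)
qed

text \<open>A majorant is asked for each word separately, so that the result for one derivative can
  be applied to every \<open>iter_partial \<alpha>\<close> in turn.\<close>

lemma
  fixes h :: "real^'n::finite \<Rightarrow> 'w \<Rightarrow> 'b::{banach, second_countable_topology}"
  assumes S: "open S" and Ck: "\<And>w. w \<in> space M \<Longrightarrow> Ck_on m S (\<lambda>x. h x w)"
    and meas: "\<And>\<alpha> x. length \<alpha> \<le> m \<Longrightarrow> x \<in> S \<Longrightarrow> (\<lambda>w. iter_partial \<alpha> (\<lambda>x. h x w) x) \<in> borel_measurable M"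
    and bd: "\<And>\<alpha>. length \<alpha> \<le> m \<Longrightarrow> \<exists>g. integrable M g \<and>
       (\<forall>x\<in>S. \<forall>w\<in>space M. norm (iter_partial \<alpha> (\<lambda>x. h x w) x) \<le> g w)"
  shows Ck_on_integral: "Ck_on m S (\<lambda>x. \<integral>w. h x w \<partial>M)"
    and iter_partial_integral: "length \<alpha> \<le> m \<Longrightarrow> x \<in> S \<Longrightarrow>
      iter_partial \<alpha> (\<lambda>x. \<integral>w. h x w \<partial>M) x = (\<integral>w. iter_partial \<alpha> (\<lambda>x. h x w) x \<partial>M)"
proof -
  let ?J = "\<lambda>\<alpha> x. \<integral>w. iter_partial \<alpha> (\<lambda>x. h x w) x \<partial>M"
  have int: "integrable M (\<lambda>w. iter_partial \<alpha> (\<lambda>x. h x w) x)" if "length \<alpha> \<le> m" "x \<in> S" for \<alpha> x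
  proof -
    from bd[OF that(1)] obtain g where g: "integrable M g"
       "\<forall>x\<in>S. \<forall>w\<in>space M. norm (iter_partial \<alpha> (\<lambda>x. h x w) x) \<le> g w" by blast
    show ?thesis
      by (rule Bochner_Integration.integrable_bound[OF g(1) meas[OF that]])
        (use g(2) that in \<open>auto intro!: AE_I2 intro: order_trans[OF _ abs_ge_self]\<close>)
  qed
  have cont: "continuous_on S (?J \<alpha>)" if "length \<alpha> \<le> m" for \<alpha>
  proof -
    from bd[OF that] obtain g where g: "integrable M g"
       "\<forall>x\<in>S. \<forall>w\<in>space M. norm (iter_partial \<alpha> (\<lambda>x. h x w) x) \<le> g w" by blast
    show ?thesis
      by (rule continuous_on_integral_dominated[OF _ _ g(1)])
        (use g(2) that meas Ck_on_continuous[OF Ck] in auto)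
  qed
  have part: "has_partial i (?J \<alpha>) x (?J (i # \<alpha>) x)" if "length \<alpha> < m" "x \<in> S" for \<alpha> i x
  proof -
    from bd[of "i # \<alpha>"] that obtain g where g: "integrable M g"
       "\<forall>x\<in>S. \<forall>w\<in>space M. norm (iter_partial (i # \<alpha>) (\<lambda>x. h x w) x) \<le> g w" by auto
    show ?thesis
    proof (rule has_partial_integral[OF S that(2), where g=g])
      show "has_partial i (iter_partial \<alpha> (\<lambda>x. h x w)) y (iter_partial (i # \<alpha>) (\<lambda>x. h x w) y)"
        if "y \<in> S" "w \<in> space M" for y w
        using that \<open>length \<alpha> < m\<close> by (intro Ck_on_has_partial[OF Ck])
      show "(\<lambda>w. iter_partial (i # \<alpha>) (\<lambda>x. h x w) x) \<in> borel_measurable M"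
        using that by (intro meas) auto
    qed (use g that int in auto)
  qed
  have eq: "iter_partial \<alpha> (?J []) x = ?J \<alpha> x" if "length \<alpha> \<le> m" "x \<in> S" for \<alpha> x
    using that
  proof (induction \<alpha> arbitrary: x)
    case (Cons i \<alpha>)
    have "has_partial i (iter_partial \<alpha> (?J [])) x (?J (i # \<alpha>) x)"
      by (rule has_partial_cong[OF S Cons.prems(2) _ part]) (use Cons in auto)
    then show ?case by (simp add: partial_deriv_eq)
  qed simp
  then show "length \<alpha> \<le> m \<Longrightarrow> x \<in> S \<Longrightarrow>
      iter_partial \<alpha> (\<lambda>x. \<integral>w. h x w \<partial>M) x = (\<integral>w. iter_partial \<alpha> (\<lambda>x. h x w) x \<partial>M)" by simp
  have "has_partial i (iter_partial \<alpha> (?J [])) x (iter_partial (i # \<alpha>) (?J []) x)"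
    if "length \<alpha> < m" "x \<in> S" for \<alpha> i x
  proof -
    have "has_partial i (iter_partial \<alpha> (?J [])) x (?J (i # \<alpha>) x)"
      by (rule has_partial_cong[OF S that(2) _ part[OF that]]) (use eq that in auto)
    moreover have "?J (i # \<alpha>) x = iter_partial (i # \<alpha>) (?J []) x"
      using that by (intro eq[symmetric]) auto
    ultimately show ?thesis by (simp only:)
  qed
  moreover have "continuous_on S (iter_partial \<alpha> (?J []))" if "length \<alpha> \<le> m" for \<alpha>
    using cont[OF that] eq that by (subst continuous_on_cong[of S S _ "?J \<alpha>"]) auto
  ultimately show "Ck_on m S (\<lambda>x. \<integral>w. h x w \<partial>M)"
    by (auto simp: Ck_on_def differentiable_iff_has_partial)
qed

section \<open>Integrals of powers and affine substitutions\<close>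

lemma has_bochner_integral_of_has_integral:
  fixes f :: "real \<Rightarrow> real"
  assumes "(f has_integral I) S" "\<And>x. x \<in> S \<Longrightarrow> 0 \<le> f x"
    and [measurable]: "f \<in> borel_measurable borel" "S \<in> sets borel"
  shows "has_bochner_integral lborel (\<lambda>x. indicator S x * f x) I"
proof -
  \<comment> \<open>Nonnegativity upgrades the gauge integral to an absolutely convergent one;
    measurability then allows the passage from the completed measure to
    \<open>lborel\<close>.\<close>
  have *: "f absolutely_integrable_on S"
    by (rule nonnegative_absolutely_integrable_1) (use assms in \<open>auto simp: integrable_on_def\<close>)
  then have "integrable lborel (\<lambda>x. indicator S x * f x)"
    by (simp add: set_integrable_def integrable_completion)
  moreover have "(LINT x|lebesgue. indicator S x * f x) = I"
    using set_lebesgue_integral_eq_integral(2)[OF *] assms(1)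
    by (simp add: set_lebesgue_integral_def integral_unique)
  ultimately show ?thesis
    by (simp add: has_bochner_integral_iff integral_completion)
qed

lemma has_bochner_integral_powr_atMost:
  fixes a c :: real
  assumes "a > -1" "c \<ge> 0"
  shows "has_bochner_integral lborel (\<lambda>s. indicator {0..c} s * s powr a) (c powr (a + 1) / (a + 1))"
  using assms by (intro has_bochner_integral_of_has_integral has_integral_powr_from_0) auto

lemma has_bochner_integral_powr_atLeast:
  fixes a c :: real
  assumes "a < -1" "c > 0"
  shows "has_bochner_integral lborel (\<lambda>s. indicator {c..} s * s powr a) (- (c powr (a + 1)) / (a + 1))"
  using assms by (intro has_bochner_integral_of_has_integral has_integral_powr_to_inf) auto

lemma integral_translate:
  fixes f :: "real^'n::finite \<Rightarrow> 'b::{banach, second_countable_topology}"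
  assumes [measurable]: "f \<in> borel_measurable borel"
  shows "(LINT x|lborel. f (a + x)) = (LINT x|lborel. f x)"
proof -
  have "(LINT x|lborel. f x) = (LINT x|distr lborel borel ((+) a). f x)"
    by (simp add: lborel_distr_plus)
  also have "\<dots> = (LINT x|lborel. f (a + x))" by (subst integral_distr) auto
  finally show ?thesis ..
qed

lemma
  fixes f :: "real^'n::finite \<Rightarrow> 'b::{banach, second_countable_topology}"
  assumes [measurable]: "f \<in> borel_measurable borel" and c: "c \<noteq> 0"
  shows integral_affine: "(LINT x|lborel. f x) = \<bar>c\<bar> ^ CARD('n) *\<^sub>R (LINT x|lborel. f (a + c *\<^sub>R x))"
    and integrable_affine: "integrable lborel (\<lambda>x. f (a + c *\<^sub>R x)) \<longleftrightarrow> integrable lborel f"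
proof -
  have [measurable]: "(\<lambda>x::real^'n. a + c *\<^sub>R x) \<in> borel \<rightarrow>\<^sub>M borel" by measurable
  have eq: "lborel = density (distr lborel borel (\<lambda>x::real^'n. a + c *\<^sub>R x)) (\<lambda>_. \<bar>c\<bar> ^ CARD('n))"
    using lborel_affine[OF c, of a] by simp
  have "(LINT x|lborel. f x) = (LINT x|density (distr lborel borel (\<lambda>x::real^'n. a + c *\<^sub>R x)) (\<lambda>_. \<bar>c\<bar> ^ CARD('n)). f x)"
    by (subst eq) (rule refl)
  also have "\<dots> = \<bar>c\<bar> ^ CARD('n) *\<^sub>R (LINT x|lborel. f (a + c *\<^sub>R x))"
    by (subst integral_density) (auto simp: integral_distr)
  finally show "(LINT x|lborel. f x) = \<bar>c\<bar> ^ CARD('n) *\<^sub>R (LINT x|lborel. f (a + c *\<^sub>R x))" .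
  have "integrable lborel f \<longleftrightarrow> integrable (density (distr lborel borel (\<lambda>x::real^'n. a + c *\<^sub>R x)) (\<lambda>_. \<bar>c\<bar> ^ CARD('n))) f"
    by (subst eq) (rule refl)
  also have "\<dots> \<longleftrightarrow> integrable lborel (\<lambda>x. f (a + c *\<^sub>R x))"
  proof -
    have "integrable lborel (\<lambda>x. \<bar>c\<bar> ^ CARD('n) *\<^sub>R f (a + c *\<^sub>R x)) \<longleftrightarrow> integrable lborel (\<lambda>x. f (a + c *\<^sub>R x))"
      using integrable_scaleR_right[of "inverse (\<bar>c\<bar> ^ CARD('n))" lborel "\<lambda>x. \<bar>c\<bar> ^ CARD('n) *\<^sub>R f (a + c *\<^sub>R x)"] c
      by auto
    then show ?thesis by (subst integrable_density) (simp_all add: integrable_distr_eq)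
  qed
  finally show "integrable lborel (\<lambda>x. f (a + c *\<^sub>R x)) \<longleftrightarrow> integrable lborel f" ..
qed

lemma integrable_indicator_cball:
  "integrable lborel (\<lambda>x. indicator (cball (a::real^'n::finite) r) x * (c::real))"
  using emeasure_lborel_cball_finite[of a r] by (simp add: integrable_mult_left_iff less_top[symmetric])

lemma measure_lborel_cball:
  fixes a :: "real^'n::finite"
  assumes "r \<ge> 0"
  shows "measure lborel (cball a r) = r ^ CARD('n) * measure lborel (cball (0::real^'n) 1)"
proof (cases "r = 0")
  case False
  have "measure lborel (cball a r) = (LINT x|lborel. indicator (cball a r) x)" by simp
  also have "\<dots> = \<bar>r\<bar> ^ CARD('n) *\<^sub>R (LINT x|lborel. indicator (cball a r) (a + r *\<^sub>R x))"
    using False by (intro integral_affine borel_measurable_indicator) simp_all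
  also have "(\<lambda>x. indicator (cball a r) (a + r *\<^sub>R x)) = (indicator (cball 0 1) :: real^'n \<Rightarrow> real)"
    using False assms by (auto simp: indicator_def dist_norm fun_eq_iff)
  finally show ?thesis using assms by simp
qed simp

section \<open>Compactly supported functions\<close>

lemma iter_partial_support:
  fixes u :: "real^'n::finite \<Rightarrow> 'b::real_normed_vector"
  assumes "closed T" "\<And>x. x \<notin> T \<Longrightarrow> u x = 0" "x \<notin> T"
  shows "iter_partial \<alpha> u x = 0"
proof -
  have "iter_partial \<alpha> u x = iter_partial \<alpha> (\<lambda>x. 0) x"
    by (rule iter_partial_cong[of "- T"]) (use assms in auto)
  then show ?thesis by (simp add: iter_partial_zero)
qed

text \<open>Only finitely many words have length at most m, so the maxima over the compact support
  combine into one constant.\<close>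

lemma compact_support_bounded:
  fixes u :: "real^'n::finite \<Rightarrow> 'b::real_normed_vector"
  assumes "Ck_on m UNIV u" "compact T" "\<And>x. x \<notin> T \<Longrightarrow> u x = 0"
  obtains M where "M \<ge> 0" "\<And>\<alpha> x. length \<alpha> \<le> m \<Longrightarrow> norm (iter_partial \<alpha> u x) \<le> M"
proof -
  have "\<exists>M. \<forall>x. norm (iter_partial \<alpha> u x) \<le> M" if "length \<alpha> \<le> m" for \<alpha>
  proof -
    have "bounded (iter_partial \<alpha> u ` T)"
      using Ck_on_continuous[OF assms(1) that] assms(2)
      by (intro compact_imp_bounded compact_continuous_image) (auto intro: continuous_on_subset)
    then obtain M where M: "\<And>x. x \<in> T \<Longrightarrow> norm (iter_partial \<alpha> u x) \<le> M"
      by (auto simp: bounded_iff)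
    have "norm (iter_partial \<alpha> u x) \<le> max M 0" for x
      using M[of x] iter_partial_support[OF compact_imp_closed[OF assms(2)] assms(3), where x=x and \<alpha>=\<alpha>]
      by (cases "x \<in> T") auto
    then show ?thesis by blast
  qed
  then obtain M where M: "\<And>\<alpha> x. length \<alpha> \<le> m \<Longrightarrow> norm (iter_partial \<alpha> u x) \<le> M \<alpha>" by metis
  define M' where "M' = Max (insert 0 (M ` {\<alpha>. set \<alpha> \<subseteq> UNIV \<and> length \<alpha> \<le> m}))"
  have fin: "finite {\<alpha>::'n list. set \<alpha> \<subseteq> UNIV \<and> length \<alpha> \<le> m}" by (rule finite_lists_length_le) simp
  show thesis
  proof (rule that[of M'])
    show "M' \<ge> 0" unfolding M'_def using fin by (intro Max_ge) auto
    show "norm (iter_partial \<alpha> u x) \<le> M'" if "length \<alpha> \<le> m" for \<alpha> x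
      using fin that unfolding M'_def by (intro order_trans[OF M[OF that]] Max_ge) auto
  qed
qed

text \<open>By translation invariance the integral of u(x + w) over w does not depend on x;
  differentiating this constant under the integral sign at x = 0 gives the claim.\<close>

lemma integral_partial_deriv_zero:
  fixes u :: "real^'n::finite \<Rightarrow> 'b::{banach, second_countable_topology}"
  assumes "Ck_on 1 UNIV u" "compact T" "\<And>x. x \<notin> T \<Longrightarrow> u x = 0"
  shows "(LINT x|lborel. partial_deriv i u x) = 0"
proof -
  have c: "continuous_on UNIV u" "continuous_on UNIV (partial_deriv i u)"
    using assms(1) by (auto simp: Ck_on_Suc Ck_on_0)
  then have [measurable]: "u \<in> borel_measurable borel" "partial_deriv i u \<in> borel_measurable borel"
    by (auto intro: borel_measurable_continuous_onI)
  obtain M where M: "M \<ge> 0" "\<And>\<alpha> x. length \<alpha> \<le> 1 \<Longrightarrow> norm (iter_partial \<alpha> u x) \<le> M"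
    using compact_support_bounded[OF assms] by metis
  obtain R where R: "\<And>x. x \<in> T \<Longrightarrow> norm x \<le> R" using compact_imp_bounded[OF assms(2)] by (auto simp: bounded_iff)
  \<comment> \<open>The radius R + 1 covers the supports of all translates by vectors shorter than
    1.\<close>
  define g where "g = (\<lambda>x::real^'n. indicator (cball 0 (R + 1)) x * M)"
  have bd: "norm (iter_partial \<alpha> u (y + w)) \<le> g w" if "y \<in> ball 0 1" "length \<alpha> \<le> 1" for \<alpha> y w
  proof (cases "y + w \<in> T")
    case True
    have "norm w \<le> norm (y + w) + norm y" using norm_triangle_ineq4[of "y + w" y] by simp
    then have "norm w \<le> R + 1" using R[OF True] that by simp
    then show ?thesis using M(2)[OF that(2), of "y + w"] by (simp add: g_def)
  qed (use iter_partial_support[OF compact_imp_closed[OF assms(2)] assms(3)] M in \<open>auto simp: g_def\<close>)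
  have "has_partial i (\<lambda>x. LINT w|lborel. u (x + w)) 0 (LINT w|lborel. partial_deriv i u (0 + w))"
  proof (rule has_partial_integral[where S="ball 0 1" and g=g and h="\<lambda>x w. u (x + w)"])
    show "integrable lborel (\<lambda>w. u (y + w))" if "y \<in> ball 0 1" for y
    proof (rule Bochner_Integration.integrable_bound)
      show "integrable lborel g" unfolding g_def by (rule integrable_indicator_cball)
      show "AE w in lborel. norm (u (y + w)) \<le> norm (g w)"
        using bd[OF that, of "[]"] by (intro AE_I2 order_trans[OF _ abs_ge_self[of "g _", folded real_norm_def]]) simp
    qed simp
    show "has_partial i (\<lambda>x. u (x + w)) y (partial_deriv i u (y + w))" for y w
      using has_partial_scale[of i u 1 y w "partial_deriv i u (y + w)"] assms(1)
      by (simp add: Ck_on_Suc)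
    show "norm (partial_deriv i u (y + w)) \<le> g w" if "y \<in> ball 0 1" for y w
      using bd[OF that, of "[i]"] by simp
    show "integrable lborel g" unfolding g_def by (rule integrable_indicator_cball)
  qed auto
  moreover have "(\<lambda>x. LINT w|lborel. u (x + w)) = (\<lambda>x. LINT w|lborel. u w)"
    by (simp add: integral_translate)
  ultimately have "has_partial i (\<lambda>x. LINT w|lborel. u w) 0 (LINT w|lborel. partial_deriv i u w)"
    by simp
  from partial_deriv_eq[OF this] partial_deriv_eq[OF has_partial_const[of i _ 0]] show ?thesis by metis
qed

text \<open>The coordinates of b are exchanged for those of a one at a time. Each exchange moves
  along a coordinate line and costs at most M |a - b|, which explains the factor
  \<open>CARD('n)\<close>.\<close>

lemma Ck_on_lipschitz:
  fixes u :: "real^'n::finite \<Rightarrow> 'b::real_normed_vector"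
  assumes "Ck_on 1 UNIV u" "\<And>i x. norm (partial_deriv i u x) \<le> M"
  shows "norm (u a - u b) \<le> M * real CARD('n) * norm (a - b)"
proof -
  have one: "norm (u (x + t *\<^sub>R axis i 1) - u x) \<le> M * \<bar>t\<bar>" for x i t
  proof -
    have "norm (u (x + t *\<^sub>R axis i 1) - u (x + 0 *\<^sub>R axis i 1)) \<le> M * norm (t - 0)"
    proof (rule differentiable_bound[where S=UNIV and f="\<lambda>t. u (x + t *\<^sub>R axis i 1)"
          and f'="\<lambda>t r. r *\<^sub>R partial_deriv i u (x + t *\<^sub>R axis i 1)"])
      show "((\<lambda>t. u (x + t *\<^sub>R axis i 1)) has_derivative (\<lambda>r. r *\<^sub>R partial_deriv i u (x + t *\<^sub>R axis i 1))) (at t)" for t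
      proof -
        have "has_partial i u (x + t *\<^sub>R axis i 1) (partial_deriv i u (x + t *\<^sub>R axis i 1))"
          using assms(1) by (simp add: Ck_on_Suc)
        then show ?thesis unfolding has_partial_shift has_vector_derivative_def .
      qed
      show "onorm (\<lambda>r. r *\<^sub>R partial_deriv i u (x + t *\<^sub>R axis i 1)) \<le> M" for t
        using assms(2)[of i "x + t *\<^sub>R axis i 1"] order_trans[OF norm_ge_zero assms(2)[of i "x + t *\<^sub>R axis i 1"]]
        by (intro onorm_bound) (simp_all add: mult.commute[of M] mult_left_mono)
    qed auto
    then show ?thesis by simp
  qed
  have M: "M \<ge> 0" using order_trans[OF norm_ge_zero assms(2)] .
  have "norm (u (\<chi> i. if i \<in> J then a $ i else b $ i) - u b) \<le> M * (real (card J) * norm (a - b))" for J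
  proof (induction J rule: infinite_finite_induct)
    case (insert j J)
    let ?c = "\<lambda>J. \<chi> i. if i \<in> J then a $ i else b $ i"
    have "?c (insert j J) = ?c J + (a $ j - b $ j) *\<^sub>R axis j 1"
      using insert by (auto simp: vec_eq_iff axis_def)
    then have "norm (u (?c (insert j J)) - u (?c J)) \<le> M * \<bar>a $ j - b $ j\<bar>" using one by simp
    also have "\<dots> \<le> M * norm (a - b)"
      using component_le_norm_cart[of "a - b" j] M by (intro mult_left_mono) auto
    finally have "norm (u (?c (insert j J)) - u b) \<le> M * norm (a - b) + M * (real (card J) * norm (a - b))"
      using norm_diff_triangle_le[OF _ insert.IH] by blast
    then show ?case using insert by (simp add: algebra_simps)
  qed auto
  from this[of UNIV] show ?thesis by (simp add: mult.assoc)
qed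

section \<open>Size and smoothness of the layers and of their superposition\<close>

lemma norm_integral_le_cball:
  fixes w :: "real^'n::finite \<Rightarrow> 'b::{banach, second_countable_topology}"
  assumes "\<And>z. norm (w z) \<le> indicator (cball x r) z * c" "r \<ge> 0"
  shows "norm (LINT z|lborel. w z) \<le> c * (r ^ CARD('n) * measure lborel (cball (0::real^'n) 1))"
proof -
  have "norm (LINT z|lborel. w z) \<le> (LINT z|lborel. indicator (cball x r) z * c)"
  proof (cases "integrable lborel w")
    case True
    then show ?thesis
      by (intro order_trans[OF integral_norm_bound] integral_mono integrable_norm
          integrable_indicator_cball assms)
  next
    case False
    moreover have "0 \<le> (LINT z|lborel. indicator (cball x r) z * c)"
      using order_trans[OF norm_ge_zero assms(1)] by (intro Bochner_Integration.integral_nonneg)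
    ultimately show ?thesis by (simp add: not_integrable_integral_eq)
  qed
  also have "\<dots> = c * measure lborel (cball x r)" by simp
  finally show ?thesis using assms(2) by (simp add: measure_lborel_cball[of r x])
qed

text \<open>For s > 0 this is the derivative \<alpha> of the convolution of g with H(s x) / s (see
  \<open>layer_derivs\<close>); the factor \<open>s ^ length \<alpha>\<close> is due to the chain
  rule.\<close>

definition layer ::
    "(real^'n::finite \<Rightarrow> real) \<Rightarrow> (real^'n \<Rightarrow> real) \<Rightarrow> 'n list \<Rightarrow> real \<Rightarrow> real^'n \<Rightarrow> real" where
  "layer H g \<alpha> s x = (LINT z|lborel. s ^ length \<alpha> / s * iter_partial \<alpha> H (s *\<^sub>R (x - z)) * g z)"

text \<open>In the intended instance H is \<open>bump n j\<close> and g is a derivative of order k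
  of the density, cut off to a ball. The cut-off is why the Hoelder bound is assumed only for x near
  x0 and z within 2 \<rho> of x. One derivative of H beyond the order d serves as Lipschitz constant
  of those of order d.\<close>

context
  fixes H g :: "real^'n::finite \<Rightarrow> real" and M G C \<beta> \<rho> r Vol :: real and x0 x1 :: "real^'n"
  assumes H: "Ck_on (Suc CARD('n)) UNIV H" "\<And>x. x \<notin> cball 0 1 \<Longrightarrow> H x = 0"
    and M: "M \<ge> 0" "\<And>\<alpha> x. length \<alpha> \<le> Suc CARD('n) \<Longrightarrow> \<bar>iter_partial \<alpha> H x\<bar> \<le> M"
    and g[measurable]: "g \<in> borel_measurable borel" and G: "\<And>z. \<bar>g z\<bar> \<le> indicator (cball x1 r) z * G"
    and \<beta>: "0 < \<beta>" "\<beta> < 1" and \<rho>: "0 < \<rho>" "\<rho> \<le> 1" and C: "C \<ge> 0"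
    and holder: "\<And>x z. x \<in> ball x0 \<rho> \<Longrightarrow> norm (z - x) \<le> 2 * \<rho> \<Longrightarrow> \<bar>g z - g x\<bar> \<le> C * norm (z - x) powr \<beta>"
    and Vol: "Vol = measure lborel (cball (0::real^'n) 1)"
begin

private lemma Vol_nonneg: "Vol \<ge> 0" by (simp add: Vol)

private lemma H_meas: "length \<alpha> \<le> Suc CARD('n) \<Longrightarrow> iter_partial \<alpha> H \<in> borel_measurable borel"
  by (intro borel_measurable_continuous_onI Ck_on_continuous[OF H(1)])

private lemma G': "\<bar>g z\<bar> \<le> \<bar>G\<bar>"
  using G[of z] by (cases "z \<in> cball x1 r") auto

private lemma g_int: "integrable lborel g"
  by (rule Bochner_Integration.integrable_bound[OF integrable_indicator_cball[of x1 r G]])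
    (use G in \<open>auto intro: order_trans[OF _ abs_ge_self]\<close>)

private lemma supp: "norm y > 1 \<Longrightarrow> iter_partial \<alpha> H y = 0"
  by (rule iter_partial_support[of "cball 0 1"]) (use H(2) in auto)

private lemma far: "s > 0 \<Longrightarrow> norm (x - z) > 1 / s \<Longrightarrow> iter_partial \<alpha> H (s *\<^sub>R (x - z)) = 0"
  by (intro supp) (simp only: norm_scaleR, simp add: field_simps)

private lemma H_int:
  assumes "length \<alpha> \<le> Suc CARD('n)" "s > 0"
  shows "integrable lborel (\<lambda>z. iter_partial \<alpha> H (s *\<^sub>R (x - z)))"
proof (rule Bochner_Integration.integrable_bound[OF integrable_indicator_cball[of x "1/s" M]])
  note H_meas[OF assms(1), measurable]
  show "(\<lambda>z. iter_partial \<alpha> H (s *\<^sub>R (x - z))) \<in> borel_measurable lborel" by measurable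
  have "norm (iter_partial \<alpha> H (s *\<^sub>R (x - z))) \<le> norm (indicator (cball x (1 / s)) z * M)" for z
    using far[OF assms(2), of x z \<alpha>] M(2)[OF assms(1), of "s *\<^sub>R (x - z)"]
    by (cases "norm (x - z) \<le> 1 / s") (auto simp: dist_norm)
  then show "AE z in lborel. norm (iter_partial \<alpha> H (s *\<^sub>R (x - z))) \<le> norm (indicator (cball x (1 / s)) z * M)"
    by simp
qed

private lemma Hg_int:
  assumes "length \<alpha> \<le> Suc CARD('n)"
  shows "integrable lborel (\<lambda>z. iter_partial \<alpha> H (s *\<^sub>R (x - z)) * g z)"
proof (rule Bochner_Integration.integrable_bound[OF integrable_mult_right[OF integrable_norm[OF g_int], of M]])
  note H_meas[OF assms(1), measurable]
  show "(\<lambda>z. iter_partial \<alpha> H (s *\<^sub>R (x - z)) * g z) \<in> borel_measurable lborel" by measurable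
qed (use M assms in \<open>auto simp: abs_mult intro!: mult_right_mono\<close>)

private lemma H_mean_zero:
  assumes "length \<alpha> \<le> Suc CARD('n)" "\<alpha> \<noteq> []" "s > 0"
  shows "(LINT z|lborel. iter_partial \<alpha> H (s *\<^sub>R (x - z))) = 0"
proof -
  obtain i \<gamma> where \<alpha>: "\<alpha> = i # \<gamma>" using assms(2) by (cases \<alpha>) auto
  have "(LINT z|lborel. iter_partial \<alpha> H z) = 0" unfolding \<alpha> iter_partial.simps
    by (rule integral_partial_deriv_zero[of _ "cball 0 1"])
      (use assms \<alpha> supp in \<open>auto intro!: Ck_on_iter[OF H(1)]\<close>)
  moreover have "(LINT z|lborel. iter_partial \<alpha> H z) =
      \<bar>-s\<bar> ^ CARD('n) *\<^sub>R (LINT z|lborel. iter_partial \<alpha> H (s *\<^sub>R x + (-s) *\<^sub>R z))"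
    using assms by (intro integral_affine H_meas) auto
  moreover have "s *\<^sub>R x + (-s) *\<^sub>R z = s *\<^sub>R (x - z)" for z by (simp add: scaleR_diff_right)
  ultimately show ?thesis using assms(3) by simp
qed

text \<open>Since the differentiated kernel has mean zero, any constant may be subtracted from g.
  With c = g x the Hoelder bound gains a factor of order s^(-\<beta>) on the support of radius 1 /
  s.\<close>

private lemma layer_alt:
  assumes "length \<alpha> \<le> Suc CARD('n)" "\<alpha> \<noteq> []" "s > 0"
  shows "layer H g \<alpha> s x = (LINT z|lborel. s ^ length \<alpha> / s * iter_partial \<alpha> H (s *\<^sub>R (x - z)) * (g z - c))"
proof -
  have "(LINT z|lborel. s ^ length \<alpha> / s * iter_partial \<alpha> H (s *\<^sub>R (x - z)) * (g z - c)) =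
    (LINT z|lborel. s ^ length \<alpha> / s * (iter_partial \<alpha> H (s *\<^sub>R (x - z)) * g z) -
       s ^ length \<alpha> / s * c * iter_partial \<alpha> H (s *\<^sub>R (x - z)))"
    by (intro Bochner_Integration.integral_cong refl) (simp only: left_diff_distrib right_diff_distrib mult_ac)
  also have "\<dots> = s ^ length \<alpha> / s * (LINT z|lborel. iter_partial \<alpha> H (s *\<^sub>R (x - z)) * g z) -
       s ^ length \<alpha> / s * c * (LINT z|lborel. iter_partial \<alpha> H (s *\<^sub>R (x - z)))"
    using Hg_int[OF assms(1), of s x] H_int[OF assms(1,3), of x]
    by (subst Bochner_Integration.integral_diff) simp_all
  also have "\<dots> = layer H g \<alpha> s x"
    by (simp add: H_mean_zero[OF assms] layer_def mult.assoc)
  finally show ?thesis ..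
qed

text \<open>Here s \<ge> 1, and the support of radius 1 / s \<le> \<rho> lies within reach of the
  Hoelder bound. For a nonempty word the exponent is \<open>length \<alpha>\<close> - 1 - \<beta> -
  d, at most -1 - \<beta>. The empty word offers no cancellation, but the factor 1 / s and the
  volume, at most of order 1 / s, give s^(-2), and \<beta> < 1.\<close>

private lemma layer_bound:
  assumes "length \<alpha> \<le> CARD('n)" "s \<ge> 1 / \<rho>" "x \<in> ball x0 \<rho>"
  shows "\<bar>layer H g \<alpha> s x\<bar> \<le> M * (C + \<bar>G\<bar>) * Vol * s powr (- 1 - \<beta>)"
proof -
  have "1 \<le> 1 / \<rho>" using \<rho> by simp
  then have s: "s \<ge> 1" "s > 0" using assms(2) by linarith+
  have s\<rho>: "1 / s \<le> \<rho>" using assms(2) s \<rho> by (simp add: field_simps)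
  have near: "iter_partial \<alpha> H (s *\<^sub>R (x - z)) = 0" if "z \<notin> cball x (1 / s)" for z
    using that s by (intro far) (simp_all add: dist_norm)
  show ?thesis
  proof (cases "\<alpha> = []")
    case True
    have "norm (layer H g \<alpha> s x) \<le> (1 / s * M * \<bar>G\<bar>) * ((1 / s) ^ CARD('n) * Vol)"
      unfolding layer_def Vol
    proof (rule norm_integral_le_cball[of _ x])
      show "norm (s ^ length \<alpha> / s * iter_partial \<alpha> H (s *\<^sub>R (x - z)) * g z) \<le>
          indicator (cball x (1 / s)) z * (1 / s * M * \<bar>G\<bar>)" for z
      proof (cases "z \<in> cball x (1 / s)")
        case t: True
        have "\<bar>iter_partial \<alpha> H (s *\<^sub>R (x - z))\<bar> * \<bar>g z\<bar> \<le> M * \<bar>G\<bar>"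
          using M assms(1) G' by (intro mult_mono) auto
        then show ?thesis using True t s by (simp add: abs_mult divide_right_mono)
      qed (simp add: near)
    qed (use s in auto)
    also have "(1 / s) ^ CARD('n) \<le> (1 / s) ^ 1"
      using s by (intro power_decreasing) (auto simp: Suc_le_eq)
    also have "(1 / s * M * \<bar>G\<bar>) * ((1 / s) ^ 1 * Vol) = M * \<bar>G\<bar> * Vol * (1 / s) ^ 2"
      by (simp add: power2_eq_square)
    also have "(1 / s) ^ 2 = s powr (-2)" using s by (simp add: powr_minus powr_numeral field_simps power_divide)
    also have "s powr (-2) \<le> s powr (- 1 - \<beta>)" using s \<beta> by (intro powr_mono) auto
    also have "M * \<bar>G\<bar> * Vol * s powr (- 1 - \<beta>) \<le> M * (C + \<bar>G\<bar>) * Vol * s powr (- 1 - \<beta>)"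
      using M C Vol_nonneg by (intro mult_right_mono mult_left_mono) auto
    finally show ?thesis using s M Vol_nonneg
      by (simp add: mult_left_mono mult_right_mono divide_right_mono)
  next
    case False
    have "norm (layer H g \<alpha> s x) \<le> (s ^ length \<alpha> / s * M * (C * (1 / s) powr \<beta>)) * ((1 / s) ^ CARD('n) * Vol)"
      unfolding layer_alt[OF le_SucI[OF assms(1)] False s(2), of x "g x"] Vol
    proof (rule norm_integral_le_cball[of _ x])
      show "norm (s ^ length \<alpha> / s * iter_partial \<alpha> H (s *\<^sub>R (x - z)) * (g z - g x)) \<le>
          indicator (cball x (1 / s)) z * (s ^ length \<alpha> / s * M * (C * (1 / s) powr \<beta>))" for z
      proof (cases "z \<in> cball x (1 / s)")
        case t: True
        then have z: "norm (z - x) \<le> 1 / s" by (simp add: dist_norm norm_minus_commute)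
        have "\<bar>g z - g x\<bar> \<le> C * norm (z - x) powr \<beta>"
          using z s\<rho> \<rho> by (intro holder assms) auto
        also have "\<dots> \<le> C * (1 / s) powr \<beta>"
          using z C \<beta> by (intro mult_left_mono powr_mono2) auto
        finally have "\<bar>g z - g x\<bar> \<le> C * (1 / s) powr \<beta>" .
        then have "\<bar>s ^ length \<alpha> / s * iter_partial \<alpha> H (s *\<^sub>R (x - z))\<bar> * \<bar>g z - g x\<bar> \<le>
            (s ^ length \<alpha> / s * M) * (C * (1 / s) powr \<beta>)"
          using M assms(1) s C unfolding abs_mult
          by (intro mult_mono) auto
        then show ?thesis using t by (simp add: abs_mult)
      qed (simp add: near)
    qed (use s in auto)
    also have "\<dots> = M * C * Vol * (s powr length \<alpha> * s powr -1 * s powr (-\<beta>) * s powr - CARD('n))"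
      using s by (simp add: powr_minus powr_realpow powr_divide field_simps power_divide)
    also have "s powr length \<alpha> * s powr -1 * s powr (-\<beta>) * s powr - CARD('n) =
        s powr (real (length \<alpha>) - 1 - \<beta> - CARD('n))"
      unfolding powr_add[symmetric] by (rule arg_cong[where f="\<lambda>e. s powr e"]) simp
    also have "s powr (real (length \<alpha>) - 1 - \<beta> - CARD('n)) \<le> s powr (- 1 - \<beta>)"
      using s assms(1) by (intro powr_mono) auto
    also have "M * C * Vol * s powr (- 1 - \<beta>) \<le> M * (C + \<bar>G\<bar>) * Vol * s powr (- 1 - \<beta>)"
      using M C Vol_nonneg by (intro mult_right_mono mult_left_mono) auto
    finally show ?thesis using M C Vol_nonneg by (simp add: mult_left_mono)
  qed
qed

text \<open>Subtracting the same constant g x in both layers leaves a difference of kernels, at most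
  M d s |x - y|, on a ball of radius 2 / s around x; that ball contains both supports because |x -
  y| \<le> 1 / s. The powers s^(d-1), s, s^(-\<beta>) and s^(-d) multiply to s^(-\<beta>).\<close>

private lemma layer_diff_bound:
  assumes "length \<alpha> = CARD('n)" "s \<ge> 1 / \<rho>" "x \<in> ball x0 \<rho>" "y \<in> ball x0 \<rho>" "norm (x - y) \<le> 1 / s"
  shows "\<bar>layer H g \<alpha> s x - layer H g \<alpha> s y\<bar> \<le>
    M * CARD('n) * C * 2 ^ CARD('n) * 2 powr \<beta> * Vol * norm (x - y) * s powr (- \<beta>)"
proof -
  let ?\<psi> = "iter_partial \<alpha> H" and ?\<delta> = "norm (x - y)"
  have "1 \<le> 1 / \<rho>" using \<rho> by simp
  then have s: "s \<ge> 1" "s > 0" using assms(2) by linarith+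
  have s\<rho>: "1 / s \<le> \<rho>" using assms(2) s \<rho> by (simp add: field_simps)
  have ne: "\<alpha> \<noteq> []" using assms(1) by auto
  have le: "length \<alpha> \<le> Suc CARD('n)" using assms(1) by simp
  have int: "integrable lborel (\<lambda>z. s ^ length \<alpha> / s * ?\<psi> (s *\<^sub>R (u - z)) * (g z - g x))" for u
  proof -
    have "integrable lborel (\<lambda>z. s ^ length \<alpha> / s * (?\<psi> (s *\<^sub>R (u - z)) * g z - ?\<psi> (s *\<^sub>R (u - z)) * g x))"
      using Hg_int[OF le, of s u] H_int[OF le s(2), of u] by simp
    then show ?thesis
      by (rule Bochner_Integration.integrable_cong[THEN iffD1, rotated 2])
        (simp_all only: left_diff_distrib right_diff_distrib mult_ac)
  qed
  have lip: "\<bar>?\<psi> a - ?\<psi> b\<bar> \<le> M * real CARD('n) * norm (a - b)" for a b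
  proof -
    have "Ck_on 1 UNIV ?\<psi>" using assms(1) by (intro Ck_on_iter[OF H(1)]) simp
    moreover have "norm (partial_deriv i ?\<psi> z) \<le> M" for i z
      using M(2)[of "i # \<alpha>" z] assms(1) by simp
    ultimately show ?thesis using Ck_on_lipschitz[of ?\<psi> M a b] by simp
  qed
  have "layer H g \<alpha> s x - layer H g \<alpha> s y =
      (LINT z|lborel. s ^ length \<alpha> / s * (?\<psi> (s *\<^sub>R (x - z)) - ?\<psi> (s *\<^sub>R (y - z))) * (g z - g x))"
    unfolding layer_alt[OF le ne s(2), of _ "g x"]
    by (subst Bochner_Integration.integral_diff[OF int int, symmetric])
      (intro Bochner_Integration.integral_cong refl, simp only: right_diff_distrib left_diff_distrib mult_ac)
  also have "norm \<dots> \<le> (s ^ length \<alpha> / s * (M * real CARD('n) * (s * ?\<delta>)) * (C * (2 / s) powr \<beta>)) * ((2 / s) ^ CARD('n) * Vol)" unfolding Vol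
  proof (rule norm_integral_le_cball[of _ x])
    show "norm (s ^ length \<alpha> / s * (?\<psi> (s *\<^sub>R (x - z)) - ?\<psi> (s *\<^sub>R (y - z))) * (g z - g x)) \<le>
      indicator (cball x (2 / s)) z * (s ^ length \<alpha> / s * (M * real CARD('n) * (s * ?\<delta>)) * (C * (2 / s) powr \<beta>))" for z
    proof (cases "z \<in> cball x (2 / s)")
      case t: True
      then have z: "norm (z - x) \<le> 2 / s" by (simp add: dist_norm norm_minus_commute)
      have "\<bar>g z - g x\<bar> \<le> C * norm (z - x) powr \<beta>"
        using z s\<rho> \<rho> by (intro holder assms) (auto simp: field_simps)
      also have "\<dots> \<le> C * (2 / s) powr \<beta>"
        using z C \<beta> by (intro mult_left_mono powr_mono2) auto
      finally have 1: "\<bar>g z - g x\<bar> \<le> C * (2 / s) powr \<beta>" .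
      have "s *\<^sub>R (x - z) - s *\<^sub>R (y - z) = s *\<^sub>R (x - y)" by (simp add: algebra_simps)
      then have 2: "\<bar>?\<psi> (s *\<^sub>R (x - z)) - ?\<psi> (s *\<^sub>R (y - z))\<bar> \<le> M * real CARD('n) * (s * ?\<delta>)"
        using lip[of "s *\<^sub>R (x - z)" "s *\<^sub>R (y - z)"] s by simp
      have "\<bar>s ^ length \<alpha> / s * (?\<psi> (s *\<^sub>R (x - z)) - ?\<psi> (s *\<^sub>R (y - z)))\<bar> * \<bar>g z - g x\<bar> \<le>
          (s ^ length \<alpha> / s * (M * real CARD('n) * (s * ?\<delta>))) * (C * (2 / s) powr \<beta>)"
        unfolding abs_mult using s M C 1 2 by (intro mult_mono) auto
      then show ?thesis using t by (simp add: abs_mult)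
    next
      case False
      then have z: "norm (x - z) > 2 / s" by (simp add: dist_norm)
      have "norm (x - z) \<le> ?\<delta> + norm (y - z)" by (metis diff_add_cancel norm_triangle_ineq add_diff_eq)
      then have "norm (y - z) > 1 / s" using z assms(5) by (simp add: field_simps)
      moreover have "norm (x - z) > 1 / s" using z s by (simp add: field_simps)
      ultimately have "?\<psi> (s *\<^sub>R (x - z)) = 0" "?\<psi> (s *\<^sub>R (y - z)) = 0"
        using s by (auto intro!: far simp del: scaleR_diff_right)
      then show ?thesis using False by simp
    qed
  qed (use s in auto)
  also have "\<dots> = M * CARD('n) * C * 2 ^ CARD('n) * 2 powr \<beta> * Vol * ?\<delta> * s powr (- \<beta>)"
    using s assms(1) by (simp add: powr_divide powr_minus field_simps power_divide)
  finally show ?thesis by simp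
qed

private lemma layer_derivs:
  assumes "s > 0"
  shows "Ck_on CARD('n) UNIV (layer H g [] s)"
    and "length \<alpha> \<le> CARD('n) \<Longrightarrow> iter_partial \<alpha> (layer H g [] s) x = layer H g \<alpha> s x"
proof -
  have CH: "Ck_on CARD('n) UNIV H" using H(1) by (rule Ck_on_mono) auto
  have lin: "bounded_linear (\<lambda>y. 1 / s * y * g z)" for z
  proof -
    have "(\<lambda>y. 1 / s * y * g z) = (\<lambda>y. y * (g z / s))" by (simp add: fun_eq_iff)
    then show ?thesis by (simp only: bounded_linear_mult_left)
  qed
  have eqz: "s *\<^sub>R (x - z) = s *\<^sub>R x + (- s *\<^sub>R z)" for x z :: "real^'n" by (simp add: scaleR_diff_right)
  have Ck: "Ck_on CARD('n) UNIV (\<lambda>x. 1 / s * H (s *\<^sub>R (x - z)) * g z)" for z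
    unfolding eqz by (intro Ck_on_linear[OF open_UNIV lin, where u="\<lambda>x. H (s *\<^sub>R x + (- s *\<^sub>R z))"] Ck_on_scale CH)
  have it: "iter_partial \<alpha> (\<lambda>x. 1 / s * H (s *\<^sub>R (x - z)) * g z) x = s ^ length \<alpha> / s * iter_partial \<alpha> H (s *\<^sub>R (x - z)) * g z"
    if "length \<alpha> \<le> CARD('n)" for \<alpha> x z
  proof -
    have "iter_partial \<alpha> (\<lambda>x. 1 / s * H (s *\<^sub>R x + (- s *\<^sub>R z)) * g z) x =
        1 / s * iter_partial \<alpha> (\<lambda>x. H (s *\<^sub>R x + (- s *\<^sub>R z))) x * g z"
      by (rule iter_partial_linear[OF open_UNIV lin Ck_on_scale[OF CH] that UNIV_I])
    then show ?thesis unfolding eqz iter_partial_scale[OF CH that] by simp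
  qed
  have bd: "\<exists>b. integrable lborel b \<and> (\<forall>x\<in>UNIV. \<forall>z\<in>space lborel.
      norm (iter_partial \<alpha> (\<lambda>x. 1 / s * H (s *\<^sub>R (x - z)) * g z) x) \<le> b z)" if "length \<alpha> \<le> CARD('n)" for \<alpha>
  proof (intro exI conjI ballI)
    show "integrable lborel (\<lambda>z. s ^ length \<alpha> / s * M * \<bar>g z\<bar>)" using g_int by simp
    show "norm (iter_partial \<alpha> (\<lambda>x. 1 / s * H (s *\<^sub>R (x - z)) * g z) x) \<le> s ^ length \<alpha> / s * M * \<bar>g z\<bar>" for x z
      using M(2)[of \<alpha> "s *\<^sub>R (x - z)"] that assms unfolding it[OF that] norm_mult
      by (intro mult_mono) simp_all
  qed
  have meas: "(\<lambda>z. iter_partial \<alpha> (\<lambda>x. 1 / s * H (s *\<^sub>R (x - z)) * g z) x) \<in> borel_measurable lborel"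
    if "length \<alpha> \<le> CARD('n)" for \<alpha> x
  proof -
    have [measurable]: "iter_partial \<alpha> H \<in> borel_measurable borel" using that by (intro H_meas) simp
    show ?thesis unfolding it[OF that] by measurable
  qed
  have layer0: "layer H g [] s = (\<lambda>x. LINT z|lborel. 1 / s * H (s *\<^sub>R (x - z)) * g z)"
    by (simp add: layer_def fun_eq_iff)
  show "Ck_on CARD('n) UNIV (layer H g [] s)"
    unfolding layer0 by (rule Ck_on_integral[OF open_UNIV Ck meas bd])
  show "length \<alpha> \<le> CARD('n) \<Longrightarrow> iter_partial \<alpha> (layer H g [] s) x = layer H g \<alpha> s x"
    unfolding layer0
    by (rule trans[OF iter_partial_integral[OF open_UNIV Ck meas bd]]) (simp_all only: it layer_def UNIV_I)
qed

private abbreviation "Ms \<equiv> restrict_space lborel {1 / \<rho>..}"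

private lemma Ms_int: "integrable Ms (\<lambda>s. c * s powr (- 1 - \<beta>))"
proof -
  have "integrable lborel (\<lambda>s. c * (indicator {1 / \<rho>..} s * s powr (- 1 - \<beta>)))"
    using has_bochner_integral_powr_atLeast[of "- 1 - \<beta>" "1 / \<rho>"] \<beta> \<rho>
    by (intro integrable_mult_right) (auto simp: has_bochner_integral_iff)
  then show ?thesis by (simp add: integrable_restrict_space mult_ac)
qed

private lemma layer_meas: "length \<alpha> \<le> CARD('n) \<Longrightarrow> (\<lambda>s. layer H g \<alpha> s x) \<in> borel_measurable borel"
proof -
  assume "length \<alpha> \<le> CARD('n)"
  then have [measurable]: "iter_partial \<alpha> H \<in> borel_measurable borel" by (intro H_meas) simp
  show ?thesis unfolding layer_def by measurable
qed

text \<open>The majorant s^(-1-\<beta>) of \<open>layer_bound\<close> is the same for all orders up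
  to d and integrable at infinity because \<beta> > 0.\<close>

private lemma sum_layers_aux:
  shows "Ck_on CARD('n) (ball x0 \<rho>) (\<lambda>x. LINT s|Ms. layer H g [] s x)"
    and "length \<alpha> \<le> CARD('n) \<Longrightarrow> x \<in> ball x0 \<rho> \<Longrightarrow>
      iter_partial \<alpha> (\<lambda>x. LINT s|Ms. layer H g [] s x) x = (LINT s|Ms. layer H g \<alpha> s x)"
proof -
  have pos: "s > 0" if "s \<in> space Ms" for s
  proof -
    have "0 < 1 / \<rho>" using \<rho> by simp
    also have "1 / \<rho> \<le> s" using that by (simp add: space_restrict_space)
    finally show ?thesis .
  qed
  have Ck: "Ck_on CARD('n) (ball x0 \<rho>) (\<lambda>x. layer H g [] s x)" if "s \<in> space Ms" for s
    using layer_derivs(1)[OF pos[OF that]] by (rule Ck_on_mono) auto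
  have meas: "(\<lambda>s. iter_partial \<alpha> (\<lambda>x. layer H g [] s x) x) \<in> borel_measurable Ms"
    if "length \<alpha> \<le> CARD('n)" for \<alpha> x
  proof -
    have "(\<lambda>s. layer H g \<alpha> s x) \<in> borel_measurable Ms"
      using layer_meas[OF that] by (intro measurable_restrict_space1) simp
    then show ?thesis
      by (rule measurable_cong[THEN iffD1, rotated]) (simp add: layer_derivs(2)[OF pos that])
  qed
  have bd: "\<exists>b. integrable Ms b \<and> (\<forall>x\<in>ball x0 \<rho>. \<forall>s\<in>space Ms.
      norm (iter_partial \<alpha> (\<lambda>x. layer H g [] s x) x) \<le> b s)" if "length \<alpha> \<le> CARD('n)" for \<alpha>
  proof (intro exI conjI ballI)
    show "integrable Ms (\<lambda>s. M * (C + \<bar>G\<bar>) * Vol * s powr (- 1 - \<beta>))" by (rule Ms_int)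
    show "norm (iter_partial \<alpha> (layer H g [] s) x) \<le> M * (C + \<bar>G\<bar>) * Vol * s powr (- 1 - \<beta>)"
      if "x \<in> ball x0 \<rho>" "s \<in> space Ms" for x s
      using layer_bound[OF \<open>length \<alpha> \<le> CARD('n)\<close> _ that(1), of s] that(2)
      by (simp add: layer_derivs(2)[OF pos[OF that(2)] \<open>length \<alpha> \<le> CARD('n)\<close>] space_restrict_space)
  qed
  show "Ck_on CARD('n) (ball x0 \<rho>) (\<lambda>x. LINT s|Ms. layer H g [] s x)"
    by (rule Ck_on_integral[OF open_ball Ck meas bd])
  show "iter_partial \<alpha> (\<lambda>x. LINT s|Ms. layer H g [] s x) x = (LINT s|Ms. layer H g \<alpha> s x)"
    if "length \<alpha> \<le> CARD('n)" "x \<in> ball x0 \<rho>"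
    by (subst iter_partial_integral[OF open_ball Ck meas bd that])
      (auto intro!: Bochner_Integration.integral_cong simp: layer_derivs(2)[OF pos that(1)])
qed

lemma Ck_on_sum_layers: "Ck_on CARD('n) (ball x0 \<rho>) (\<lambda>x. LINT s|restrict_space lborel {1 / \<rho>..}. layer H g [] s x)"
  by (rule sum_layers_aux)

text \<open>The difference of a layer is estimated by its Lipschitz constant for \<open>s \<le> 1 / \<delta>\<close>
  and by its size for \<open>s \<ge> 1 / \<delta>\<close>, where \<open>\<delta>\<close> is the distance of the two points.\<close>

lemma holder_on_sum_layers:
  assumes "length \<alpha> = CARD('n)"
  shows "holder_on \<beta> (ball x0 \<rho>) (iter_partial \<alpha> (\<lambda>x. LINT s|restrict_space lborel {1 / \<rho>..}. layer H g [] s x))"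
proof -
  define B where "B = M * (C + \<bar>G\<bar>) * Vol"
  define D where "D = M * CARD('n) * C * 2 ^ CARD('n) * 2 powr \<beta> * Vol"
  have BD: "B \<ge> 0" "D \<ge> 0" using M C Vol_nonneg by (auto simp: B_def D_def)
  have le: "length \<alpha> \<le> CARD('n)" using assms by simp
  show ?thesis unfolding holder_on_def
  proof (intro exI ballI)
    fix x y assume xy: "x \<in> ball x0 \<rho>" "y \<in> ball x0 \<rho>"
    let ?F = "\<lambda>x. LINT s|Ms. layer H g [] s x" and ?\<delta> = "norm (x - y)"
    show "norm (iter_partial \<alpha> ?F x - iter_partial \<alpha> ?F y) \<le> (D / (1 - \<beta>) + 2 * B / \<beta>) * ?\<delta> powr \<beta>"
    proof (cases "x = y")
      case False
      then have \<delta>: "?\<delta> > 0" by simp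
      have int: "integrable Ms (\<lambda>s. layer H g \<alpha> s u)" if "u \<in> ball x0 \<rho>" for u
      proof (rule Bochner_Integration.integrable_bound[OF Ms_int[of B]])
        show "(\<lambda>s. layer H g \<alpha> s u) \<in> borel_measurable Ms"
          using layer_meas[OF le] by (intro measurable_restrict_space1) simp
        show "AE s in Ms. norm (layer H g \<alpha> s u) \<le> norm (B * s powr (- 1 - \<beta>))"
          using layer_bound[OF le _ that] BD by (intro AE_I2) (simp add: space_restrict_space B_def[symmetric])
      qed
      \<comment> \<open>Both parts integrate to multiples of \<delta>^\<beta>: the first converges
        at 0 because \<beta> < 1, the second at infinity because \<beta> > 0. The factor 2 arises
        because beyond 1 / \<delta> the two layers are estimated separately.\<close>
      let ?b = "\<lambda>s. D * ?\<delta> * (indicator {0..1/?\<delta>} s * s powr (- \<beta>)) +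
          2 * B * (indicator {1/?\<delta>..} s * s powr (- 1 - \<beta>))"
      have b: "has_bochner_integral lborel ?b (D * ?\<delta> * ((1/?\<delta>) powr (- \<beta> + 1) / (- \<beta> + 1)) +
          2 * B * (- ((1/?\<delta>) powr (- 1 - \<beta> + 1)) / (- 1 - \<beta> + 1)))"
        using \<beta> \<delta> by (intro has_bochner_integral_add has_bochner_integral_mult_right
            has_bochner_integral_powr_atMost has_bochner_integral_powr_atLeast) auto
      have "iter_partial \<alpha> ?F x - iter_partial \<alpha> ?F y = (LINT s|Ms. layer H g \<alpha> s x - layer H g \<alpha> s y)"
        using int xy by (simp add: sum_layers_aux(2)[OF le])
      also have "\<dots> = (LINT s|lborel. indicator {1/\<rho>..} s * (layer H g \<alpha> s x - layer H g \<alpha> s y))"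
        by (subst integral_restrict_space) auto
      finally have eq: "iter_partial \<alpha> ?F x - iter_partial \<alpha> ?F y =
          (LINT s|lborel. indicator {1/\<rho>..} s * (layer H g \<alpha> s x - layer H g \<alpha> s y))" .
      have "norm (iter_partial \<alpha> ?F x - iter_partial \<alpha> ?F y) \<le> integral\<^sup>L lborel ?b" unfolding eq
      proof (rule order_trans[OF integral_norm_bound integral_mono[OF integrable_norm]])
        show "integrable lborel (\<lambda>s. indicator {1/\<rho>..} s * (layer H g \<alpha> s x - layer H g \<alpha> s y))"
          using Bochner_Integration.integrable_diff[OF int int, OF xy]
          by (subst (asm) integrable_restrict_space) auto
        show "integrable lborel ?b" by (rule integrable.intros[OF b])
        show "norm (indicator {1/\<rho>..} s * (layer H g \<alpha> s x - layer H g \<alpha> s y)) \<le> ?b s" for s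
        proof (cases "s \<ge> 1 / \<rho>")
          case s: True
          have "0 < 1 / \<rho>" using \<rho> by simp
          with s have s0: "s > 0" by linarith
          show ?thesis
          proof (cases "s \<le> 1 / ?\<delta>")
            case True
            then have "?\<delta> \<le> 1 / s" using s0 \<delta> by (simp add: field_simps)
            from layer_diff_bound[OF assms s xy this]
            have "\<bar>layer H g \<alpha> s x - layer H g \<alpha> s y\<bar> \<le> D * ?\<delta> * s powr (- \<beta>)" by (simp add: D_def)
            moreover have "0 \<le> 2 * B * (indicator {1/?\<delta>..} s * s powr (- 1 - \<beta>))" using BD by simp
            ultimately have "\<bar>layer H g \<alpha> s x - layer H g \<alpha> s y\<bar> \<le> D * ?\<delta> * s powr (- \<beta>) +
                2 * B * (indicator {1/?\<delta>..} s * s powr (- 1 - \<beta>))" by linarith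
            then show ?thesis using True s s0 by simp
          next
            case False
            have "\<bar>layer H g \<alpha> s x - layer H g \<alpha> s y\<bar> \<le> 2 * B * s powr (- 1 - \<beta>)"
              using layer_bound[OF le s xy(1)] layer_bound[OF le s xy(2)] by (simp add: B_def)
            then show ?thesis using False s s0 by simp
          qed
        qed (use BD in simp)
      qed
      also have "\<dots> = D * ?\<delta> * ((1/?\<delta>) powr (- \<beta> + 1) / (- \<beta> + 1)) +
          2 * B * (- ((1/?\<delta>) powr (- 1 - \<beta> + 1)) / (- 1 - \<beta> + 1))"
        by (rule has_bochner_integral_integral_eq[OF b])
      also have "\<dots> = (D / (1 - \<beta>) + 2 * B / \<beta>) * ?\<delta> powr \<beta>"
      proof -
        have "?\<delta> * (1/?\<delta>) powr (- \<beta> + 1) = ?\<delta> powr \<beta>"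
        proof -
          have "?\<delta> * (1/?\<delta>) powr (- \<beta> + 1) = ?\<delta> powr 1 * ?\<delta> powr (\<beta> - 1)"
            using \<delta> by (simp add: powr_divide powr_minus_divide[symmetric])
          then show ?thesis unfolding powr_add[symmetric] by simp
        qed
        moreover have "(1/?\<delta>) powr (- 1 - \<beta> + 1) = ?\<delta> powr \<beta>"
          using \<delta> by (simp add: powr_divide powr_minus)
        moreover have "- \<beta> + 1 = 1 - \<beta>" by simp
        ultimately show ?thesis using \<beta> by (simp add: distrib_right mult.assoc)
      qed
      finally show ?thesis .
    qed simp
  qed
qed

end

section \<open>Truncated powers as compactly supported functions of finite smoothness\<close>

lemma has_partial_inner_self: "has_partial i (\<lambda>x::real^'n::finite. x \<bullet> x) x (2 * x $ i)"
proof -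
  have "(\<lambda>t. (x + t *\<^sub>R axis i 1) \<bullet> (x + t *\<^sub>R axis i 1)) = (\<lambda>t. x \<bullet> x + t * (2 * x $ i) + t * t)"
    by (simp add: fun_eq_iff inner_add_left inner_add_right inner_axis inner_commute[of "axis i 1"] algebra_simps)
  moreover have "((\<lambda>t. x \<bullet> x + t * (2 * x $ i) + t * t) has_vector_derivative 2 * x $ i) (at 0)"
    by (auto intro!: derivative_eq_intros)
  ultimately show ?thesis by (simp add: has_partial_def)
qed

lemma has_vector_derivative_truncated_power:
  fixes s :: real
  shows "((\<lambda>s. max s 0 ^ (n + 2)) has_vector_derivative real (n + 2) * max s 0 ^ (n + 1)) (at s)"
proof -
  consider "s < 0" | "s = 0" | "s > 0" by linarith
  then show ?thesis
  proof cases
    case 1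
    show ?thesis
    proof (rule has_vector_derivative_transform_within_open[of "\<lambda>s. 0" _ s "{..<0}"])
      show "((\<lambda>s. 0) has_vector_derivative real (n + 2) * max s 0 ^ (n + 1)) (at s)"
        using 1 by (auto intro!: derivative_eq_intros)
    qed (use 1 in auto)
  next
    case 2
    have "((\<lambda>t::real. max t 0 ^ (n + 1)) \<longlongrightarrow> max 0 0 ^ (n + 1)) (at 0)"
      by (intro tendsto_intros)
    moreover have "(max t 0 ^ (n + 2) - max 0 0 ^ (n + 2)) /\<^sub>R (t - 0) = max t 0 ^ (n + 1)" if "t \<noteq> 0" for t :: real
      using that by (cases "t > 0") (auto simp: field_simps)
    ultimately have "((\<lambda>t::real. (max t 0 ^ (n + 2) - max 0 0 ^ (n + 2)) /\<^sub>R (t - 0)) \<longlongrightarrow> 0) (at 0)"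
      by (subst Lim_cong_within[where g="\<lambda>t. max t 0 ^ (n + 1)"]) auto
    then show ?thesis unfolding has_vector_derivative_iff_quotient 2 by simp
  next
    case 3
    show ?thesis
    proof (rule has_vector_derivative_transform_within_open[of "\<lambda>s. s ^ (n + 2)" _ s "{0<..}"])
      have "((\<lambda>s. s ^ (n + 2)) has_field_derivative real (n + 2) * s ^ (n + 1)) (at s)"
        using DERIV_pow[of "n + 2" s UNIV] by simp
      then show "((\<lambda>s. s ^ (n + 2)) has_vector_derivative real (n + 2) * max s 0 ^ (n + 1)) (at s)"
        using 3 by (simp add: has_real_derivative_iff_has_vector_derivative max_def)
    qed (use 3 in auto)
  qed
qed

text \<open>The exponent \<open>n + 1\<close> is one above the order of smoothness that is wanted
  across the unit sphere.\<close>

definition trunc_pow :: "nat \<Rightarrow> real^'n::finite \<Rightarrow> real" where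
  "trunc_pow n x = max (1 - x \<bullet> x) 0 ^ (n + 1)"

lemma continuous_trunc_pow: "continuous_on S (trunc_pow n)"
  unfolding trunc_pow_def by (intro continuous_intros)

text \<open>The family is closed under differentiation up to polynomial factors: a partial
  derivative of the member \<open>Suc n\<close> is a multiple of x_i times the member n.\<close>

lemma Ck_on_trunc_pow: "Ck_on n UNIV (trunc_pow n :: real^'n::finite \<Rightarrow> real)"
proof (induction n)
  case 0
  show ?case by (simp add: Ck_on_0 continuous_trunc_pow)
next
  case (Suc n)
  show ?case
  proof (rule Ck_on_SucI[where D="\<lambda>i x. (-2 * real (n + 2)) * (x $ i * trunc_pow n x)"])
    show "has_partial i (trunc_pow (Suc n)) x ((-2 * real (n + 2)) * (x $ i * trunc_pow n x))" for i and x :: "real^'n"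
    proof -
      have "has_partial i (\<lambda>x. 1 + (-1) * (x \<bullet> x)) x (0 + (-1) * (2 * x $ i))"
        by (intro has_partial_add has_partial_const has_partial_linear[OF bounded_linear_mult_right, where u="\<lambda>x. x \<bullet> x"]
            has_partial_inner_self)
      from has_partial_real_comp[OF this has_vector_derivative_truncated_power[of n]]
      have *: "has_partial i (\<lambda>x. max (1 + - 1 * (x \<bullet> x)) 0 ^ (n + 2)) x
        ((0 + - 1 * (2 * x $ i)) *\<^sub>R (real (n + 2) * max (1 + - 1 * (x \<bullet> x)) 0 ^ (n + 1)))" .
      have "(0 + - 1 * (2 * x $ i)) *\<^sub>R (real (n + 2) * max (1 + - 1 * (x \<bullet> x)) 0 ^ (n + 1)) =
          (-2 * real (n + 2)) * (x $ i * trunc_pow n x)" by (simp add: trunc_pow_def algebra_simps)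
      moreover have "trunc_pow (Suc n) = (\<lambda>x::real^'n. max (1 + - 1 * (x \<bullet> x)) 0 ^ (n + 2))"
        by (simp add: trunc_pow_def fun_eq_iff)
      ultimately show ?thesis using * by (simp only:)
    qed
    show "Ck_on n UNIV (\<lambda>x::real^'n. (-2 * real (n + 2)) * (x $ i * trunc_pow n x))" for i
      by (intro Ck_on_mult Ck_on_const Ck_on_nth Suc.IH open_UNIV)
  qed (auto intro: continuous_trunc_pow)
qed

section \<open>Decomposition of the kernel into layers\<close>

definition bump :: "nat \<Rightarrow> 'n::finite \<Rightarrow> real^'n \<Rightarrow> real" where
  "bump n j x = x $ j * trunc_pow n x"

text \<open>For \<open>s > 0\<close> this is \<open>H (s x) / s\<close> with \<open>H = bump n j\<close>; the integral over \<open>s > 0\<close> is a constant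
  multiple of \<open>x\<^sub>j / \<parallel>x\<parallel>\<close>.\<close>

definition dilate :: "nat \<Rightarrow> 'n::finite \<Rightarrow> real^'n \<Rightarrow> real \<Rightarrow> real" where
  "dilate n j x s = x $ j * max (1 - s\<^sup>2 * (x \<bullet> x)) 0 ^ (n + 1)"

lemma Ck_on_bump: "Ck_on n UNIV (bump n j)"
  unfolding bump_def[abs_def] by (intro Ck_on_mult Ck_on_nth Ck_on_trunc_pow open_UNIV)

lemma bump_support: "x \<notin> cball 0 1 \<Longrightarrow> bump n j x = 0"
proof -
  assume "x \<notin> cball 0 1"
  then have "x \<bullet> x \<ge> 1" unfolding power2_norm_eq_inner[symmetric] by (intro one_le_power) simp
  then show ?thesis by (simp add: bump_def trunc_pow_def)
qed

lemma dilate_eq: "s > 0 \<Longrightarrow> dilate n j x s = 1 / s * bump n j (s *\<^sub>R x)"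
  by (simp add: dilate_def bump_def trunc_pow_def power2_eq_square mult.assoc)

text \<open>The factor x_j inside the bump cancels the 1 / s, so the dilates stay bounded as s tends
  to 0.\<close>

lemma dilate_abs_le: "\<bar>dilate n j x s\<bar> \<le> norm x"
proof -
  have "max (1 - s\<^sup>2 * (x \<bullet> x)) 0 ^ (n + 1) \<le> 1" by (intro power_le_one) auto
  then have "\<bar>x $ j\<bar> * max (1 - s\<^sup>2 * (x \<bullet> x)) 0 ^ (n + 1) \<le> \<bar>x $ j\<bar> * 1"
    by (intro mult_left_mono) auto
  then show ?thesis using component_le_norm_cart[of x j] by (simp add: dilate_def abs_mult)
qed

lemma dilate_far: "norm x * s > 1 \<Longrightarrow> s > 0 \<Longrightarrow> dilate n j x s = 0"
  by (simp add: dilate_eq bump_support mult.commute)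

lemma borel_measurable_vec_nth[measurable (raw)]:
  fixes f :: "'a \<Rightarrow> real^'n::finite"
  assumes [measurable]: "f \<in> borel_measurable M"
  shows "(\<lambda>w. f w $ j) \<in> borel_measurable M"
proof -
  have "(\<lambda>x::real^'n. x $ j) \<in> borel_measurable borel"
    by (intro borel_measurable_continuous_onI linear_continuous_on bounded_linear_vec_nth)
  from measurable_compose[OF assms this] show ?thesis .
qed

lemma dilate_measurable[measurable (raw)]:
  assumes [measurable]: "f \<in> borel_measurable M" "g \<in> borel_measurable M"
  shows "(\<lambda>w. dilate n j (f w) (g w)) \<in> borel_measurable M"
  unfolding dilate_def by measurable

definition trunc_mass :: "nat \<Rightarrow> real" where
  "trunc_mass n = (LINT s|lborel. indicator {0<..} s * max (1 - s\<^sup>2) 0 ^ (n + 1))"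

lemma trunc_mass_integrable: "integrable lborel (\<lambda>s::real. indicator {0<..} s * max (1 - s\<^sup>2) 0 ^ (n + 1))"
proof (rule Bochner_Integration.integrable_bound[of lborel "\<lambda>s. indicator {0..1} s * (1::real)"])
  have "norm (indicator {0<..} s * max (1 - s\<^sup>2) 0 ^ (n + 1)) \<le> norm (indicator {0..1} s * (1::real))" for s :: real
  proof (cases "0 < s \<and> s \<le> 1")
    case True
    moreover have "max (1 - s\<^sup>2) 0 ^ (n + 1) \<le> 1" by (intro power_le_one) auto
    ultimately show ?thesis by simp
  next
    case False
    then have "s \<le> 0 \<or> 1 \<le> s\<^sup>2" by (auto simp: one_le_power)
    then show ?thesis by auto
  qed
  then show "AE s in lborel. norm (indicator {0<..} s * max (1 - s\<^sup>2) 0 ^ (n + 1) :: real) \<le> norm (indicator {0..1} s * (1::real))"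
    by (intro AE_I2)
qed simp_all

lemma trunc_mass_pos: "trunc_mass n > 0"
proof -
  have "0 < (LINT s|lborel. indicator {0..1/2::real} s * (1/2 :: real) ^ (n + 1))" by simp
  also have "\<dots> \<le> trunc_mass n" unfolding trunc_mass_def
  proof (rule integral_mono_AE[OF _ trunc_mass_integrable])
    show "AE s in lborel. indicator {0..1/2} s * (1/2 :: real) ^ (n + 1) \<le>
        indicator {0<..} s * max (1 - s\<^sup>2) 0 ^ (n + 1)"
    \<comment> \<open>The two indicators disagree at s = 0; elsewhere on [0, 1/2] one has 1 - s^2
      \<ge> 1/2.\<close>
    proof (rule AE_I[where N="{0}"])
      show "{s \<in> space lborel. \<not> indicator {0..1/2} s * (1/2 :: real) ^ (n + 1) \<le>
          indicator {0<..} s * max (1 - s\<^sup>2) 0 ^ (n + 1)} \<subseteq> {0}"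
      proof
        fix s assume s: "s \<in> {s \<in> space lborel. \<not> indicator {0..1/2} s * (1/2 :: real) ^ (n + 1) \<le>
          indicator {0<..} s * max (1 - s\<^sup>2) 0 ^ (n + 1)}"
        show "s \<in> {0}"
        proof (rule ccontr)
          assume "s \<notin> {0}"
          then have "indicator {0..1/2} s * (1/2 :: real) ^ (n + 1) \<le>
              indicator {0<..} s * max (1 - s\<^sup>2) 0 ^ (n + 1)"
          proof (cases "s \<in> {0..1/2}")
            case True
            then have "s * s \<le> 1/2 * (1/2)" by (intro mult_mono) auto
            then have "(1/2 :: real) ^ (n + 1) \<le> max (1 - s\<^sup>2) 0 ^ (n + 1)"
              by (intro power_mono) (auto simp: power2_eq_square)
            then show ?thesis using True \<open>s \<notin> {0}\<close> by simp
          qed auto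
          with s show False by simp
        qed
      qed
    qed auto
    show "integrable lborel (\<lambda>s. indicator {0..1/2::real} s * (1/2 :: real) ^ (n + 1))"
      by (intro integrable_mult_left integrable_real_indicator emeasure_bounded_finite) simp_all
  qed
  finally show ?thesis .
qed

text \<open>Replacing |x| s by s removes x from the profile and produces the factor 1 / |x|. At x =
  0 both sides vanish, since division by 0 yields 0. The absolute version is bounded uniformly in x,
  which is what the exchange of integrals later needs.\<close>

lemma
  fixes x :: "real^'n::finite"
  shows dilate_integrable: "integrable lborel (\<lambda>s. indicator {0<..} s * dilate n j x s)"
    and dilate_integral: "(LINT s|lborel. indicator {0<..} s * dilate n j x s) = trunc_mass n * (x $ j / norm x)"
    and dilate_abs_integral_le: "(LINT s|lborel. indicator {0<..} s * \<bar>dilate n j x s\<bar>) \<le> trunc_mass n"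
proof -
  let ?f = "\<lambda>s::real. indicator {0<..} s * max (1 - s\<^sup>2) 0 ^ (n + 1)"
  have "integrable lborel (\<lambda>s. indicator {0<..} s * dilate n j x s) \<and>
     (LINT s|lborel. indicator {0<..} s * dilate n j x s) = trunc_mass n * (x $ j / norm x) \<and>
     (LINT s|lborel. indicator {0<..} s * \<bar>dilate n j x s\<bar>) = trunc_mass n * (\<bar>x $ j\<bar> / norm x)"
  proof (cases "x = 0")
    case False
    have eq: "indicator {0<..} s * max (1 - s\<^sup>2 * (x \<bullet> x)) 0 ^ (n + 1) = ?f (0 + norm x * s)" for s
      using False by (simp add: indicator_def power2_norm_eq_inner power_mult_distrib mult.commute zero_less_mult_iff)
    have int: "integrable lborel (\<lambda>s. ?f (0 + norm x * s))"
      using lborel_integrable_real_affine[OF trunc_mass_integrable[of n], of "norm x" 0] False by simp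
    have I: "(LINT s|lborel. ?f (0 + norm x * s)) = trunc_mass n / norm x"
      using lborel_integral_real_affine[of "norm x" ?f 0] False by (simp add: trunc_mass_def field_simps)
    have 1: "indicator {0<..} s * dilate n j x s = x $ j * ?f (0 + norm x * s)" for s
      unfolding eq[symmetric] by (simp add: dilate_def)
    have 2: "indicator {0<..} s * \<bar>dilate n j x s\<bar> = \<bar>x $ j\<bar> * ?f (0 + norm x * s)" for s
      unfolding eq[symmetric] by (simp add: dilate_def abs_mult)
    show ?thesis unfolding 1 2
      using integrable_mult_right[OF int, of "x $ j"]
      unfolding Bochner_Integration.integral_mult_right_zero I by (simp del: power_Suc)
  qed (simp add: dilate_def)
  moreover have "trunc_mass n * (\<bar>x $ j\<bar> / norm x) \<le> trunc_mass n * 1"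
    using component_le_norm_cart[of x j] trunc_mass_pos[of n]
    by (intro mult_left_mono) (auto simp: divide_le_eq_1)
  ultimately show "integrable lborel (\<lambda>s. indicator {0<..} s * dilate n j x s)"
    "(LINT s|lborel. indicator {0<..} s * dilate n j x s) = trunc_mass n * (x $ j / norm x)"
    "(LINT s|lborel. indicator {0<..} s * \<bar>dilate n j x s\<bar>) \<le> trunc_mass n" by auto
qed

lemma
  fixes x :: "real^'n::finite"
  assumes S[measurable]: "S \<in> sets borel" and "S \<subseteq> {0<..}"
  shows dilate_integrable_on: "integrable lborel (\<lambda>s. indicator S s * dilate n j x s)"
    and dilate_integral_on_le: "(LINT s|lborel. \<bar>indicator S s * dilate n j x s\<bar>) \<le> trunc_mass n"
    and dilate_integral_on_abs_le: "\<bar>LINT s|lborel. indicator S s * dilate n j x s\<bar> \<le> trunc_mass n"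
proof -
  have le: "\<bar>indicator S s * dilate n j x s\<bar> \<le> indicator {0<..} s * \<bar>dilate n j x s\<bar>" for s
    using assms(2) by (auto simp: indicator_def)
  have int': "integrable lborel (\<lambda>s. indicator {0<..} s * \<bar>dilate n j x s\<bar>)"
    using integrable_abs[OF dilate_integrable[of n j x]] by (simp add: abs_mult)
  show int: "integrable lborel (\<lambda>s. indicator S s * dilate n j x s)"
    by (rule Bochner_Integration.integrable_bound[OF int']) (use le in auto)
  have "(LINT s|lborel. \<bar>indicator S s * dilate n j x s\<bar>) \<le> (LINT s|lborel. indicator {0<..} s * \<bar>dilate n j x s\<bar>)"
    by (rule integral_mono[OF integrable_abs[OF int] int' le])
  also note dilate_abs_integral_le
  finally show *: "(LINT s|lborel. \<bar>indicator S s * dilate n j x s\<bar>) \<le> trunc_mass n" .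
  show "\<bar>LINT s|lborel. indicator S s * dilate n j x s\<bar> \<le> trunc_mass n"
    using integral_norm_bound[of lborel "\<lambda>s. indicator S s * dilate n j x s"] *
    by (simp only: real_norm_def)
qed

text \<open>A derivative of order m \<ge> 1 of a dilate is at most M s^(m-1), integrable over (0, S)
  and independent of x. The dilate itself is only bounded by |x|; hence smoothness is proved on
  balls and glued, while the global bound of order 0 comes from \<open>trunc_mass\<close>.\<close>

lemma remainder_derivs:
  fixes j :: "'n::finite" and S :: real and n :: nat
  assumes "S > 0"
  defines "R \<equiv> \<lambda>x. LINT s|lborel. indicator {0<..<S} s * dilate n j x s"
  shows "Ck_on n UNIV R" and "\<exists>B. \<forall>\<alpha> x. length \<alpha> \<le> n \<longrightarrow> \<bar>iter_partial \<alpha> R x\<bar> \<le> B"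
proof -
  let ?M = "restrict_space lborel {0<..<S}"
  obtain M where M: "M \<ge> 0" "\<And>\<alpha> x. length \<alpha> \<le> n \<Longrightarrow> norm (iter_partial \<alpha> (bump n j) x) \<le> M"
    using compact_support_bounded[OF Ck_on_bump[of n j] compact_cball[of 0 1] bump_support] by metis
  have pos: "s > 0" "s < S" if "s \<in> space ?M" for s using that by (auto simp: space_restrict_space)
  have dil: "(\<lambda>x. dilate n j x s) = (\<lambda>x. 1 / s * bump n j (s *\<^sub>R x + 0))" if "s > 0" for s
    using that by (simp add: dilate_eq)
  have Ck: "Ck_on n UNIV (\<lambda>x. dilate n j x s)" if "s \<in> space ?M" for s
    unfolding dil[OF pos(1)[OF that]]
    by (intro Ck_on_mult Ck_on_const Ck_on_scale Ck_on_bump open_UNIV)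
  have it: "iter_partial \<alpha> (\<lambda>x. dilate n j x s) x = s ^ length \<alpha> / s * iter_partial \<alpha> (bump n j) (s *\<^sub>R x)"
    if "s > 0" "length \<alpha> \<le> n" for s \<alpha> x
    unfolding dil[OF that(1)]
      iter_partial_linear[OF open_UNIV bounded_linear_mult_right Ck_on_scale[OF Ck_on_bump] that(2) UNIV_I]
      iter_partial_scale[OF Ck_on_bump that(2)] by simp
  have bd: "norm (iter_partial \<alpha> (\<lambda>x. dilate n j x s) x) \<le> (if \<alpha> = [] then r else S ^ (length \<alpha> - 1) * M)"
    if "x \<in> ball 0 r" "s \<in> space ?M" "length \<alpha> \<le> n" for r x s \<alpha>
  proof (cases "\<alpha> = []")
    case False
    then obtain m where m: "length \<alpha> = Suc m" by (cases \<alpha>) auto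
    show ?thesis using False M pos[OF that(2)] that(3) assms(1)
      by (simp add: it m abs_mult mult_mono power_mono)
  qed (use dilate_abs_le[of n j x s] that(1) in auto)
  have meas: "(\<lambda>s. iter_partial \<alpha> (\<lambda>x. dilate n j x s) x) \<in> borel_measurable ?M"
    if "length \<alpha> \<le> n" for \<alpha> x
  proof -
    have [measurable]: "iter_partial \<alpha> (bump n j) \<in> borel_measurable borel"
      by (intro borel_measurable_continuous_onI Ck_on_continuous[OF Ck_on_bump] that)
    have "(\<lambda>s. s ^ length \<alpha> / s * iter_partial \<alpha> (bump n j) (s *\<^sub>R x)) \<in> borel_measurable lborel"
      by measurable
    then have "(\<lambda>s. s ^ length \<alpha> / s * iter_partial \<alpha> (bump n j) (s *\<^sub>R x)) \<in> borel_measurable ?M"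
      by (rule measurable_restrict_space1)
    then show ?thesis
      by (rule measurable_cong[THEN iffD1, rotated]) (simp add: it[OF pos(1) that])
  qed
  have const: "integrable ?M (\<lambda>s. c::real)" for c
    by (subst integrable_restrict_space) (use assms(1) in \<open>auto intro!: integrable_mult_left integrable_real_indicator\<close>)
  have bd': "\<exists>g. integrable ?M g \<and> (\<forall>x\<in>ball 0 r. \<forall>s\<in>space ?M.
      norm (iter_partial \<alpha> (\<lambda>x. dilate n j x s) x) \<le> g s)" if "length \<alpha> \<le> n" for \<alpha> r
    by (rule exI[of _ "\<lambda>s. if \<alpha> = [] then r else S ^ (length \<alpha> - 1) * M"])
      (use bd[OF _ _ that, of _ r] const in blast)
  have R: "R = (\<lambda>x. LINT s|?M. dilate n j x s)"
    unfolding R_def by (subst integral_restrict_space) auto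
  have CkR: "Ck_on n (ball 0 r) R" for r
    unfolding R by (rule Ck_on_integral[OF open_ball Ck_on_mono[OF Ck order_refl subset_UNIV] meas bd'])
  show "Ck_on n UNIV R"
  proof (rule Ck_on_local)
    fix x :: "real^'n"
    show "\<exists>V. open V \<and> x \<in> V \<and> Ck_on n V R"
      by (rule exI[of _ "ball 0 (norm x + 1)"]) (simp add: CkR)
  qed
  have itR: "iter_partial \<alpha> R x = (LINT s|?M. iter_partial \<alpha> (\<lambda>x. dilate n j x s) x)"
    if "length \<alpha> \<le> n" for \<alpha> x
    unfolding R by (rule iter_partial_integral[where S="ball 0 (norm x + 1)",
          OF open_ball Ck_on_mono[OF Ck order_refl subset_UNIV] meas bd']) (use that in auto)
  \<comment> \<open>The sum over all orders m makes the bound independent of the word.\<close>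
  have "\<bar>iter_partial \<alpha> R x\<bar> \<le> trunc_mass n + (\<Sum>m\<le>n. S ^ (m - 1) * M * S)" if "length \<alpha> \<le> n" for \<alpha> x
  proof (cases "\<alpha> = []")
    case True
    have "\<bar>R x\<bar> \<le> trunc_mass n" unfolding R_def by (rule dilate_integral_on_abs_le) auto
    moreover have "(\<Sum>m\<le>n. S ^ (m - 1) * M * S) \<ge> 0" using assms(1) M by (intro sum_nonneg) auto
    ultimately show ?thesis using True by simp
  next
    case False
    have "norm (iter_partial \<alpha> R x) \<le> (LINT s|?M. norm (iter_partial \<alpha> (\<lambda>x. dilate n j x s) x))"
      unfolding itR[OF that] by (rule integral_norm_bound)
    also have "\<dots> \<le> (LINT s|?M. S ^ (length \<alpha> - 1) * M)"
    proof (rule integral_mono)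
      have b: "norm (iter_partial \<alpha> (\<lambda>x. dilate n j x s) x) \<le> S ^ (length \<alpha> - 1) * M" if "s \<in> space ?M" for s
        using bd[of x "norm x + 1" s \<alpha>] that \<open>length \<alpha> \<le> n\<close> False by simp
      then show "norm (iter_partial \<alpha> (\<lambda>x. dilate n j x s) x) \<le> S ^ (length \<alpha> - 1) * M" if "s \<in> space ?M" for s
        using that .
      show "integrable ?M (\<lambda>s. norm (iter_partial \<alpha> (\<lambda>x. dilate n j x s) x))"
        by (rule Bochner_Integration.integrable_bound[OF const[of "S ^ (length \<alpha> - 1) * M"]])
          (use meas[OF that] b in \<open>auto intro!: AE_I2 intro: order_trans[OF _ abs_ge_self]\<close>)
    qed (rule const)
    also have "\<dots> = S ^ (length \<alpha> - 1) * M * S"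
      using assms(1) by (subst integral_restrict_space) auto
    also have "\<dots> \<le> (\<Sum>m\<le>n. S ^ (m - 1) * M * S)"
      using that assms(1) M by (intro member_le_sum[of "length \<alpha>" "{..n}" "\<lambda>m. S ^ (m - 1) * M * S"]) auto
    finally show ?thesis using trunc_mass_pos[of n] by simp
  qed
  then show "\<exists>B. \<forall>\<alpha> x. length \<alpha> \<le> n \<longrightarrow> \<bar>iter_partial \<alpha> R x\<bar> \<le> B" by blast
qed

text \<open>Nothing is known about P, so the majorants are constants, integrable because P has mass
  1; this is why the derivatives of R have to be bounded on the whole space.\<close>

lemma convolution_derivs:
  fixes R :: "real^'n::finite \<Rightarrow> real"
  assumes P: "prob_space P" "sets P = sets borel" and R: "Ck_on n UNIV R"
    and B: "\<And>\<alpha> x. length \<alpha> \<le> n \<Longrightarrow> \<bar>iter_partial \<alpha> R x\<bar> \<le> B"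
  shows "Ck_on n UNIV (\<lambda>x. LINT z|P. R (x - z))"
    and "length \<alpha> \<le> n \<Longrightarrow> \<bar>iter_partial \<alpha> (\<lambda>x. LINT z|P. R (x - z)) x\<bar> \<le> B"
proof -
  interpret P: prob_space P by fact
  note [measurable_cong] = P(2)
  have eq: "(\<lambda>x. R (x - z)) = (\<lambda>x. R (1 *\<^sub>R x + - z))" for z by simp
  have Ck: "Ck_on n UNIV (\<lambda>x. R (x - z))" for z
    unfolding eq by (rule Ck_on_scale[OF R])
  have it: "iter_partial \<alpha> (\<lambda>x. R (x - z)) x = iter_partial \<alpha> R (x - z)" if "length \<alpha> \<le> n" for \<alpha> x z
    unfolding eq iter_partial_scale[OF R that] by simp
  have meas: "(\<lambda>z. iter_partial \<alpha> (\<lambda>x. R (x - z)) x) \<in> borel_measurable P" if "length \<alpha> \<le> n" for \<alpha> x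
  proof -
    have [measurable]: "iter_partial \<alpha> R \<in> borel_measurable borel"
      by (intro borel_measurable_continuous_onI Ck_on_continuous[OF R] that)
    show ?thesis unfolding it[OF that] by measurable
  qed
  have bd: "\<exists>g. integrable P g \<and> (\<forall>x\<in>UNIV. \<forall>z\<in>space P. norm (iter_partial \<alpha> (\<lambda>x. R (x - z)) x) \<le> g z)"
    if "length \<alpha> \<le> n" for \<alpha>
    using B[OF that] that by (intro exI[of _ "\<lambda>z. B"]) (simp add: it)
  show "Ck_on n UNIV (\<lambda>x. LINT z|P. R (x - z))"
    by (rule Ck_on_integral[OF open_UNIV Ck meas bd])
  assume \<alpha>: "length \<alpha> \<le> n"
  have "iter_partial \<alpha> (\<lambda>x. LINT z|P. R (x - z)) x = (LINT z|P. iter_partial \<alpha> (\<lambda>x. R (x - z)) x)"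
    by (rule iter_partial_integral[OF open_UNIV Ck meas bd \<alpha> UNIV_I])
  also have "\<bar>\<dots>\<bar> \<le> B"
  proof -
    have "norm (LINT z|P. iter_partial \<alpha> (\<lambda>x. R (x - z)) x) \<le>
        (LINT z|P. norm (iter_partial \<alpha> (\<lambda>x. R (x - z)) x))"
      by (rule integral_norm_bound)
    also have "\<dots> \<le> (LINT z|P. B)"
      using meas[OF \<alpha>, of x] B[OF \<alpha>]
      by (intro integral_mono integrable_norm P.integrable_const_bound[where B=B])
        (simp_all add: it[OF \<alpha>] order_trans[OF abs_ge_zero B[OF \<alpha>]])
    finally have "norm (LINT z|P. iter_partial \<alpha> (\<lambda>x. R (x - z)) x) \<le> (LINT z|P. B)" .
    then show ?thesis by (simp add: P.prob_space)
  qed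
  finally show "\<bar>iter_partial \<alpha> (\<lambda>x. LINT z|P. R (x - z)) x\<bar> \<le> B" .
qed

section \<open>Measures with a density over an open set\<close>

text \<open>The density is given only by its integrals over Borel subsets of \<Omega>. Its sign is
  recovered first; then P restricted to \<Omega> and the measure with this density agree on every
  Borel set, and integrals of functions vanishing off \<Omega> can be transferred.\<close>

lemma
  fixes P :: "(real^'n::finite) measure"
  assumes P: "prob_space P" "sets P = sets borel" and \<Omega>: "open \<Omega>" and f: "has_L1_density_over P \<Omega> f"
    and h[measurable]: "h \<in> borel_measurable borel" and h0: "\<And>z. z \<notin> \<Omega> \<Longrightarrow> h z = 0"
  shows integral_density_over: "(LINT z|P. h z) = (LINT z|lborel. (indicator \<Omega> z * f z) *\<^sub>R (h z :: 'b::{banach, second_countable_topology}))"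
proof -
  interpret P: prob_space P by fact
  note [measurable_cong] = P(2)
  define f' where "f' = (\<lambda>z. indicator \<Omega> z * f z)"
  have \<Omega>_sets[measurable]: "\<Omega> \<in> sets borel" using \<Omega> by simp
  have int: "integrable lborel f'" using f by (simp add: has_L1_density_over_def set_integrable_def f'_def)
  then have [measurable]: "f' \<in> borel_measurable borel" by simp
  have mP: "measure P (E \<inter> \<Omega>) = (LINT z|lborel. indicator E z * f' z)" if "E \<in> sets borel" for E
  proof -
    have "measure P (E \<inter> \<Omega>) = (LINT z:E \<inter> \<Omega>|lborel. f z)"
      using f that by (simp add: has_L1_density_over_def)
    then show ?thesis by (simp add: set_lebesgue_integral_def f'_def indicator_inter_arith mult.assoc)
  qed
  \<comment> \<open>On the set where \<open>f'\<close> is negative its integral is a P-measure,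
    hence nonnegative; so the negative part integrates to 0.\<close>
  have nonneg: "AE z in lborel. f' z \<ge> 0"
  proof -
    define E where "E = {z. f' z < 0}"
    have [measurable]: "E \<in> sets borel" unfolding E_def by measurable
    have int': "integrable lborel (\<lambda>z. indicator E z * - f' z)"
      by (rule Bochner_Integration.integrable_bound[OF int]) (auto simp: indicator_def)
    have "(LINT z|lborel. indicator E z * - f' z) \<le> 0"
      using mP[of E] measure_nonneg[of P "E \<inter> \<Omega>"] by simp
    moreover have nn: "0 \<le> indicator E z * - f' z" for z by (auto simp: E_def indicator_def)
    ultimately have "(LINT z|lborel. indicator E z * - f' z) = 0"
      by (intro antisym Bochner_Integration.integral_nonneg)
    then have "AE z in lborel. indicator E z * - f' z = 0"
      using integral_nonneg_eq_0_iff_AE[OF int'] nn by simp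
    then show ?thesis
      by eventually_elim (auto simp: E_def indicator_def split: if_splits)
  qed
  have eq: "density P (indicator \<Omega>) = density lborel (\<lambda>z. ennreal (f' z))"
  proof (rule measure_eqI)
    fix A assume "A \<in> sets (density P (indicator \<Omega>))"
    then have A[measurable]: "A \<in> sets borel" by (simp add: P(2))
    have "emeasure (density P (indicator \<Omega>)) A = emeasure P (A \<inter> \<Omega>)"
      by (subst emeasure_density) (auto simp: P(2) nn_integral_indicator[symmetric]
          indicator_inter_arith mult.commute simp del: nn_integral_indicator)
    also have "\<dots> = ennreal (LINT z|lborel. indicator A z * f' z)"
      by (simp add: P.emeasure_eq_measure mP[OF A])
    also have "\<dots> = (\<integral>\<^sup>+z. ennreal (indicator A z * f' z) \<partial>lborel)"
    proof (rule nn_integral_eq_integral[symmetric])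
      show "integrable lborel (\<lambda>z. indicator A z * f' z)"
        by (rule Bochner_Integration.integrable_bound[OF int]) (auto simp: indicator_def)
      show "AE z in lborel. 0 \<le> indicator A z * f' z"
        using nonneg by eventually_elim (auto simp: indicator_def)
    qed
    also have "\<dots> = emeasure (density lborel (\<lambda>z. ennreal (f' z))) A"
      by (subst emeasure_density) (auto intro!: nn_integral_cong simp: indicator_def)
    finally show "emeasure (density P (indicator \<Omega>)) A = emeasure (density lborel (\<lambda>z. ennreal (f' z))) A" .
  qed (simp add: P(2))
  have "(LINT z|P. h z) = (LINT z|P. indicator \<Omega> z *\<^sub>R h z)"
    using h0 by (intro Bochner_Integration.integral_cong) (auto simp: indicator_def)
  also have "\<dots> = (LINT z|density P (\<lambda>z. ennreal (indicator \<Omega> z)). h z)"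
    by (subst integral_density) (auto simp: P(2))
  also have "(\<lambda>z. ennreal (indicator \<Omega> z)) = (indicator \<Omega> :: real^'n \<Rightarrow> ennreal)"
    by (auto simp: indicator_def)
  also have "(LINT z|density P (indicator \<Omega>). h z) = (LINT z|lborel. f' z *\<^sub>R h z)"
    unfolding eq using nonneg by (subst integral_density) auto
  finally show ?thesis by (simp add: f'_def)
qed

lemma iter_partial_shift:
  "iter_partial \<alpha> (\<lambda>x. u (x + a)) x = iter_partial \<alpha> u (x + a)"
proof (induction \<alpha> arbitrary: x)
  case (Cons i \<alpha>)
  have "iter_partial \<alpha> (\<lambda>x. u (x + a)) = (\<lambda>x. iter_partial \<alpha> u (x + a))" using Cons by auto
  moreover have "x + t *\<^sub>R axis i 1 + a = x + a + t *\<^sub>R axis i 1" for t by (simp only: add_ac)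
  ultimately show ?case by (simp only: iter_partial.simps partial_deriv_def)
qed simp

lemma Ck_on_shift:
  fixes u :: "real^'n::finite \<Rightarrow> 'b::real_normed_vector"
  assumes "Ck_on k S u" "\<And>x. x \<in> T \<Longrightarrow> x + a \<in> S"
  shows "Ck_on k T (\<lambda>x. u (x + a))"
proof -
  have eq: "iter_partial \<alpha> (\<lambda>x. u (x + a)) = (\<lambda>x. iter_partial \<alpha> u (x + a))" for \<alpha>
    by (simp add: iter_partial_shift fun_eq_iff)
  have sh: "x + t *\<^sub>R axis i 1 + a = x + a + t *\<^sub>R axis i 1" for x :: "real^'n" and t i by (simp add: algebra_simps)
  have "continuous_on T (\<lambda>x. iter_partial \<alpha> u (x + a))" if "length \<alpha> \<le> k" for \<alpha>
    by (rule continuous_on_compose2[OF Ck_on_continuous[OF assms(1) that]])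
      (use assms(2) in \<open>auto intro!: continuous_intros\<close>)
  moreover have "(\<lambda>t. iter_partial \<alpha> u (x + t *\<^sub>R axis i 1 + a)) differentiable at 0"
    if "length \<alpha> < k" "x \<in> T" for \<alpha> i x
    unfolding sh using assms that by (simp add: Ck_on_def)
  ultimately show ?thesis unfolding Ck_on_def eq by blast
qed

text \<open>The kernel \<open>x\<^sub>j / \<parallel>x\<parallel>\<close> without its layers \<open>s < 1 / \<rho>\<close>; it is supported in the ball of radius \<open>\<rho>\<close>.\<close>

definition sum_layer_kernel :: "nat \<Rightarrow> 'n::finite \<Rightarrow> real \<Rightarrow> real^'n \<Rightarrow> real" where
  "sum_layer_kernel n j \<rho> y = (LINT s|lborel. indicator {1 / \<rho>..} s * dilate n j y s)"

lemma sum_layer_kernel_measurable[measurable]: "sum_layer_kernel n j \<rho> \<in> borel_measurable borel"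
  unfolding sum_layer_kernel_def[abs_def] by measurable

lemma sum_layer_kernel_le:
  assumes "\<rho> > 0" shows "\<bar>sum_layer_kernel n j \<rho> y\<bar> \<le> trunc_mass n"
proof -
  have "{1 / \<rho>..} \<subseteq> {0<..}" using assms by (auto intro: less_le_trans[of 0 "1 / \<rho>"])
  then show ?thesis unfolding sum_layer_kernel_def by (intro dilate_integral_on_abs_le) auto
qed

lemma sum_layer_kernel_far:
  assumes "\<rho> > 0" "norm y > \<rho>" shows "sum_layer_kernel n j \<rho> y = 0"
proof -
  have "indicator {1 / \<rho>..} s * dilate n j y s = 0" for s
  proof (cases "1 / \<rho> \<le> s")
    case True
    have "0 < 1 / \<rho>" using assms(1) by simp
    then have s: "s > 0" using True by linarith
    have "1 = \<rho> * (1 / \<rho>)" using assms by simp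
    also have "\<dots> \<le> \<rho> * s" using True assms(1) by (intro mult_left_mono) auto
    also have "\<dots> < norm y * s" using assms(2) s by simp
    finally show ?thesis using dilate_far[of y s n j] s by simp
  qed simp
  then show ?thesis unfolding sum_layer_kernel_def by (simp only: Bochner_Integration.integral_zero)
qed

lemma kernel_split:
  assumes "\<rho> > 0"
  shows "trunc_mass n * (y $ j / norm y) =
    (LINT s|lborel. indicator {0<..<1 / \<rho>} s * dilate n j y s) + sum_layer_kernel n j \<rho> y"
proof -
  have sub: "{0<..<1 / \<rho>} \<subseteq> {0<..}" "{1 / \<rho>..} \<subseteq> {0<..}"
    using assms by (auto intro: less_le_trans[of 0 "1 / \<rho>"])
  have "(LINT s|lborel. indicator {0<..<1 / \<rho>} s * dilate n j y s) + sum_layer_kernel n j \<rho> y =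
      (LINT s|lborel. indicator {0<..<1 / \<rho>} s * dilate n j y s + indicator {1 / \<rho>..} s * dilate n j y s)"
    unfolding sum_layer_kernel_def
    by (intro Bochner_Integration.integral_add[symmetric] dilate_integrable_on sub) auto
  also have "\<dots> = (LINT s|lborel. indicator {0<..} s * dilate n j y s)"
    using sub by (intro Bochner_Integration.integral_cong) (auto simp: indicator_def)
  finally show ?thesis by (simp add: dilate_integral)
qed

section \<open>Hoelder bounds on balls and on compact sets\<close>

lemma holder_on_cong: "(\<And>x. x \<in> S \<Longrightarrow> u x = v x) \<Longrightarrow> holder_on \<beta> S u \<longleftrightarrow> holder_on \<beta> S v"
  unfolding holder_on_def by simp

lemma holder_on_add:
  assumes "holder_on \<beta> S u" "holder_on \<beta> S v" shows "holder_on \<beta> S (\<lambda>x. u x + v x)"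
proof -
  from assms obtain C D where C: "\<And>x y. x \<in> S \<Longrightarrow> y \<in> S \<Longrightarrow> norm (u x - u y) \<le> C * norm (x - y) powr \<beta>"
    and D: "\<And>x y. x \<in> S \<Longrightarrow> y \<in> S \<Longrightarrow> norm (v x - v y) \<le> D * norm (x - y) powr \<beta>"
    unfolding holder_on_def by blast
  show ?thesis unfolding holder_on_def
  proof (intro exI ballI)
    fix x y assume xy: "x \<in> S" "y \<in> S"
    have "norm (u x + v x - (u y + v y)) \<le> norm (u x - u y) + norm (v x - v y)"
      by (metis add_diff_add norm_triangle_ineq)
    then show "norm (u x + v x - (u y + v y)) \<le> (C + D) * norm (x - y) powr \<beta>"
      using C[OF xy] D[OF xy] by (simp add: distrib_right)
  qed
qed

lemma holder_on_cmult:
  fixes u :: "real^'n::finite \<Rightarrow> real"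
  assumes "holder_on \<beta> S u" shows "holder_on \<beta> S (\<lambda>x. c * u x)"
proof -
  from assms obtain C where C: "\<And>x y. x \<in> S \<Longrightarrow> y \<in> S \<Longrightarrow> norm (u x - u y) \<le> C * norm (x - y) powr \<beta>"
    unfolding holder_on_def by blast
  show ?thesis unfolding holder_on_def
  proof (intro exI ballI)
    fix x y assume xy: "x \<in> S" "y \<in> S"
    have "norm (c * u x - c * u y) = \<bar>c\<bar> * norm (u x - u y)"
      by (simp add: right_diff_distrib[symmetric] abs_mult)
    also have "\<dots> \<le> \<bar>c\<bar> * (C * norm (x - y) powr \<beta>)" using C[OF xy] by (intro mult_left_mono) auto
    finally show "norm (c * u x - c * u y) \<le> (\<bar>c\<bar> * C) * norm (x - y) powr \<beta>" by simp
  qed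
qed

text \<open>In a ball of radius at most 1 distances are at most 2, so \<delta> = \<delta>^\<beta>
  \<delta>^(1-\<beta>) is at most 2 \<delta>^\<beta>.\<close>

lemma holder_on_ball_of_lipschitz:
  fixes u :: "real^'n::finite \<Rightarrow> 'b::real_normed_vector"
  assumes "\<And>x y. norm (u x - u y) \<le> L * norm (x - y)" "0 < \<beta>" "\<beta> < 1" "\<rho> \<le> 1" "L \<ge> 0"
  shows "holder_on \<beta> (ball x0 \<rho>) u"
  unfolding holder_on_def
proof (intro exI ballI)
  fix x y assume xy: "x \<in> ball x0 \<rho>" "y \<in> ball x0 \<rho>"
  let ?\<delta> = "norm (x - y)"
  have "dist x y \<le> dist x0 x + dist x0 y" by (metis dist_commute dist_triangle)
  then have "?\<delta> \<le> 2" using xy assms(4) by (simp add: dist_norm)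
  have "?\<delta> \<le> 2 * ?\<delta> powr \<beta>"
  proof (cases "x = y")
    case False
    have "?\<delta> = ?\<delta> powr \<beta> * ?\<delta> powr (1 - \<beta>)" using False by (simp add: powr_add[symmetric])
    also have "?\<delta> powr (1 - \<beta>) \<le> 2 powr (1 - \<beta>)" using \<open>?\<delta> \<le> 2\<close> assms by (intro powr_mono2) auto
    also have "2 powr (1 - \<beta>) \<le> 2 powr (1::real)" using assms by (intro powr_mono) auto
    finally show ?thesis by (simp add: mult_left_mono)
  qed simp
  then have "L * ?\<delta> \<le> L * (2 * ?\<delta> powr \<beta>)" using assms(5) by (rule mult_left_mono)
  with assms(1)[of x y] show "norm (u x - u y) \<le> (2 * L) * ?\<delta> powr \<beta>" by simp
qed

text \<open>A Lebesgue number argument. Points of the compact set closer than some \<delta> share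
  one of finitely many balls with a Hoelder bound; for the others boundedness suffices, with
  constant 2 B / \<delta>^\<beta>.\<close>

lemma Ck_holder_locI:
  fixes u :: "real^'n::finite \<Rightarrow> 'b::real_normed_vector"
  assumes \<beta>: "0 < \<beta>"
    and loc: "\<And>x. x \<in> \<Omega> \<Longrightarrow> \<exists>r>0. Ck_on m (ball x r) u \<and>
      (\<forall>\<alpha>. length \<alpha> = m \<longrightarrow> holder_on \<beta> (ball x r) (iter_partial \<alpha> u))"
  shows "Ck_holder_loc m \<beta> \<Omega> u"
proof -
  have Ck: "Ck_on m \<Omega> u"
  proof (rule Ck_on_local)
    fix x assume "x \<in> \<Omega>"
    with loc obtain r where "r > 0" "Ck_on m (ball x r) u" by blast
    then show "\<exists>V. open V \<and> x \<in> V \<and> Ck_on m V u" by (intro exI[of _ "ball x r"]) auto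
  qed
  have bdd: "bounded (iter_partial \<alpha> u ` K)" if "compact K" "K \<subseteq> \<Omega>" "length \<alpha> \<le> m" for K \<alpha>
    using Ck_on_continuous[OF Ck that(3)] that
    by (intro compact_imp_bounded compact_continuous_image) (auto intro: continuous_on_subset)
  have "holder_on \<beta> K (iter_partial \<alpha> u)" if K: "compact K" "K \<subseteq> \<Omega>" and \<alpha>: "length \<alpha> = m" for K \<alpha>
  proof (cases "K = {}")
    case False
    let ?v = "iter_partial \<alpha> u"
    have "\<exists>r C. r > 0 \<and> (\<forall>y\<in>ball x r. \<forall>z\<in>ball x r. norm (?v y - ?v z) \<le> C * norm (y - z) powr \<beta>)"
      if "x \<in> K" for x
      using loc[of x] that K \<alpha> unfolding holder_on_def by blast
    then obtain r C where rC: "\<And>x. x \<in> K \<Longrightarrow> r x > 0"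
      "\<And>x y z. x \<in> K \<Longrightarrow> y \<in> ball x (r x) \<Longrightarrow> z \<in> ball x (r x) \<Longrightarrow> norm (?v y - ?v z) \<le> C x * norm (y - z) powr \<beta>"
      by metis
    obtain T where T: "T \<subseteq> K" "finite T" "K \<subseteq> (\<Union>x\<in>T. ball x (r x / 2))"
      using compactE_image[OF K(1), of K "\<lambda>x. ball x (r x / 2)"] rC(1) by (metis (no_types, lifting) UN_I centre_in_ball half_gt_zero open_ball subsetI)
    then have "T \<noteq> {}" using False by auto
    \<comment> \<open>The cover uses balls of half radius, so a point within \<delta> of a covered
      point stays in the corresponding ball of full radius.\<close>
    define \<delta> where "\<delta> = Min ((\<lambda>x. r x / 2) ` T)"
    have "\<delta> > 0" using T \<open>T \<noteq> {}\<close> rC(1) by (auto simp: \<delta>_def)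
    moreover have "\<delta> \<le> r x / 2" if "x \<in> T" for x
      unfolding \<delta>_def using T that by (intro Min_le) auto
    ultimately have \<delta>: "\<delta> > 0" "\<And>x. x \<in> T \<Longrightarrow> \<delta> \<le> r x / 2" by auto
    define CM where "CM = Max ((\<lambda>x. C x) ` T)"
    have CM: "C x \<le> CM" if "x \<in> T" for x using T that by (auto simp: CM_def)
    obtain B where B: "\<And>x. x \<in> K \<Longrightarrow> norm (?v x) \<le> B"
      using bdd[OF K, of \<alpha>] \<alpha> by (auto simp: bounded_iff)
    define D where "D = max CM (2 * B / \<delta> powr \<beta>)"
    show ?thesis unfolding holder_on_def
    proof (intro exI ballI)
      fix y z assume yz: "y \<in> K" "z \<in> K"
      show "norm (?v y - ?v z) \<le> D * norm (y - z) powr \<beta>"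
      proof (cases "norm (y - z) < \<delta>")
        case True
        from yz T(3) obtain x where x: "x \<in> T" "dist x y < r x / 2" by auto
        have "dist x z \<le> dist x y + dist y z" by (rule dist_triangle)
        then have "dist x z < r x" using x True \<delta>(2)[OF x(1)] by (simp add: dist_norm)
        moreover have "dist x y < r x" using x rC(1)[of x] T(1) by auto
        ultimately have "norm (?v y - ?v z) \<le> C x * norm (y - z) powr \<beta>"
          using x T(1) by (intro rC(2)) auto
        also have "\<dots> \<le> D * norm (y - z) powr \<beta>"
          using CM[OF x(1)] by (intro mult_right_mono) (auto simp: D_def)
        finally show ?thesis .
      next
        case False
        have "norm (?v y - ?v z) \<le> 2 * B"
          using norm_triangle_ineq4[of "?v y" "?v z"] B[OF yz(1)] B[OF yz(2)] by linarith
        also have "\<dots> = (2 * B / \<delta> powr \<beta>) * \<delta> powr \<beta>" using \<delta>(1) by simp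
        also have "\<dots> \<le> D * \<delta> powr \<beta>" by (intro mult_right_mono) (auto simp: D_def)
        also have "\<dots> \<le> D * norm (y - z) powr \<beta>"
        proof (intro mult_left_mono powr_mono2)
          have "0 \<le> B" using B[OF yz(1)] norm_ge_zero order_trans by blast
          then have "0 \<le> 2 * B / \<delta> powr \<beta>" by simp
          then show "0 \<le> D" by (simp add: D_def max_def)
        qed (use False \<delta> \<beta> in auto)
        finally show ?thesis .
      qed
    qed
  qed (simp add: holder_on_def)
  with Ck bdd show ?thesis unfolding Ck_holder_loc_def by auto
qed

section \<open>Local regularity of the geometric cdf\<close>

lemma iter_partial_layer_convolution:
  fixes f :: "real^'n::finite \<Rightarrow> real" and n :: nat and j :: 'n
  assumes "\<rho> > 0" and f: "Ck_on k \<Omega> f" and sub: "cball x0 (2 * \<rho>) \<subseteq> \<Omega>"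
  defines "A \<equiv> \<lambda>x. LINT y|restrict_space lborel (cball 0 \<rho>). sum_layer_kernel n j \<rho> y * f (x - y)"
  shows "Ck_on k (ball x0 \<rho>) A"
    and "length \<alpha> \<le> k \<Longrightarrow> x \<in> ball x0 \<rho> \<Longrightarrow>
      iter_partial \<alpha> A x = (LINT y|restrict_space lborel (cball 0 \<rho>). sum_layer_kernel n j \<rho> y * iter_partial \<alpha> f (x - y))"
proof -
  let ?M = "restrict_space lborel (cball (0::real^'n) \<rho>)" and ?K = "sum_layer_kernel n j \<rho>"
  have sp: "space ?M = cball 0 \<rho>" by (simp add: space_restrict_space)
  \<comment> \<open>In the form K(y) f(x - y) the variable x occurs in f alone, so all k derivatives
    fall on the density and the kernel only has to be bounded. The restriction to |y| \<le> \<rho>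
    keeps x - y inside the part of \<Omega> where f is of class C^k.\<close>
  have near: "x + - y \<in> cball x0 (2 * \<rho>)" if "x \<in> ball x0 \<rho>" "y \<in> cball 0 \<rho>" for x y
  proof -
    have "dist x0 (x + - y) \<le> dist x0 x + dist x (x + - y)" by (rule dist_triangle)
    then show ?thesis using that by (simp add: dist_norm)
  qed
  have shift: "Ck_on k (ball x0 \<rho>) (\<lambda>x. f (x + - y))" if "y \<in> cball 0 \<rho>" for y
    using near[OF _ that] sub by (intro Ck_on_shift[OF f]) auto
  have Ck: "Ck_on k (ball x0 \<rho>) (\<lambda>x. ?K y * f (x - y))" if "y \<in> space ?M" for y
    using Ck_on_linear[OF open_ball bounded_linear_mult_right shift, of y "?K y"] that by (simp add: sp)
  have it: "iter_partial \<alpha> (\<lambda>x. ?K y * f (x - y)) x = ?K y * iter_partial \<alpha> f (x - y)"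
    if "y \<in> space ?M" "x \<in> ball x0 \<rho>" "length \<alpha> \<le> k" for x y \<alpha>
    using iter_partial_linear[OF open_ball bounded_linear_mult_right shift that(3,2), of y "?K y"] that(1)
    by (simp add: sp iter_partial_shift[of _ f "- y", simplified])
  have cont: "continuous_on (cball x0 (2 * \<rho>)) (iter_partial \<alpha> f)" if "length \<alpha> \<le> k" for \<alpha>
    using Ck_on_continuous[OF f that] sub by (rule continuous_on_subset)
  have meas: "(\<lambda>y. iter_partial \<alpha> (\<lambda>x. ?K y * f (x - y)) x) \<in> borel_measurable ?M"
    if "length \<alpha> \<le> k" "x \<in> ball x0 \<rho>" for \<alpha> x
  proof -
    have "continuous_on (cball 0 \<rho>) (\<lambda>y. iter_partial \<alpha> f (x + - y))"
      by (rule continuous_on_compose2[OF cont[OF that(1)]])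
        (use near[OF that(2)] in \<open>auto intro!: continuous_intros\<close>)
    then have "(\<lambda>y. iter_partial \<alpha> f (x - y)) \<in> borel_measurable (restrict_space borel (cball 0 \<rho>))"
      by (intro borel_measurable_continuous_on_restrict) simp
    then have [measurable]: "(\<lambda>y. iter_partial \<alpha> f (x - y)) \<in> borel_measurable ?M"
      by (simp cong: measurable_cong_sets add: sets_restrict_space)
    have [measurable]: "?K \<in> borel_measurable ?M" by (intro measurable_restrict_space1) simp
    have "(\<lambda>y. ?K y * iter_partial \<alpha> f (x - y)) \<in> borel_measurable ?M" by measurable
    then show ?thesis
      by (rule measurable_cong[THEN iffD1, rotated]) (rule it[symmetric], use that in auto)
  qed
  have const: "integrable ?M (\<lambda>s. c::real)" for c
    using integrable_indicator_cball[of 0 \<rho> c] by (subst integrable_restrict_space) auto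
  have bd: "\<exists>g. integrable ?M g \<and> (\<forall>x\<in>ball x0 \<rho>. \<forall>y\<in>space ?M.
      norm (iter_partial \<alpha> (\<lambda>x. ?K y * f (x - y)) x) \<le> g y)" if "length \<alpha> \<le> k" for \<alpha>
  proof -
    obtain B where B: "\<And>z. z \<in> cball x0 (2 * \<rho>) \<Longrightarrow> norm (iter_partial \<alpha> f z) \<le> B"
      using compact_imp_bounded[OF compact_continuous_image[OF cont[OF \<open>length \<alpha> \<le> k\<close>] compact_cball]]
      unfolding bounded_iff by blast
    show ?thesis
    proof (intro exI conjI ballI)
      show "integrable ?M (\<lambda>y. trunc_mass n * B)" by (rule const)
      fix x y assume xy: "x \<in> ball x0 \<rho>" "y \<in> space ?M"
      have "norm (?K y * iter_partial \<alpha> f (x - y)) \<le> trunc_mass n * B"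
        unfolding norm_mult using near[OF xy(1), of y] xy(2) B[of "x - y"] trunc_mass_pos[of n]
          sum_layer_kernel_le[OF assms(1), of n j y] by (intro mult_mono) (auto simp: sp)
      then show "norm (iter_partial \<alpha> (\<lambda>x. ?K y * f (x - y)) x) \<le> trunc_mass n * B"
        using it[OF xy(2,1) that] by simp
    qed
  qed
  show "Ck_on k (ball x0 \<rho>) A" unfolding A_def by (rule Ck_on_integral[OF open_ball Ck meas bd])
  assume \<alpha>: "length \<alpha> \<le> k" and x: "x \<in> ball x0 \<rho>"
  have "iter_partial \<alpha> A x = (LINT y|?M. iter_partial \<alpha> (\<lambda>x. ?K y * f (x - y)) x)"
    unfolding A_def by (rule iter_partial_integral[OF open_ball Ck meas bd \<alpha> x])
  also have "\<dots> = (LINT y|?M. ?K y * iter_partial \<alpha> f (x - y))"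
    by (intro Bochner_Integration.integral_cong refl it x \<alpha>)
  finally show "iter_partial \<alpha> A x = (LINT y|?M. ?K y * iter_partial \<alpha> f (x - y))" .
qed

text \<open>Fubini in z and s: the dilates are integrable in s with a bound uniform in their
  argument, and g is integrable in z. This turns the convolution with the summed kernel into the
  superposition of layers estimated above.\<close>

lemma layer_kernel_convolution:
  fixes g :: "real^'n::finite \<Rightarrow> real"
  assumes "\<rho> > 0" and g[measurable]: "g \<in> borel_measurable borel" and int: "integrable lborel g"
  shows "(LINT z|lborel. sum_layer_kernel n j \<rho> (x - z) * g z) =
    (LINT s|restrict_space lborel {1 / \<rho>..}. layer (bump n j) g [] s x)"
proof -
  have sub: "{1 / \<rho>..} \<subseteq> {0<..}" using assms(1) by (auto intro: less_le_trans[of 0 "1 / \<rho>"])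
  let ?h = "\<lambda>z s. indicator {1 / \<rho>..} s * dilate n j (x - z) s * g z"
  have I: "integrable (lborel \<Otimes>\<^sub>M lborel) (\<lambda>(z, s). ?h z s)"
  proof (rule lborel_pair.Fubini_integrable)
    show "(\<lambda>(z, s). ?h z s) \<in> borel_measurable (lborel \<Otimes>\<^sub>M lborel)" by measurable
    have eq: "(LINT s|lborel. norm (?h z s)) = (LINT s|lborel. \<bar>indicator {1 / \<rho>..} s * dilate n j (x - z) s\<bar>) * \<bar>g z\<bar>" for z
      by (simp add: abs_mult)
    show "integrable lborel (\<lambda>z. LINT s|lborel. norm (case (z, s) of (z, s) \<Rightarrow> ?h z s))"
      unfolding prod.case eq
    proof (rule Bochner_Integration.integrable_bound[of lborel "\<lambda>z. trunc_mass n * \<bar>g z\<bar>"])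
      show "integrable lborel (\<lambda>z. trunc_mass n * \<bar>g z\<bar>)" using int by simp
      show "(\<lambda>z. (LINT s|lborel. \<bar>indicator {1 / \<rho>..} s * dilate n j (x - z) s\<bar>) * \<bar>g z\<bar>) \<in> borel_measurable lborel"
        by measurable
      have "norm ((LINT s|lborel. \<bar>indicator {1 / \<rho>..} s * dilate n j (x - z) s\<bar>) * \<bar>g z\<bar>) \<le> norm (trunc_mass n * \<bar>g z\<bar>)" for z
        using dilate_integral_on_le[of "{1 / \<rho>..}" n j "x - z", OF _ sub] trunc_mass_pos[of n]
        unfolding norm_mult by (intro mult_right_mono) auto
      then show "AE z in lborel. norm ((LINT s|lborel. \<bar>indicator {1 / \<rho>..} s * dilate n j (x - z) s\<bar>) * \<bar>g z\<bar>) \<le> norm (trunc_mass n * \<bar>g z\<bar>)"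
        by (intro AE_I2)
    qed
    show "AE z in lborel. integrable lborel (\<lambda>s. case (z, s) of (z, s) \<Rightarrow> ?h z s)"
      unfolding prod.case using dilate_integrable_on[of "{1 / \<rho>..}" n j, OF _ sub]
      by (intro AE_I2 integrable_mult_left) simp
  qed
  have "(LINT z|lborel. sum_layer_kernel n j \<rho> (x - z) * g z) = (LINT z|lborel. LINT s|lborel. ?h z s)"
    by (simp add: sum_layer_kernel_def)
  also have "\<dots> = (LINT s|lborel. LINT z|lborel. ?h z s)"
    by (rule lborel_pair.Fubini_integral[OF I, symmetric])
  also have "\<dots> = (LINT s|lborel. indicator {1 / \<rho>..} s *\<^sub>R layer (bump n j) g [] s x)"
  proof (intro Bochner_Integration.integral_cong refl)
    fix s :: real
    show "(LINT z|lborel. ?h z s) = indicator {1 / \<rho>..} s *\<^sub>R layer (bump n j) g [] s x"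
    proof (cases "s \<in> {1 / \<rho>..}")
      case True
      then have "s > 0" using sub by auto
      then show ?thesis using True by (simp add: layer_def dilate_eq del: scaleR_diff_right)
    qed simp
  qed
  also have "\<dots> = (LINT s|restrict_space lborel {1 / \<rho>..}. layer (bump n j) g [] s x)"
    by (subst integral_restrict_space) auto
  finally show ?thesis .
qed

text \<open>The convention that division by 0 yields 0 takes over the role of the indicator at z =
  x.\<close>

lemma geometric_cdf_nth:
  fixes P :: "(real^'n::finite) measure"
  assumes "prob_space P" "sets P = sets borel"
  shows "geometric_cdf P x $ j = (LINT z|P. (x - z) $ j / norm (x - z))"
proof -
  interpret P: prob_space P by fact
  note [measurable_cong] = assms(2)
  have eq: "indicat_real {z. z \<noteq> x} z *\<^sub>R ((x - z) /\<^sub>R norm (x - z)) = (x - z) /\<^sub>R norm (x - z)" for z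
    by (auto simp: indicator_def)
  have int: "integrable P (\<lambda>z. (x - z) /\<^sub>R norm (x - z))"
    by (rule P.integrable_const_bound[where B=1]) (auto simp: divide_simps)
  show ?thesis
    unfolding geometric_cdf_def eq
    by (subst integral_bounded_linear[OF bounded_linear_vec_nth int, symmetric]) (simp add: divide_inverse mult.commute)
qed

text \<open>Near x0 the cdf, multiplied by \<open>trunc_mass n\<close>, is \<open>RP + A\<close>:
  \<open>RP\<close> collects the layers s < 1 / \<rho> integrated against all of P, and
  \<open>A\<close> the remaining ones, which see P only inside \<Omega>, through f. The term
  \<open>RP\<close> has one derivative in reserve, so its derivatives of order d + k are
  Lipschitz.\<close>

lemma geometric_cdf_local:
  fixes \<Omega> :: "(real^'n::finite) set" and f :: "real^'n \<Rightarrow> real"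
  assumes \<Omega>: "open \<Omega>" and P: "prob_space P" "sets P = sets borel"
    and dens: "has_L1_density_over P \<Omega> f" and \<beta>: "0 < \<beta>" "\<beta> < 1"
    and f: "Ck_holder_loc k \<beta> \<Omega> f" and x0: "x0 \<in> \<Omega>"
  shows "\<exists>\<rho>>0. Ck_on (CARD('n) + k) (ball x0 \<rho>) (\<lambda>x. geometric_cdf P x $ j) \<and>
    (\<forall>\<alpha>. length \<alpha> = CARD('n) + k \<longrightarrow> holder_on \<beta> (ball x0 \<rho>) (iter_partial \<alpha> (\<lambda>x. geometric_cdf P x $ j)))"
proof -
  interpret P: prob_space P by fact
  note [measurable_cong] = P(2)
  obtain e where e: "e > 0" "cball x0 e \<subseteq> \<Omega>" using \<Omega> x0 by (meson open_contains_cball)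
  \<comment> \<open>Room for three steps: x lies within \<rho> of x0, and the estimates for the
    layers reach 2 \<rho> beyond x.\<close>
  define \<rho> where "\<rho> = min 1 (e / 3)"
  have \<rho>: "\<rho> > 0" "\<rho> \<le> 1" "cball x0 (3 * \<rho>) \<subseteq> \<Omega>"
    using e by (auto simp: \<rho>_def intro: order_trans[OF subset_cball])
  have sub2: "cball x0 (2 * \<rho>) \<subseteq> cball x0 (3 * \<rho>)" using \<rho> by (intro subset_cball) auto
  \<comment> \<open>The order d + k + 1 supplies the extra derivative of \<open>RP\<close> and at
    least the d + 1 derivatives of the bump required by the bounds for the layers.\<close>
  define n where "n = Suc (CARD('n) + k)"
  define F where "F = (\<lambda>x. geometric_cdf P x $ j)"
  define R where "R = (\<lambda>x::real^'n. LINT s|lborel. indicator {0<..<1 / \<rho>} s * dilate n j x s)"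
  define RP where "RP = (\<lambda>x. LINT z|P. R (x - z))"
  define A where "A = (\<lambda>x. LINT y|restrict_space lborel (cball 0 \<rho>). sum_layer_kernel n j \<rho> y * f (x - y))"
  have fCk: "Ck_on k \<Omega> f" using f by (simp add: Ck_holder_loc_def)
  have \<Omega>_sets[measurable]: "\<Omega> \<in> sets borel" using \<Omega> by simp
  have RCk: "Ck_on n UNIV R" unfolding R_def using \<rho> by (intro remainder_derivs) simp
  have "\<exists>B. \<forall>\<alpha> x. length \<alpha> \<le> n \<longrightarrow> \<bar>iter_partial \<alpha> R x\<bar> \<le> B"
    unfolding R_def using \<rho> by (intro remainder_derivs(2)) simp
  then obtain B where B: "\<And>\<alpha> x. length \<alpha> \<le> n \<Longrightarrow> \<bar>iter_partial \<alpha> R x\<bar> \<le> B" by blast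
  have RP_Ck: "Ck_on n UNIV RP" unfolding RP_def by (rule convolution_derivs(1)[OF P RCk B])
  have RP_B: "\<bar>iter_partial \<alpha> RP x\<bar> \<le> B" if "length \<alpha> \<le> n" for \<alpha> x
    unfolding RP_def using that by (rule convolution_derivs(2)[OF P RCk B, rotated])
  have R_meas[measurable]: "R \<in> borel_measurable borel" unfolding R_def by measurable
  have R_le: "\<bar>R y\<bar> \<le> B" for y using B[of "[]" y] by simp

  have F_eq: "trunc_mass n * F x = RP x + A x" if x: "x \<in> ball x0 \<rho>" for x
  proof -
    have "trunc_mass n * F x = (LINT z|P. trunc_mass n * ((x - z) $ j / norm (x - z)))"
      by (simp only: F_def geometric_cdf_nth[OF P] Bochner_Integration.integral_mult_right_zero)
    also have "\<dots> = (LINT z|P. R (x - z) + sum_layer_kernel n j \<rho> (x - z))"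
      unfolding R_def by (intro Bochner_Integration.integral_cong refl kernel_split \<rho>)
    also have "\<dots> = RP x + (LINT z|P. sum_layer_kernel n j \<rho> (x - z))" unfolding RP_def
    proof (rule Bochner_Integration.integral_add)
      show "integrable P (\<lambda>z. R (x - z))"
        by (rule P.integrable_const_bound[where B=B]) (use R_le in auto)
      show "integrable P (\<lambda>z. sum_layer_kernel n j \<rho> (x - z))"
        by (rule P.integrable_const_bound[where B="trunc_mass n"]) (use sum_layer_kernel_le[OF \<rho>(1)] in auto)
    qed
    also have "(LINT z|P. sum_layer_kernel n j \<rho> (x - z)) =
        (LINT z|lborel. (indicator \<Omega> z * f z) *\<^sub>R sum_layer_kernel n j \<rho> (x - z))"
    proof (rule integral_density_over[OF P \<Omega> dens])
      fix z assume "z \<notin> \<Omega>"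
      then have "norm (x - z) > \<rho>"
      proof (rule contrapos_np)
        assume "\<not> norm (x - z) > \<rho>"
        moreover have "dist x0 z \<le> dist x0 x + dist x z" by (rule dist_triangle)
        ultimately have "z \<in> cball x0 (3 * \<rho>)" using x \<rho> by (simp add: dist_norm)
        then show "z \<in> \<Omega>" using \<rho> by auto
      qed
      then show "sum_layer_kernel n j \<rho> (x - z) = 0" by (rule sum_layer_kernel_far[OF \<rho>(1)])
    qed simp
    also have "\<dots> = (LINT y|lborel. (indicator \<Omega> (x + - 1 *\<^sub>R y) * f (x + - 1 *\<^sub>R y)) *\<^sub>R
        sum_layer_kernel n j \<rho> (x - (x + - 1 *\<^sub>R y)))"
    proof -
      have [measurable]: "(\<lambda>z. indicator \<Omega> z * f z) \<in> borel_measurable borel"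
        using dens borel_measurable_integrable[of lborel "\<lambda>z. indicator \<Omega> z * f z"]
        by (simp add: has_L1_density_over_def set_integrable_def)
      show ?thesis by (subst integral_affine[of _ "-1" x]) auto
    qed
    also have "\<dots> = (LINT y|lborel. indicator (cball 0 \<rho>) y *\<^sub>R (sum_layer_kernel n j \<rho> y * f (x - y)))"
    proof (intro Bochner_Integration.integral_cong refl)
      fix y :: "real^'n"
      show "(indicator \<Omega> (x + - 1 *\<^sub>R y) * f (x + - 1 *\<^sub>R y)) *\<^sub>R sum_layer_kernel n j \<rho> (x - (x + - 1 *\<^sub>R y)) =
          indicator (cball 0 \<rho>) y *\<^sub>R (sum_layer_kernel n j \<rho> y * f (x - y))"
      proof (cases "norm y \<le> \<rho>")
        case True
        have "dist x0 (x - y) \<le> dist x0 x + dist x (x - y)" by (rule dist_triangle)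
        then have "x - y \<in> cball x0 (3 * \<rho>)" using x \<rho> True by (simp add: dist_norm)
        then have "x - y \<in> \<Omega>" using \<rho> by auto
        then show ?thesis using True by simp
      next
        case False
        then show ?thesis using sum_layer_kernel_far[OF \<rho>(1), of y n j] by simp
      qed
    qed
    also have "\<dots> = A x" unfolding A_def by (subst integral_restrict_space) auto
    finally show ?thesis .
  qed

  have A_Ck: "Ck_on (k + CARD('n)) (ball x0 \<rho>) A \<and>
    (\<forall>\<alpha>. length \<alpha> = CARD('n) + k \<longrightarrow> holder_on \<beta> (ball x0 \<rho>) (iter_partial \<alpha> A))"
  proof -
    note Aconv = iter_partial_layer_convolution[OF \<rho>(1) fCk order_trans[OF sub2 \<rho>(3)], where n=n and j=j, folded A_def]
    have main: "Ck_on CARD('n) (ball x0 \<rho>) (iter_partial \<alpha> A) \<and>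
      (\<forall>\<gamma>. length \<gamma> = CARD('n) \<longrightarrow> holder_on \<beta> (ball x0 \<rho>) (iter_partial \<gamma> (iter_partial \<alpha> A)))"
      if \<alpha>: "length \<alpha> = k" for \<alpha>
    proof -
      \<comment> \<open>The cut-off makes the derivative a bounded, integrable function on the whole
        space; for x in the small ball the convolution does not notice it, as the kernel has radius
        \<rho>.\<close>
      define g where "g = (\<lambda>z. indicator (cball x0 (3 * \<rho>)) z * iter_partial \<alpha> f z)"
      have cont: "continuous_on (cball x0 (3 * \<rho>)) (iter_partial \<alpha> f)"
        using Ck_on_continuous[OF fCk, of \<alpha>] \<alpha> \<rho>(3) by (auto intro: continuous_on_subset)
      have g_meas[measurable]: "g \<in> borel_measurable borel"
        using borel_measurable_continuous_on_indicator[OF _ cont] by (simp add: g_def)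
      obtain G where G: "\<And>z. z \<in> cball x0 (3 * \<rho>) \<Longrightarrow> norm (iter_partial \<alpha> f z) \<le> G"
        using compact_imp_bounded[OF compact_continuous_image[OF cont compact_cball]]
        unfolding bounded_iff by blast
      have G': "\<bar>g z\<bar> \<le> indicator (cball x0 (3 * \<rho>)) z * G" for z
        using G[of z] by (cases "z \<in> cball x0 (3 * \<rho>)") (auto simp: g_def)
      have g_int: "integrable lborel g"
        by (rule Bochner_Integration.integrable_bound[OF integrable_indicator_cball[of x0 "3 * \<rho>" G]])
          (use G' in \<open>auto intro: order_trans[OF _ abs_ge_self]\<close>)
      have "holder_on \<beta> (cball x0 (3 * \<rho>)) (iter_partial \<alpha> f)"
        using f \<alpha> \<rho>(3) by (simp add: Ck_holder_loc_def)
      then obtain C where C: "\<And>x y. x \<in> cball x0 (3 * \<rho>) \<Longrightarrow> y \<in> cball x0 (3 * \<rho>) \<Longrightarrow>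
          norm (iter_partial \<alpha> f x - iter_partial \<alpha> f y) \<le> C * norm (x - y) powr \<beta>"
        unfolding holder_on_def by blast
      have hol: "\<bar>g z - g x\<bar> \<le> max C 0 * norm (z - x) powr \<beta>"
        if "x \<in> ball x0 \<rho>" "norm (z - x) \<le> 2 * \<rho>" for x z
      proof -
        have "dist x0 z \<le> dist x0 x + dist x z" by (rule dist_triangle)
        then have z: "z \<in> cball x0 (3 * \<rho>)" and x: "x \<in> cball x0 (3 * \<rho>)"
          using that \<rho> by (auto simp: dist_norm norm_minus_commute)
        have "\<bar>g z - g x\<bar> \<le> C * norm (z - x) powr \<beta>" using C[OF z x] z x by (simp add: g_def)
        also have "\<dots> \<le> max C 0 * norm (z - x) powr \<beta>" by (intro mult_right_mono) auto
        finally show ?thesis .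
      qed
      have bumpCk: "Ck_on (Suc CARD('n)) UNIV (bump n j)"
        using Ck_on_bump[of n j] by (rule Ck_on_mono) (auto simp: n_def)
      obtain M where M: "M \<ge> 0" "\<And>\<alpha> x. length \<alpha> \<le> Suc CARD('n) \<Longrightarrow> norm (iter_partial \<alpha> (bump n j) x) \<le> M"
        using compact_support_bounded[OF bumpCk compact_cball[of 0 1] bump_support] by metis
      let ?L = "\<lambda>x. LINT s|restrict_space lborel {1 / \<rho>..}. layer (bump n j) g [] s x"
      have L: "Ck_on CARD('n) (ball x0 \<rho>) ?L"
        by (rule Ck_on_sum_layers[OF bumpCk bump_support M[unfolded real_norm_def] g_meas G' \<beta> \<rho>(1,2) max.cobounded2 hol refl])
      have H: "holder_on \<beta> (ball x0 \<rho>) (iter_partial \<gamma> ?L)" if "length \<gamma> = CARD('n)" for \<gamma>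
        by (rule holder_on_sum_layers[OF bumpCk bump_support M[unfolded real_norm_def] g_meas G' \<beta> \<rho>(1,2) max.cobounded2 hol refl that])
      have eq: "iter_partial \<alpha> A x = ?L x" if x: "x \<in> ball x0 \<rho>" for x
      proof -
        have "iter_partial \<alpha> A x = (LINT y|restrict_space lborel (cball 0 \<rho>). sum_layer_kernel n j \<rho> y * iter_partial \<alpha> f (x - y))"
          using \<alpha> by (intro Aconv(2) x) simp
        also have "\<dots> = (LINT y|lborel. indicator (cball 0 \<rho>) y *\<^sub>R (sum_layer_kernel n j \<rho> y * iter_partial \<alpha> f (x - y)))"
          by (subst integral_restrict_space) auto
        also have "\<dots> = (LINT y|lborel. sum_layer_kernel n j \<rho> (x - (x + - 1 *\<^sub>R y)) * g (x + - 1 *\<^sub>R y))"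
        proof (intro Bochner_Integration.integral_cong refl)
          fix y :: "real^'n"
          show "indicator (cball 0 \<rho>) y *\<^sub>R (sum_layer_kernel n j \<rho> y * iter_partial \<alpha> f (x - y)) =
              sum_layer_kernel n j \<rho> (x - (x + - 1 *\<^sub>R y)) * g (x + - 1 *\<^sub>R y)"
          proof (cases "norm y \<le> \<rho>")
            case True
            have "dist x0 (x - y) \<le> dist x0 x + dist x (x - y)" by (rule dist_triangle)
            then have "x - y \<in> cball x0 (3 * \<rho>)" using x \<rho> True by (simp add: dist_norm)
            then show ?thesis using True by (simp add: g_def)
          next
            case False
            then show ?thesis using sum_layer_kernel_far[OF \<rho>(1), of y n j] by simp
          qed
        qed
        also have "\<dots> = (LINT z|lborel. sum_layer_kernel n j \<rho> (x - z) * g z)"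
          by (subst integral_affine[of "\<lambda>z. sum_layer_kernel n j \<rho> (x - z) * g z" "-1" x]) auto
        also have "\<dots> = ?L x" by (rule layer_kernel_convolution[OF \<rho>(1) g_meas g_int])
        finally show ?thesis .
      qed
      have "Ck_on CARD('n) (ball x0 \<rho>) (iter_partial \<alpha> A)"
        using L eq by (subst Ck_on_cong[OF open_ball, of _ _ "iter_partial \<alpha> A" ?L]) auto
      moreover have "holder_on \<beta> (ball x0 \<rho>) (iter_partial \<gamma> (iter_partial \<alpha> A))" if "length \<gamma> = CARD('n)" for \<gamma>
        using H[OF that] by (subst holder_on_cong[where v="iter_partial \<gamma> ?L"])
          (auto intro!: iter_partial_cong[OF open_ball] eq)
      ultimately show ?thesis by blast
    qed
    have "holder_on \<beta> (ball x0 \<rho>) (iter_partial \<alpha> A)" if "length \<alpha> = CARD('n) + k" for \<alpha>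
    proof -
      \<comment> \<open>The last k letters act first and have been moved onto f; the first d letters
        are those handled by the layers.\<close>
      have "\<alpha> = take CARD('n) \<alpha> @ drop CARD('n) \<alpha>" by simp
      then have "iter_partial \<alpha> A = iter_partial (take CARD('n) \<alpha>) (iter_partial (drop CARD('n) \<alpha>) A)"
        by (metis iter_partial_append)
      then show ?thesis using main[of "drop CARD('n) \<alpha>"] that by simp
    qed
    then show ?thesis using main Aconv(1) by (simp add: Ck_on_add_order)
  qed

  have RP_hol: "holder_on \<beta> (ball x0 \<rho>) (iter_partial \<alpha> RP)" if "length \<alpha> = CARD('n) + k" for \<alpha>
  proof (rule holder_on_ball_of_lipschitz[OF _ \<beta> \<rho>(2)])
    show "norm (iter_partial \<alpha> RP x - iter_partial \<alpha> RP y) \<le> (B * real CARD('n)) * norm (x - y)" for x y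
    proof (rule Ck_on_lipschitz)
      show "Ck_on 1 UNIV (iter_partial \<alpha> RP)" using that by (intro Ck_on_iter[OF RP_Ck]) (simp add: n_def)
      show "norm (partial_deriv i (iter_partial \<alpha> RP) x) \<le> B" for i x
        using RP_B[of "i # \<alpha>" x] that by (simp add: n_def)
    qed
    show "0 \<le> B * real CARD('n)" using R_le[of 0] by simp
  qed
  have RP_Ck': "Ck_on (CARD('n) + k) (ball x0 \<rho>) RP"
    using RP_Ck by (rule Ck_on_mono) (auto simp: n_def)
  have A_Ck': "Ck_on (CARD('n) + k) (ball x0 \<rho>) A" using A_Ck by (simp add: add.commute)
  let ?S = "\<lambda>x. 1 / trunc_mass n * (RP x + A x)"
  have S: "Ck_on (CARD('n) + k) (ball x0 \<rho>) ?S"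
    by (intro Ck_on_linear[OF open_ball bounded_linear_mult_right, where u="\<lambda>x. RP x + A x"]
        Ck_on_add[OF open_ball] RP_Ck' A_Ck')
  have FS: "F x = ?S x" if "x \<in> ball x0 \<rho>" for x
    using F_eq[OF that] trunc_mass_pos[of n] by (simp add: field_simps)
  have "Ck_on (CARD('n) + k) (ball x0 \<rho>) F"
    using S FS by (subst Ck_on_cong[OF open_ball, of _ _ F ?S]) auto
  moreover have "holder_on \<beta> (ball x0 \<rho>) (iter_partial \<alpha> F)" if "length \<alpha> = CARD('n) + k" for \<alpha>
  proof -
    have "iter_partial \<alpha> F x = 1 / trunc_mass n * (iter_partial \<alpha> RP x + iter_partial \<alpha> A x)"
      if x: "x \<in> ball x0 \<rho>" for x
    proof -
      have le: "length \<alpha> \<le> CARD('n) + k" using \<open>length \<alpha> = CARD('n) + k\<close> by simp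
      have "iter_partial \<alpha> F x = iter_partial \<alpha> ?S x"
        by (rule iter_partial_cong[OF open_ball x FS])
      also have "\<dots> = 1 / trunc_mass n * iter_partial \<alpha> (\<lambda>x. RP x + A x) x"
        by (rule iter_partial_linear[OF open_ball bounded_linear_mult_right Ck_on_add[OF open_ball RP_Ck' A_Ck'] le x])
      also have "iter_partial \<alpha> (\<lambda>x. RP x + A x) x = iter_partial \<alpha> RP x + iter_partial \<alpha> A x"
        by (rule iter_partial_add[OF open_ball RP_Ck' A_Ck' le x])
      finally show ?thesis .
    qed
    moreover have "holder_on \<beta> (ball x0 \<rho>) (\<lambda>x. 1 / trunc_mass n * (iter_partial \<alpha> RP x + iter_partial \<alpha> A x))"
      using A_Ck that by (intro holder_on_cmult holder_on_add RP_hol) auto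
    ultimately show ?thesis by (subst holder_on_cong) auto
  qed
  ultimately show ?thesis using \<rho>(1) unfolding F_def by blast
qed

theorem geometric_cdf_regularity:
  fixes \<Omega> :: "(real^'n::finite) set" and f :: "real^'n \<Rightarrow> real"
  assumes "open \<Omega>" "prob_space P" "sets P = sets borel" "has_L1_density_over P \<Omega> f"
    and "0 < \<beta>" "\<beta> < 1" "Ck_holder_loc k \<beta> \<Omega> f"
  shows "Ck_holder_loc (CARD('n) + k) \<beta> \<Omega> (\<lambda>x. geometric_cdf P x $ j)"
  by (rule Ck_holder_locI[OF assms(5) geometric_cdf_local[OF assms]])

section \<open>Product integrals and Gaussians\<close>

text \<open>Lebesgue measure is the image of a product of one-dimensional ones. Both the Gaussian
  integrals and the integrability of (1 + |x|)^(-d-1) are reduced to dimension one in this way,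
  without polar coordinates.\<close>

lemma
  fixes \<phi> :: "'a::euclidean_space \<Rightarrow> real \<Rightarrow> 'b::{real_normed_field, banach, second_countable_topology}"
  assumes int: "\<And>b. b \<in> Basis \<Longrightarrow> integrable lborel (\<phi> b)"
  shows integrable_prod_Basis: "integrable lborel (\<lambda>x::'a. \<Prod>b\<in>Basis. \<phi> b (x \<bullet> b))"
    and integral_prod_Basis: "(LINT x|lborel. (\<Prod>b\<in>Basis. \<phi> b (x \<bullet> b))) = (\<Prod>b\<in>Basis. (LINT s|lborel. \<phi> b s))"
proof -
  interpret product_sigma_finite "\<lambda>_::'a. lborel :: real measure" by standard
  let ?\<Pi> = "\<Pi>\<^sub>M b\<in>Basis. lborel :: real measure" and ?T = "\<lambda>f::'a \<Rightarrow> real. \<Sum>b\<in>Basis. f b *\<^sub>R b"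
  have T[measurable]: "?T \<in> ?\<Pi> \<rightarrow>\<^sub>M borel" by measurable
  have eq: "(\<Prod>b\<in>Basis. \<phi> b (?T f \<bullet> b)) = (\<Prod>b\<in>Basis. \<phi> b (f b))" for f :: "'a \<Rightarrow> real"
    by (intro prod.cong) (auto simp: inner_sum_left inner_Basis if_distrib cong: if_cong)
  have meas[measurable]: "(\<lambda>x::'a. \<Prod>b\<in>Basis. \<phi> b (x \<bullet> b)) \<in> borel_measurable borel"
  proof (rule borel_measurable_prod)
    fix b :: 'a assume "b \<in> Basis"
    then have [measurable]: "\<phi> b \<in> borel_measurable borel" using int by simp
    show "(\<lambda>x. \<phi> b (x \<bullet> b)) \<in> borel_measurable borel" by measurable
  qed
  have "integrable ?\<Pi> (\<lambda>f. \<Prod>b\<in>Basis. \<phi> b (?T f \<bullet> b))"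
    unfolding eq by (rule product_integrable_prod) (auto intro: int)
  then show "integrable lborel (\<lambda>x::'a. \<Prod>b\<in>Basis. \<phi> b (x \<bullet> b))"
    unfolding lborel_eq[where 'a='a] by (subst integrable_distr_eq) auto
  have "(LINT x|lborel. (\<Prod>b\<in>Basis. \<phi> b (x \<bullet> b))) = (LINT f|?\<Pi>. (\<Prod>b\<in>Basis. \<phi> b (?T f \<bullet> b)))"
    unfolding lborel_eq[where 'a='a] by (subst integral_distr) auto
  also have "\<dots> = (\<Prod>b\<in>Basis. (LINT s|lborel. \<phi> b s))"
    unfolding eq by (rule product_integral_prod) (auto intro: int)
  finally show "(LINT x|lborel. (\<Prod>b\<in>Basis. \<phi> b (x \<bullet> b))) = (\<Prod>b\<in>Basis. (LINT s|lborel. \<phi> b s))" .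
qed

lemma
  fixes a s :: real
  assumes a: "a > 0"
  shows integrable_gauss_wave_1: "integrable lborel (\<lambda>x::real. of_real (exp (- a * x\<^sup>2)) * iexp (2 * pi * s * x))"
    and integral_gauss_wave_1: "(LINT x|lborel. of_real (exp (- a * x\<^sup>2)) * iexp (2 * pi * s * x)) =
      of_real (sqrt (pi / a) * exp (- pi\<^sup>2 * s\<^sup>2 / a))"
proof -
  \<comment> \<open>With this scale a (c y)^2 = y^2 / 2, so the integral becomes the characteristic
    function of the standard normal distribution.\<close>
  define c where "c = 1 / sqrt (2 * a)"
  have c: "c > 0" "c\<^sup>2 = 1 / (2 * a)" using a by (simp_all add: c_def power_divide)
  let ?f = "\<lambda>x. of_real (exp (- a * x\<^sup>2)) * iexp (2 * pi * s * x)"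
  have norm: "?f (0 + c * y) = of_real (sqrt (2 * pi)) * (std_normal_density y *\<^sub>R iexp ((2 * pi * s * c) * y))" for y
  proof -
    have "a * (c * y)\<^sup>2 = y\<^sup>2 / 2" using a c by (simp add: power_mult_distrib)
    then have "exp (- a * (c * y)\<^sup>2) = sqrt (2 * pi) * std_normal_density y"
      by (simp add: std_normal_density_def)
    then show ?thesis by (simp add: scaleR_conv_of_real mult_ac)
  qed
  have int0: "integrable lborel (\<lambda>y. std_normal_density y *\<^sub>R iexp (\<tau> * y))" for \<tau>
  proof (rule Bochner_Integration.integrable_bound[of lborel "std_normal_density"])
    show "integrable lborel std_normal_density" by simp
    show "AE y in lborel. norm (std_normal_density y *\<^sub>R iexp (\<tau> * y)) \<le> norm (std_normal_density y)"
      by (simp add: norm_mult[symmetric])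
  qed simp
  have char: "(LINT y|lborel. std_normal_density y *\<^sub>R iexp (\<tau> * y)) = of_real (exp (- \<tau>\<^sup>2 / 2))" for \<tau>
  proof -
    have "char std_normal_distribution \<tau> = (LINT y|lborel. std_normal_density y *\<^sub>R iexp (\<tau> * y))"
      unfolding char_def by (subst integral_density) auto
    then show ?thesis by (simp add: char_std_normal_distribution)
  qed
  have int1: "integrable lborel (\<lambda>y. ?f (0 + c * y))"
    unfolding norm by (intro integrable_mult_right int0)
  then show "integrable lborel ?f"
    using c by (simp only: lborel_integrable_real_affine_iff[of c ?f 0])
  have "(LINT x|lborel. ?f x) = \<bar>c\<bar> *\<^sub>R (LINT y|lborel. ?f (0 + c * y))"
    using c by (intro lborel_integral_real_affine) simp
  also have "(LINT y|lborel. ?f (0 + c * y)) = of_real (sqrt (2 * pi)) * of_real (exp (- (2 * pi * s * c)\<^sup>2 / 2))"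
    unfolding norm Bochner_Integration.integral_mult_right_zero char ..
  also have "- (2 * pi * s * c)\<^sup>2 / 2 = - (pi\<^sup>2 * s\<^sup>2 / a)"
    using c a by (simp add: power_mult_distrib field_simps)
  finally have "(LINT x|lborel. ?f x) = of_real (c * sqrt (2 * pi) * exp (- (pi\<^sup>2 * s\<^sup>2 / a)))"
    using c by (simp add: scaleR_conv_of_real)
  moreover have "c * sqrt (2 * pi) = sqrt (pi / a)"
    using a by (simp add: c_def real_sqrt_divide real_sqrt_mult)
  ultimately show "(LINT x|lborel. ?f x) = of_real (sqrt (pi / a) * exp (- pi\<^sup>2 * s\<^sup>2 / a))" by simp
qed

section \<open>Plane waves and Gaussians in d dimensions\<close>

definition wave :: "real^'n::finite \<Rightarrow> real^'n \<Rightarrow> complex" where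
  "wave \<xi> x = exp (2 * \<i> * of_real pi * of_real (x \<bullet> \<xi>))"

definition gauss :: "real \<Rightarrow> real^'n::finite \<Rightarrow> real" where
  "gauss t x = exp (- t * (norm x)\<^sup>2)"

lemma norm_wave[simp]: "norm (wave \<xi> x) = 1"
proof -
  have "wave \<xi> x = iexp (2 * pi * (x \<bullet> \<xi>))" by (simp add: wave_def mult_ac)
  then show ?thesis by simp
qed

lemma wave_commute: "wave \<xi> x = wave x \<xi>" by (simp add: wave_def inner_commute)

lemma wave_add: "wave \<xi> (x + y) = wave \<xi> x * wave \<xi> y"
  by (simp add: wave_def inner_add_left algebra_simps exp_add[symmetric])

lemma wave_0[simp]: "wave 0 x = 1" by (simp_all add: wave_def)

lemma wave_measurable[measurable (raw)]:
  "f \<in> borel_measurable M \<Longrightarrow> g \<in> borel_measurable M \<Longrightarrow> (\<lambda>w. wave (f w) (g w)) \<in> borel_measurable M"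
  unfolding wave_def by measurable

lemma gauss_measurable[measurable (raw)]:
  assumes [measurable]: "f \<in> borel_measurable M" "g \<in> borel_measurable M"
  shows "(\<lambda>w. gauss (f w) (g w)) \<in> borel_measurable M"
  unfolding gauss_def by measurable

lemma gauss_pos: "gauss t x > 0" by (simp add: gauss_def)

lemma fourier_eq: "fourier u \<xi> = (LINT x|lborel. u x * wave (- \<xi>) x)"
  unfolding fourier_def wave_def by simp

lemma inv_fourier_eq: "inv_fourier v x = (LINT \<xi>|lborel. v \<xi> * wave \<xi> x)"
  unfolding inv_fourier_def wave_def by simp

lemma
  fixes \<xi> :: "real^'n::finite"
  assumes t: "t > 0"
  shows integrable_gauss_wave: "integrable lborel (\<lambda>x. of_real (gauss t x) * wave \<xi> x)"
    and integral_gauss_wave: "(LINT x|lborel. of_real (gauss t x) * wave \<xi> x) =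
      of_real ((pi / t) powr (CARD('n) / 2) * gauss (pi\<^sup>2 / t) \<xi>)"
proof -
  have eq: "of_real (gauss t x) * wave \<xi> x =
      (\<Prod>b\<in>Basis. of_real (exp (- t * (x \<bullet> b)\<^sup>2)) * iexp (2 * pi * (\<xi> \<bullet> b) * (x \<bullet> b)))" for x :: "real^'n"
  proof -
    have "(norm x)\<^sup>2 = (\<Sum>b\<in>Basis. (x \<bullet> b)\<^sup>2)"
      unfolding power2_norm_eq_inner by (subst euclidean_inner) (simp add: power2_eq_square)
    then have 1: "gauss t x = (\<Prod>b\<in>Basis. exp (- t * (x \<bullet> b)\<^sup>2))"
      by (simp add: gauss_def exp_sum[symmetric] sum_distrib_left)
    have "wave \<xi> x = exp (\<Sum>b\<in>Basis. \<i> * of_real (2 * pi * (\<xi> \<bullet> b) * (x \<bullet> b)))"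
      unfolding wave_def by (subst euclidean_inner) (simp add: sum_distrib_left mult_ac)
    then have 2: "wave \<xi> x = (\<Prod>b\<in>Basis. iexp (2 * pi * (\<xi> \<bullet> b) * (x \<bullet> b)))"
      by (simp add: exp_sum)
    show ?thesis unfolding 1 2 of_real_prod prod.distrib ..
  qed
  show "integrable lborel (\<lambda>x. of_real (gauss t x) * wave \<xi> x)"
    unfolding eq by (intro integrable_prod_Basis[where \<phi>="\<lambda>b y. of_real (exp (- t * y\<^sup>2)) * iexp (2 * pi * (\<xi> \<bullet> b) * y)"]
        integrable_gauss_wave_1 t)
  have "(LINT x|lborel. of_real (gauss t x) * wave \<xi> x) =
      (\<Prod>b\<in>Basis. of_real (sqrt (pi / t) * exp (- pi\<^sup>2 * (\<xi> \<bullet> b)\<^sup>2 / t)))"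
    unfolding eq
    by (subst integral_prod_Basis[where \<phi>="\<lambda>b y. of_real (exp (- t * y\<^sup>2)) * iexp (2 * pi * (\<xi> \<bullet> b) * y)"])
      (simp_all only: integrable_gauss_wave_1 integral_gauss_wave_1 t)
  also have "\<dots> = of_real (sqrt (pi / t) ^ CARD('n) * exp (\<Sum>b\<in>Basis. - pi\<^sup>2 * (\<xi> \<bullet> b)\<^sup>2 / t))"
    by (simp add: prod.distrib exp_sum of_real_prod)
  also have "(\<Sum>b\<in>Basis. - pi\<^sup>2 * (\<xi> \<bullet> b)\<^sup>2 / t) = - (pi\<^sup>2 / t) * (norm \<xi>)\<^sup>2"
  proof -
    have "(norm \<xi>)\<^sup>2 = (\<Sum>b\<in>Basis. (\<xi> \<bullet> b)\<^sup>2)"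
      unfolding power2_norm_eq_inner by (subst euclidean_inner) (simp add: power2_eq_square)
    then show ?thesis by (simp add: sum_distrib_left sum_negf sum_divide_distrib)
  qed
  also have "sqrt (pi / t) ^ CARD('n) = (pi / t) powr (CARD('n) / 2)"
    using t by (simp add: powr_half_sqrt[symmetric] powr_powr powr_realpow[symmetric])
  finally show "(LINT x|lborel. of_real (gauss t x) * wave \<xi> x) =
      of_real ((pi / t) powr (CARD('n) / 2) * gauss (pi\<^sup>2 / t) \<xi>)" by (simp add: gauss_def)
qed

lemma
  assumes t: "t > 0"
  shows integrable_gauss: "integrable lborel (gauss t :: real^'n::finite \<Rightarrow> real)"
    and integral_gauss: "(LINT x|lborel. gauss t (x::real^'n)) = (pi / t) powr (CARD('n) / 2)"
proof -
  have "integrable lborel (\<lambda>x::real^'n. complex_of_real (gauss t x))"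
    using integrable_gauss_wave[OF t, of 0] by simp
  from integrable_norm[OF this] show "integrable lborel (gauss t :: real^'n \<Rightarrow> real)"
    by (simp add: abs_of_pos gauss_pos)
  have "complex_of_real (LINT x|lborel. gauss t (x::real^'n)) = of_real ((pi / t) powr (CARD('n) / 2))"
    using integral_gauss_wave[OF t, of "0::real^'n"] by (simp add: gauss_def)
  then show "(LINT x|lborel. gauss t (x::real^'n)) = (pi / t) powr (CARD('n) / 2)"
    by (simp only: of_real_eq_iff)
qed

lemma has_partial_wave:
  "has_partial i (\<lambda>x. c * wave \<xi> x) x (2 * \<i> * of_real pi * of_real (\<xi> $ i) * (c * wave \<xi> x))"
proof -
  let ?k = "2 * \<i> * of_real pi :: complex"
  have "((\<lambda>t. c * exp (?k * of_real ((x \<bullet> \<xi>) + t * (\<xi> $ i)))) has_vector_derivative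
      (?k * of_real (\<xi> $ i) * (c * exp (?k * of_real (x \<bullet> \<xi>))))) (at 0)"
    by (rule has_vector_derivative_real_field derivative_eq_intros | simp)+
  then show ?thesis
    by (simp add: has_partial_def wave_def inner_add_left inner_axis')
qed

text \<open>Half of the Gaussian exponent absorbs the factor |x|.\<close>

lemma integrable_norm_gauss:
  fixes t :: real
  assumes t: "t > 0"
  shows "integrable lborel (\<lambda>x::real^'n::finite. norm x * gauss t x)"
proof (rule Bochner_Integration.integrable_bound)
  show "integrable lborel (\<lambda>x::real^'n. (1 + 1 / t) * gauss (t / 2) x)"
    using t by (intro integrable_mult_right integrable_gauss) simp
  show "(\<lambda>x::real^'n. norm x * gauss t x) \<in> borel_measurable lborel" by measurable
  have "norm x * gauss t x \<le> (1 + 1 / t) * gauss (t / 2) x" for x :: "real^'n"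
  proof -
    let ?r = "norm x"
    have "?r \<le> 1 + ?r\<^sup>2 / 2" using zero_le_power2[of "?r - 1"] by (simp add: power2_eq_square algebra_simps)
    also have "?r\<^sup>2 / 2 = (1 / t) * (t / 2 * ?r\<^sup>2)" using t by simp
    also have "\<dots> \<le> (1 / t) * exp (t / 2 * ?r\<^sup>2)"
    proof (rule mult_left_mono)
      show "t / 2 * ?r\<^sup>2 \<le> exp (t / 2 * ?r\<^sup>2)" using exp_ge_add_one_self[of "t / 2 * ?r\<^sup>2"] by linarith
    qed (use t in simp)
    also have "1 + (1 / t) * exp (t / 2 * ?r\<^sup>2) \<le> (1 + 1 / t) * exp (t / 2 * ?r\<^sup>2)"
      using t by (simp add: distrib_right)
    finally have "?r * gauss t x \<le> (1 + 1 / t) * exp (t / 2 * ?r\<^sup>2) * gauss t x"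
      using gauss_pos[of t x] by (intro mult_right_mono) auto
    also have "exp (t / 2 * ?r\<^sup>2) * gauss t x = gauss (t / 2) x"
      by (simp add: gauss_def exp_add[symmetric] algebra_simps)
    then have "(1 + 1 / t) * exp (t / 2 * ?r\<^sup>2) * gauss t x = (1 + 1 / t) * gauss (t / 2) x"
      by (simp add: mult.assoc)
    finally show ?thesis .
  qed
  then show "AE x in lborel. norm (norm x * gauss t x) \<le> norm ((1 + 1 / t) * gauss (t / 2) (x::real^'n))"
    using t by (intro AE_I2) (simp add: abs_mult abs_of_pos gauss_pos)
qed

text \<open>Obtained by differentiating both sides of \<open>integral_gauss_wave\<close> with
  respect to \<open>\<xi> $ i\<close> and dividing by 2 pi i; on the left the derivative of the wave
  supplies the factor x_i.\<close>

lemma integral_nth_gauss_wave: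
  fixes \<xi> :: "real^'n::finite"
  assumes t: "t > 0"
  shows "(LINT x|lborel. of_real (x $ i * gauss t x) * wave \<xi> x) =
      \<i> * of_real (pi * \<xi> $ i / t * ((pi / t) powr (CARD('n) / 2) * gauss (pi\<^sup>2 / t) \<xi>))"
proof -
  let ?k = "2 * \<i> * of_real pi :: complex" and ?c = "(pi / t) powr (CARD('n) / 2)"
  have h: "of_real (gauss t x) * wave \<xi> x = of_real (gauss t x) * wave x \<xi>" for \<xi> x :: "real^'n"
    by (simp add: wave_commute)
  have 1: "has_partial i (\<lambda>\<xi>. LINT x|lborel. of_real (gauss t x) * wave x \<xi>) \<xi>
      (LINT x|lborel. ?k * of_real (x $ i) * (of_real (gauss t x) * wave x \<xi>))"
  proof (rule has_partial_integral[where S=UNIV and g="\<lambda>x. 2 * pi * (norm x * gauss t x)"])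
    show "integrable lborel (\<lambda>x. of_real (gauss t x) * wave x y)" for y :: "real^'n"
      using integrable_gauss_wave[OF t, of y] by (simp add: h)
    show "integrable lborel (\<lambda>x::real^'n. 2 * pi * (norm x * gauss t x))"
      by (intro integrable_mult_right integrable_norm_gauss t)
    show "norm (?k * of_real (x $ i) * (of_real (gauss t x) * wave x y)) \<le> 2 * pi * (norm x * gauss t x)" for x y :: "real^'n"
      using component_le_norm_cart[of x i] gauss_pos[of t x]
      by (simp add: norm_mult mult_right_mono)
    show "(\<lambda>x. ?k * of_real (x $ i) * (of_real (gauss t x) * wave x \<xi>)) \<in> borel_measurable lborel"
      by measurable
  qed (auto intro: has_partial_wave)
  have eq: "(\<lambda>\<xi>. LINT x|lborel. of_real (gauss t x) * wave x \<xi>) =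
      (\<lambda>\<xi>::real^'n. complex_of_real (?c * exp (- (pi\<^sup>2 / t) * (\<xi> \<bullet> \<xi>))))"
  proof (rule ext)
    fix \<eta> :: "real^'n"
    show "(LINT x|lborel. of_real (gauss t x) * wave x \<eta>) =
        complex_of_real (?c * exp (- (pi\<^sup>2 / t) * (\<eta> \<bullet> \<eta>)))"
      using integral_gauss_wave[OF t, of \<eta>] unfolding h gauss_def[of "pi\<^sup>2 / t"] power2_norm_eq_inner .
  qed
  have "((\<lambda>r. complex_of_real (?c * exp (- (pi\<^sup>2 / t) * r))) has_vector_derivative
      complex_of_real (?c * (- (pi\<^sup>2 / t) * exp (- (pi\<^sup>2 / t) * (\<xi> \<bullet> \<xi>))))) (at (\<xi> \<bullet> \<xi>))"
    using t by (intro has_vector_derivative_of_real) (auto intro!: derivative_eq_intros)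
  from has_partial_real_comp[OF has_partial_inner_self this, of i]
  have 2: "has_partial i (\<lambda>\<xi>. complex_of_real (?c * exp (- (pi\<^sup>2 / t) * (\<xi> \<bullet> \<xi>)))) \<xi>
      ((2 * \<xi> $ i) *\<^sub>R complex_of_real (?c * (- (pi\<^sup>2 / t) * exp (- (pi\<^sup>2 / t) * (\<xi> \<bullet> \<xi>)))))" .
  have "(LINT x|lborel. ?k * of_real (x $ i) * (of_real (gauss t x) * wave x \<xi>)) =
      (2 * \<xi> $ i) *\<^sub>R complex_of_real (?c * (- (pi\<^sup>2 / t) * exp (- (pi\<^sup>2 / t) * (\<xi> \<bullet> \<xi>))))"
    using partial_deriv_eq[OF 1] partial_deriv_eq[OF 2] unfolding eq by simp
  also have "(LINT x|lborel. ?k * of_real (x $ i) * (of_real (gauss t x) * wave x \<xi>)) =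
      ?k * (LINT x|lborel. of_real (x $ i * gauss t x) * wave \<xi> x)"
    unfolding Bochner_Integration.integral_mult_right_zero[symmetric]
    by (intro Bochner_Integration.integral_cong refl) (simp add: wave_commute mult_ac)
  finally have "?k * (LINT x|lborel. of_real (x $ i * gauss t x) * wave \<xi> x) =
      ?k * (\<i> * of_real (pi * \<xi> $ i / t * (?c * gauss (pi\<^sup>2 / t) \<xi>)))"
    using t by (simp add: gauss_def dot_square_norm scaleR_conv_of_real power2_eq_square field_simps)
  from this[unfolded mult_cancel_left] show ?thesis by simp
qed

section \<open>Decay and integrability\<close>

lemma integrable_one_plus_abs_powr:
  fixes p :: real
  assumes p: "p > 1"
  shows "integrable lborel (\<lambda>x::real. (1 + \<bar>x\<bar>) powr (- p))"
proof (rule Bochner_Integration.integrable_bound)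
  let ?h = "\<lambda>x::real. indicator {1..} x * x powr (- p)"
  have h: "integrable lborel ?h"
    using has_bochner_integral_powr_atLeast[of "- p" 1] p by (simp add: has_bochner_integral_iff)
  have h': "integrable lborel (\<lambda>x. ?h (0 + (-1) * x))"
    using h by (subst lborel_integrable_real_affine_iff) auto
  show "integrable lborel (\<lambda>x. indicator {-1..1} x * 1 + (?h x + ?h (0 + (-1) * x)))"
    by (intro Bochner_Integration.integrable_add h h' integrable_mult_left integrable_real_indicator
        emeasure_bounded_finite) simp_all
  show "(\<lambda>x::real. (1 + \<bar>x\<bar>) powr (- p)) \<in> borel_measurable lborel" by measurable
  have "(1 + \<bar>x\<bar>) powr (- p) \<le> indicator {-1..1} x * 1 + (?h x + ?h (0 + (-1) * x))" for x :: real
  proof -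
    have 1: "(1 + \<bar>x\<bar>) powr (- p) \<le> 1" using p powr_mono2'[of "- p" 1 "1 + \<bar>x\<bar>"] by simp
    have 2: "(1 + \<bar>x\<bar>) powr (- p) \<le> \<bar>x\<bar> powr (- p)" if "\<bar>x\<bar> \<ge> 1"
      using that p by (intro powr_mono2') auto
    consider "\<bar>x\<bar> \<le> 1" | "x > 1" | "x < -1" by linarith
    then show ?thesis
    proof cases
      case 1
      then show ?thesis using \<open>(1 + \<bar>x\<bar>) powr (- p) \<le> 1\<close>
        by (auto simp: indicator_def add_increasing2)
    qed (use 2 in \<open>auto simp: indicator_def\<close>)
  qed
  moreover have "0 \<le> indicator {-1..1} x * 1 + (?h x + ?h (0 + (-1) * x))" for x :: real by simp
  ultimately show "AE x in lborel. norm ((1 + \<bar>x\<bar>) powr (- p)) \<le> norm (indicator {-1..1} x * 1 + (?h x + ?h (0 + (-1) * x)))"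
    by (intro AE_I2) (simp only: real_norm_def abs_of_nonneg powr_ge_zero)
qed

lemma integrable_one_plus_norm:
  "integrable lborel (\<lambda>x::real^'n::finite. 1 / (1 + norm x) ^ (CARD('n) + 1))"
proof (rule Bochner_Integration.integrable_bound)
  \<comment> \<open>Chosen with p d = d + 1: the radial weight is then dominated by a product of d
    weights of one variable, each integrable because p > 1.\<close>
  define p where "p = 1 + 1 / real CARD('n)"
  have p: "p > 1" by (simp add: p_def)
  show "integrable lborel (\<lambda>x::real^'n. \<Prod>b\<in>Basis. (1 + \<bar>x \<bullet> b\<bar>) powr (- p))"
    by (intro integrable_prod_Basis[where \<phi>="\<lambda>b s. (1 + \<bar>s\<bar>) powr (- p)"] integrable_one_plus_abs_powr p)
  show "(\<lambda>x::real^'n. 1 / (1 + norm x) ^ (CARD('n) + 1)) \<in> borel_measurable lborel" by measurable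
  have "1 / (1 + norm x) ^ (CARD('n) + 1) \<le> (\<Prod>b\<in>Basis. (1 + \<bar>x \<bullet> b\<bar>) powr (- p))" for x :: "real^'n"
  proof -
    have "(\<Prod>b\<in>(Basis::(real^'n) set). (1 + norm x) powr (- p)) \<le> (\<Prod>b\<in>Basis. (1 + \<bar>x \<bullet> b\<bar>) powr (- p))"
    proof (rule prod_mono)
      fix b :: "real^'n" assume "b \<in> Basis"
      then have "\<bar>x \<bullet> b\<bar> \<le> norm x" by (rule Basis_le_norm)
      then show "0 \<le> (1 + norm x) powr (- p) \<and> (1 + norm x) powr (- p) \<le> (1 + \<bar>x \<bullet> b\<bar>) powr (- p)"
        using p by (intro conjI powr_mono2') auto
    qed
    also have "(\<Prod>b\<in>(Basis::(real^'n) set). (1 + norm x) powr (- p)) = (1 + norm x) powr (- p * real CARD('n))"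
    proof -
      have "(1 + norm x) powr (- p) > 0" by (simp add: add_nonneg_eq_0_iff)
      from powr_realpow[OF this, of "CARD('n)"] show ?thesis by (simp add: powr_powr)
    qed
    also have "- p * real CARD('n) = - real (CARD('n) + 1)" by (simp add: p_def field_simps)
    also have "(1 + norm x) powr (- real (CARD('n) + 1)) = 1 / (1 + norm x) ^ (CARD('n) + 1)"
      unfolding powr_minus_divide by (subst powr_realpow) (auto intro: add_pos_nonneg)
    finally show ?thesis .
  qed
  moreover have "0 \<le> (\<Prod>b\<in>Basis. (1 + \<bar>x \<bullet> b\<bar>) powr (- p))" for x :: "real^'n" by (intro prod_nonneg) auto
  ultimately show "AE x in lborel. norm (1 / (1 + norm x) ^ (CARD('n) + 1)) \<le>
      norm (\<Prod>b\<in>Basis. (1 + \<bar>(x::real^'n) \<bullet> b\<bar>) powr (- p))"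
    by (intro AE_I2) simp
qed

lemma integrable_of_decay:
  fixes w :: "real^'n::finite \<Rightarrow> 'b::{banach, second_countable_topology}"
  assumes [measurable]: "w \<in> borel_measurable borel"
    and "\<And>x. (1 + norm x) ^ (CARD('n) + 1) * norm (w x) \<le> C"
  shows "integrable lborel w"
proof (rule Bochner_Integration.integrable_bound)
  show "integrable lborel (\<lambda>x::real^'n. C * (1 / (1 + norm x) ^ (CARD('n) + 1)))"
    by (intro integrable_mult_right integrable_one_plus_norm)
  have "norm (w x) \<le> C * (1 / (1 + norm x) ^ (CARD('n) + 1))" for x
  proof -
    have "0 < (1 + norm x) ^ (CARD('n) + 1)" by (intro zero_less_power add_pos_nonneg) auto
    then show ?thesis using assms(2)[of x] by (simp add: field_simps)
  qed
  then show "AE x in lborel. norm (w x) \<le> norm (C * (1 / (1 + norm x) ^ (CARD('n) + 1)))"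
    by (intro AE_I2 order_trans[OF _ abs_ge_self[of "C * _", folded real_norm_def]])
qed simp

text \<open>Schwartz decay with smoothness replaced by measurability: the symbol |\<xi>| of the half
  Laplacian is not smooth at 0, so the Schwartz class would not be preserved.\<close>

definition rapid :: "(real^'n::finite \<Rightarrow> complex) \<Rightarrow> bool" where
  "rapid w \<longleftrightarrow> w \<in> borel_measurable borel \<and> (\<forall>m. \<exists>C. \<forall>\<xi>. (1 + norm \<xi>) ^ m * norm (w \<xi>) \<le> C)"

lemma rapid_measurable: "rapid w \<Longrightarrow> w \<in> borel_measurable borel" by (simp add: rapid_def)

lemma rapid_integrable: "rapid w \<Longrightarrow> integrable lborel w"
  unfolding rapid_def using integrable_of_decay by blast

lemma rapid_mult:
  assumes w: "rapid w" and [measurable]: "v \<in> borel_measurable borel"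
    and v: "\<And>\<xi>. norm (v \<xi>) \<le> c * (1 + norm \<xi>) ^ p"
  shows "rapid (\<lambda>\<xi>. v \<xi> * w \<xi>)"
  unfolding rapid_def
proof (intro conjI allI)
  have [measurable]: "w \<in> borel_measurable borel" by (rule rapid_measurable[OF w])
  show "(\<lambda>\<xi>. v \<xi> * w \<xi>) \<in> borel_measurable borel" by measurable
  fix m
  from w obtain C where C: "\<And>\<xi>. (1 + norm \<xi>) ^ (m + p) * norm (w \<xi>) \<le> C" unfolding rapid_def by blast
  have c: "c \<ge> 0" using order_trans[OF norm_ge_zero v[of 0]] by simp
  have "(1 + norm \<xi>) ^ m * norm (v \<xi> * w \<xi>) \<le> c * C" for \<xi>
  proof -
    have "(1 + norm \<xi>) ^ m * norm (v \<xi> * w \<xi>) = (1 + norm \<xi>) ^ m * norm (w \<xi>) * norm (v \<xi>)"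
      by (simp add: norm_mult)
    also have "\<dots> \<le> (1 + norm \<xi>) ^ m * norm (w \<xi>) * (c * (1 + norm \<xi>) ^ p)"
      by (intro mult_left_mono v) auto
    also have "\<dots> = c * ((1 + norm \<xi>) ^ (m + p) * norm (w \<xi>))" by (simp add: power_add)
    also have "\<dots> \<le> c * C" using c by (intro mult_left_mono C)
    finally show ?thesis .
  qed
  then show "\<exists>C. \<forall>\<xi>. (1 + norm \<xi>) ^ m * norm (v \<xi> * w \<xi>) \<le> C" by blast
qed

section \<open>Derivatives of inverse Fourier transforms\<close>

definition deriv_symbol :: "'n::finite \<Rightarrow> real^'n \<Rightarrow> complex" where
  "deriv_symbol i \<xi> = 2 * \<i> * of_real pi * of_real (\<xi> $ i)"

lemma deriv_symbol_measurable[measurable (raw)]: "f \<in> borel_measurable M \<Longrightarrow> (\<lambda>w. deriv_symbol i (f w)) \<in> borel_measurable M"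
  unfolding deriv_symbol_def by measurable

lemma norm_deriv_symbol_le: "norm (deriv_symbol i \<xi>) \<le> 2 * pi * (1 + norm \<xi>)"
  using component_le_norm_cart[of \<xi> i] by (simp add: deriv_symbol_def norm_mult)

definition deriv_symbols :: "'n::finite list \<Rightarrow> real^'n \<Rightarrow> complex" where
  "deriv_symbols \<alpha> \<xi> = (\<Prod>i\<leftarrow>\<alpha>. deriv_symbol i \<xi>)"

lemma deriv_symbols_simps[simp]: "deriv_symbols [] \<xi> = 1" "deriv_symbols (i # \<alpha>) \<xi> = deriv_symbol i \<xi> * deriv_symbols \<alpha> \<xi>"
  by (simp_all add: deriv_symbols_def)

lemma deriv_symbols_measurable[measurable]: "deriv_symbols \<alpha> \<in> borel_measurable borel"
proof (induction \<alpha>)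
  case Nil show ?case by (simp add: deriv_symbols_def)
next
  case (Cons i \<alpha>)
  note Cons.IH[measurable]
  have "(\<lambda>\<xi>. deriv_symbol i \<xi> * deriv_symbols \<alpha> \<xi>) \<in> borel_measurable borel" by measurable
  then show ?case by (simp add: deriv_symbols_def)
qed

lemma norm_deriv_symbols_le: "norm (deriv_symbols \<alpha> \<xi>) \<le> (2 * pi) ^ length \<alpha> * (1 + norm \<xi>) ^ length \<alpha>"
proof (induction \<alpha>)
  case (Cons i \<alpha>)
  have "norm (deriv_symbols (i # \<alpha>) \<xi>) \<le> (2 * pi * (1 + norm \<xi>)) * ((2 * pi) ^ length \<alpha> * (1 + norm \<xi>) ^ length \<alpha>)"
    unfolding deriv_symbols_simps norm_mult by (intro mult_mono norm_deriv_symbol_le Cons.IH) (auto intro: mult_nonneg_nonneg)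
  then show ?case by (simp only: list.size power_Suc add_Suc_right add_0_right mult_ac)
qed simp

lemma rapid_deriv_symbols: "rapid w \<Longrightarrow> rapid (\<lambda>\<xi>. deriv_symbols \<alpha> \<xi> * w \<xi>)"
  by (rule rapid_mult[OF _ _ norm_deriv_symbols_le]) auto

lemma Ck_on_wave: "Ck_on k UNIV (\<lambda>x. c * wave \<xi> x)"
proof (induction k arbitrary: c)
  case 0
  show ?case unfolding Ck_on_0 wave_def by (intro continuous_intros)
next
  case (Suc k)
  show ?case
  proof (rule Ck_on_SucI[where D="\<lambda>i x. (deriv_symbol i \<xi> * c) * wave \<xi> x"])
    show "continuous_on UNIV (\<lambda>x. c * wave \<xi> x)" unfolding wave_def by (intro continuous_intros)
    show "has_partial i (\<lambda>x. c * wave \<xi> x) x (deriv_symbol i \<xi> * c * wave \<xi> x)" for i x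
      using has_partial_wave[of i c \<xi> x] by (simp add: deriv_symbol_def mult.assoc)
  qed (auto intro: Suc.IH)
qed

lemma iter_partial_wave: "iter_partial \<alpha> (\<lambda>x. c * wave \<xi> x) = (\<lambda>x. deriv_symbols \<alpha> \<xi> * c * wave \<xi> x)"
proof (induction \<alpha>)
  case (Cons i \<alpha>)
  have "partial_deriv i (\<lambda>x. (deriv_symbols \<alpha> \<xi> * c) * wave \<xi> x) x = deriv_symbols (i # \<alpha>) \<xi> * c * wave \<xi> x" for x
    using partial_deriv_eq[OF has_partial_wave[of i "deriv_symbols \<alpha> \<xi> * c" \<xi> x]] by (simp add: deriv_symbol_def mult.assoc)
  then show ?case unfolding iter_partial.simps Cons.IH by (rule ext)
qed simp

text \<open>Each derivative brings down a polynomial factor, which the rapid decay of w absorbs;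
  this gives majorants of every order.\<close>

lemma
  fixes w :: "real^'n::finite \<Rightarrow> complex"
  assumes w: "rapid w"
  shows smooth_inv_fourier: "smooth (inv_fourier w)"
    and iter_partial_inv_fourier: "iter_partial \<alpha> (inv_fourier w) = inv_fourier (\<lambda>\<xi>. deriv_symbols \<alpha> \<xi> * w \<xi>)"
proof -
  have [measurable]: "w \<in> borel_measurable borel" by (rule rapid_measurable[OF w])
  have eq: "inv_fourier w = (\<lambda>x. LINT \<xi>|lborel. w \<xi> * wave \<xi> x)" by (simp add: inv_fourier_eq fun_eq_iff)
  have meas: "(\<lambda>\<xi>. iter_partial \<alpha> (\<lambda>x. w \<xi> * wave \<xi> x) x) \<in> borel_measurable lborel" for \<alpha> x
    unfolding iter_partial_wave by measurable
  have bd: "\<exists>g. integrable lborel g \<and> (\<forall>x\<in>UNIV. \<forall>\<xi>\<in>space lborel. norm (iter_partial \<alpha> (\<lambda>x. w \<xi> * wave \<xi> x) x) \<le> g \<xi>)" for \<alpha>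
    unfolding iter_partial_wave
    by (rule exI[of _ "\<lambda>\<xi>. norm (deriv_symbols \<alpha> \<xi> * w \<xi>)"])
      (simp add: norm_mult[of _ "wave _ _"] integrable_norm[OF rapid_integrable[OF rapid_deriv_symbols[OF w]]])
  show "smooth (inv_fourier w)" unfolding smooth_def eq
    by (intro allI Ck_on_integral[OF open_UNIV Ck_on_wave meas bd])
  show "iter_partial \<alpha> (inv_fourier w) = inv_fourier (\<lambda>\<xi>. deriv_symbols \<alpha> \<xi> * w \<xi>)"
  proof
    fix x
    show "iter_partial \<alpha> (inv_fourier w) x = inv_fourier (\<lambda>\<xi>. deriv_symbols \<alpha> \<xi> * w \<xi>) x"
      unfolding eq inv_fourier_eq
      by (subst iter_partial_integral[OF open_UNIV Ck_on_wave meas bd le_refl UNIV_I])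
        (simp only: iter_partial_wave)
  qed
qed

lemma norm_inv_fourier_le:
  "norm (inv_fourier w x) \<le> (LINT \<xi>|lborel. norm (w \<xi>))"
  unfolding inv_fourier_eq using integral_norm_bound[of lborel "\<lambda>\<xi>. w \<xi> * wave \<xi> x"] by (simp add: norm_mult)

section \<open>Fourier transforms of test functions\<close>

text \<open>The support is not tied to \<Omega>: the distributional identity is proved for all such
  functions on the whole space, and \<Omega> enters only in the last step.\<close>

definition test_fun :: "(real^'n::finite \<Rightarrow> complex) \<Rightarrow> bool" where
  "test_fun \<psi> \<longleftrightarrow> smooth \<psi> \<and> (\<exists>R. \<forall>x. norm x > R \<longrightarrow> \<psi> x = 0)"

lemma test_fun_Ck: "test_fun \<psi> \<Longrightarrow> Ck_on k UNIV \<psi>" by (simp add: test_fun_def smooth_def)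

lemma test_fun_support:
  assumes "test_fun \<psi>" obtains R where "R \<ge> 0" "\<And>x. x \<notin> cball 0 R \<Longrightarrow> \<psi> x = 0"
proof -
  from assms obtain R where "\<And>x. norm x > R \<Longrightarrow> \<psi> x = 0" unfolding test_fun_def by blast
  then show ?thesis by (intro that[of "max R 0"]) auto
qed

lemma test_fun_iter_partial:
  assumes "test_fun \<psi>" shows "test_fun (iter_partial \<alpha> \<psi>)"
proof -
  obtain R where R: "\<And>x. x \<notin> cball 0 R \<Longrightarrow> \<psi> x = 0" using test_fun_support[OF assms] by blast
  have "iter_partial \<alpha> \<psi> x = 0" if "norm x > R" for x
    by (rule iter_partial_support[of "cball 0 R", OF closed_cball R]) (use that in auto)
  moreover have "smooth (iter_partial \<alpha> \<psi>)" unfolding smooth_def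
    using Ck_on_iter[OF test_fun_Ck[OF assms, of "length \<alpha> + k" for k]] by blast
  ultimately show ?thesis unfolding test_fun_def by blast
qed

lemma test_fun_partial: "test_fun \<psi> \<Longrightarrow> test_fun (partial_deriv i \<psi>)"
  using test_fun_iter_partial[of \<psi> "[i]"] by simp

lemma test_fun_measurable: "test_fun \<psi> \<Longrightarrow> \<psi> \<in> borel_measurable borel"
  using test_fun_Ck[of \<psi> 0] by (auto simp: Ck_on_0 intro: borel_measurable_continuous_onI)

lemma test_fun_bounded:
  assumes "test_fun \<psi>" obtains M where "M \<ge> 0" "\<And>x. norm (\<psi> x) \<le> M"
proof -
  obtain R where R: "\<And>x. x \<notin> cball 0 R \<Longrightarrow> \<psi> x = 0" using test_fun_support[OF assms] by blast
  obtain M where "M \<ge> 0" "\<And>\<alpha> x. length \<alpha> \<le> 0 \<Longrightarrow> norm (iter_partial \<alpha> \<psi> x) \<le> M"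
    using compact_support_bounded[OF test_fun_Ck[OF assms] compact_cball R, of 0] by metis
  then show ?thesis using that[of M] by (metis iter_partial.simps(1) le_refl list.size(3))
qed

lemma test_fun_integrable:
  assumes "test_fun \<psi>" shows "integrable lborel \<psi>"
proof -
  obtain R where R: "\<And>x. x \<notin> cball 0 R \<Longrightarrow> \<psi> x = 0" using test_fun_support[OF assms] by blast
  obtain M where M: "M \<ge> 0" "\<And>x. norm (\<psi> x) \<le> M" using test_fun_bounded[OF assms] by blast
  have "norm (\<psi> x) \<le> norm (indicator (cball 0 R) x * M)" for x
    using R[of x] M by (cases "x \<in> cball 0 R") auto
  then show ?thesis
    by (intro Bochner_Integration.integrable_bound[OF integrable_indicator_cball[of 0 R M]] AE_I2)
      (use test_fun_measurable[OF assms] in auto)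
qed

text \<open>Integration by parts, in the form that the partial derivative of the compactly supported
  product of \<psi> and a wave has integral 0.\<close>

lemma fourier_partial:
  assumes "test_fun \<psi>"
  shows "fourier (partial_deriv i \<psi>) \<xi> = deriv_symbol i \<xi> * fourier \<psi> \<xi>"
proof -
  obtain R where R: "\<And>x. x \<notin> cball 0 R \<Longrightarrow> \<psi> x = 0" using test_fun_support[OF assms] by blast
  let ?u = "\<lambda>x. \<psi> x * (1 * wave (- \<xi>) x)"
  have hp: "has_partial i ?u x (\<psi> x * (deriv_symbol i (- \<xi>) * (1 * wave (- \<xi>) x)) + partial_deriv i \<psi> x * (1 * wave (- \<xi>) x))" for x
    using has_partial_wave[of i 1 "- \<xi>" x] test_fun_Ck[OF assms, of 1]
    by (intro has_partial_mult) (auto simp: deriv_symbol_def Ck_on_Suc)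
  have eq: "partial_deriv i ?u x = partial_deriv i \<psi> x * wave (- \<xi>) x - deriv_symbol i \<xi> * (\<psi> x * wave (- \<xi>) x)" for x
    using partial_deriv_eq[OF hp, of x] by (simp add: deriv_symbol_def algebra_simps)
  have int: "integrable lborel (\<lambda>x. \<phi> x * wave (- \<xi>) x)" if "test_fun \<phi>" for \<phi>
    using test_fun_measurable[OF that]
    by (intro Bochner_Integration.integrable_bound[OF test_fun_integrable[OF that]]) (auto simp: norm_mult)
  have "(LINT x|lborel. partial_deriv i ?u x) = 0"
  proof (rule integral_partial_deriv_zero[OF _ compact_cball[of 0 R]])
    show "Ck_on 1 UNIV ?u" by (intro Ck_on_mult open_UNIV Ck_on_wave test_fun_Ck[OF assms])
  qed (simp add: R)
  then show ?thesis
    unfolding eq fourier_eq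
    using int[OF assms] int[OF test_fun_partial[OF assms]] by simp
qed

lemma fourier_iter_partial:
  "test_fun \<psi> \<Longrightarrow> fourier (iter_partial \<alpha> \<psi>) \<xi> = deriv_symbols \<alpha> \<xi> * fourier \<psi> \<xi>"
  by (induction \<alpha>) (auto simp: fourier_partial test_fun_iter_partial mult.assoc)

text \<open>Let i be a coordinate of \<xi> of largest modulus, so that |\<xi>| \<le> d |\<xi>_i|. If
  |\<xi>_i| > 1, then m derivatives in the single direction i pay for the weight; otherwise the
  weight itself is bounded. The sum over all i in C removes the dependence on \<xi>.\<close>

lemma rapid_fourier:
  fixes \<psi> :: "real^'n::finite \<Rightarrow> complex"
  assumes \<psi>: "test_fun \<psi>" shows "rapid (fourier \<psi>)"
  unfolding rapid_def
proof (intro conjI allI)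
  have [measurable]: "\<psi> \<in> borel_measurable borel" by (rule test_fun_measurable[OF \<psi>])
  show "fourier \<psi> \<in> borel_measurable borel"
    unfolding fourier_eq[abs_def] by measurable
  fix m :: nat
  define I where "I = (\<lambda>\<alpha>. LINT x|lborel. norm (iter_partial \<alpha> \<psi> x))"
  have le: "norm (deriv_symbols \<alpha> \<xi> * fourier \<psi> \<xi>) \<le> I \<alpha>" for \<alpha> \<xi>
  proof -
    have "norm (fourier (iter_partial \<alpha> \<psi>) \<xi>) \<le> I \<alpha>" unfolding fourier_eq I_def
      using integral_norm_bound[of lborel "\<lambda>x. iter_partial \<alpha> \<psi> x * wave (- \<xi>) x"] by (simp add: norm_mult)
    then show ?thesis by (simp only: fourier_iter_partial[OF \<psi>])
  qed
  have I0: "0 \<le> I \<alpha>" for \<alpha> unfolding I_def by simp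
  define C where "C = (1 + real CARD('n)) ^ m * (I [] + (\<Sum>i\<in>UNIV. I (replicate m i)))"
  have "(1 + norm \<xi>) ^ m * norm (fourier \<psi> \<xi>) \<le> C" for \<xi> :: "real^'n"
  proof -
    have "Max (range (\<lambda>j. \<bar>\<xi> $ j\<bar>)) \<in> range (\<lambda>j. \<bar>\<xi> $ j\<bar>)" by (rule Max_in) auto
    then obtain i where "Max (range (\<lambda>j. \<bar>\<xi> $ j\<bar>)) = \<bar>\<xi> $ i\<bar>" by blast
    moreover have "\<bar>\<xi> $ j\<bar> \<le> Max (range (\<lambda>j. \<bar>\<xi> $ j\<bar>))" for j by (rule Max_ge) auto
    ultimately have i: "\<And>j. \<bar>\<xi> $ j\<bar> \<le> \<bar>\<xi> $ i\<bar>" by simp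
    have n: "norm \<xi> \<le> real CARD('n) * \<bar>\<xi> $ i\<bar>"
      using norm_le_l1_cart[of \<xi>] sum_bounded_above[of UNIV "\<lambda>j. \<bar>\<xi> $ j\<bar>" "\<bar>\<xi> $ i\<bar>"] i by simp
    have deriv_symbols_rep: "deriv_symbols (replicate m i) \<xi> = deriv_symbol i \<xi> ^ m" by (induction m) auto
    show ?thesis
    proof (cases "\<bar>\<xi> $ i\<bar> \<le> 1")
      case True
      then have "real CARD('n) * \<bar>\<xi> $ i\<bar> \<le> real CARD('n) * 1" by (intro mult_left_mono) auto
      then have "(1 + norm \<xi>) ^ m * norm (fourier \<psi> \<xi>) \<le> (1 + real CARD('n)) ^ m * I []"
        using order_trans[OF n] le[of "[]" \<xi>] by (intro mult_mono power_mono) auto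
      also have "\<dots> \<le> C" unfolding C_def using I0 by (intro mult_left_mono) (auto intro: sum_nonneg)
      finally show ?thesis .
    next
      case False
      have "1 + norm \<xi> \<le> (1 + real CARD('n)) * \<bar>\<xi> $ i\<bar>" using n False by (simp add: distrib_right)
      also have "\<dots> \<le> (1 + real CARD('n)) * norm (deriv_symbol i \<xi>)"
      proof (intro mult_left_mono)
        have "1 * \<bar>\<xi> $ i\<bar> \<le> (2 * pi) * \<bar>\<xi> $ i\<bar>" using pi_gt3 by (intro mult_right_mono) auto
        then show "\<bar>\<xi> $ i\<bar> \<le> norm (deriv_symbol i \<xi>)" by (simp add: deriv_symbol_def norm_mult)
      qed simp
      finally have "(1 + norm \<xi>) ^ m \<le> ((1 + real CARD('n)) * norm (deriv_symbol i \<xi>)) ^ m"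
        by (intro power_mono) auto
      then have "(1 + norm \<xi>) ^ m * norm (fourier \<psi> \<xi>) \<le> ((1 + real CARD('n)) * norm (deriv_symbol i \<xi>)) ^ m * norm (fourier \<psi> \<xi>)"
        by (intro mult_right_mono) auto
      also have "\<dots> = (1 + real CARD('n)) ^ m * norm (deriv_symbols (replicate m i) \<xi> * fourier \<psi> \<xi>)"
        by (simp add: deriv_symbols_rep norm_mult norm_power power_mult_distrib)
      also have "\<dots> \<le> (1 + real CARD('n)) ^ m * I (replicate m i)" by (intro mult_left_mono le) auto
      also have "\<dots> \<le> C" unfolding C_def
        using I0 member_le_sum[of i UNIV "\<lambda>i. I (replicate m i)"] I0[of "[]"]
        by (intro mult_left_mono) (auto intro: add_increasing)
      finally show ?thesis .
    qed
  qed
  then show "\<exists>C. \<forall>\<xi>. (1 + norm \<xi>) ^ m * norm (fourier \<psi> \<xi>) \<le> C" by blast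
qed

text \<open>With the Gaussian factor Fubini applies, and the inner integral is the transform of a
  Gaussian: the damped inversion integral is a convolution with the heat kernel. It serves both the
  inversion formula and the decay of the half Laplacian.\<close>

lemma heat_fourier:
  fixes \<psi> :: "real^'n::finite \<Rightarrow> complex"
  assumes \<psi>: "test_fun \<psi>" and t: "t > 0"
  shows "inv_fourier (\<lambda>\<xi>. of_real (gauss t \<xi>) * fourier \<psi> \<xi>) x =
    (LINT y|lborel. of_real ((pi / t) powr (CARD('n) / 2) * gauss (pi\<^sup>2 / t) (x - y)) * \<psi> y)"
proof -
  note [measurable] = test_fun_measurable[OF \<psi>]
  let ?h = "\<lambda>\<xi> y. of_real (gauss t \<xi>) * (\<psi> y * wave (- \<xi>) y) * wave \<xi> x"
  have int\<psi>: "integrable lborel (\<lambda>y. norm (\<psi> y))" using test_fun_integrable[OF \<psi>] by simp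
  have I: "integrable (lborel \<Otimes>\<^sub>M lborel) (\<lambda>(\<xi>, y). ?h \<xi> y)"
  proof (rule lborel_pair.Fubini_integrable)
    show "(\<lambda>(\<xi>, y). ?h \<xi> y) \<in> borel_measurable (lborel \<Otimes>\<^sub>M lborel)" by measurable
    have eq: "(LINT y|lborel. norm (?h \<xi> y)) = gauss t \<xi> * (LINT y|lborel. norm (\<psi> y))" for \<xi>
      by (simp add: norm_mult abs_of_pos gauss_pos)
    show "integrable lborel (\<lambda>\<xi>. LINT y|lborel. norm (case (\<xi>, y) of (\<xi>, y) \<Rightarrow> ?h \<xi> y))"
      unfolding prod.case eq by (intro integrable_mult_left integrable_gauss t)
    show "AE \<xi> in lborel. integrable lborel (\<lambda>y. case (\<xi>, y) of (\<xi>, y) \<Rightarrow> ?h \<xi> y)"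
    proof (intro AE_I2)
      fix \<xi> :: "real^'n"
      show "integrable lborel (\<lambda>y. case (\<xi>, y) of (\<xi>, y) \<Rightarrow> ?h \<xi> y)" unfolding prod.case
        by (rule Bochner_Integration.integrable_bound[OF integrable_mult_right[OF int\<psi>, of "gauss t \<xi>"]])
          (simp_all add: norm_mult)
    qed
  qed
  have "inv_fourier (\<lambda>\<xi>. of_real (gauss t \<xi>) * fourier \<psi> \<xi>) x = (LINT \<xi>|lborel. LINT y|lborel. ?h \<xi> y)"
    by (simp add: inv_fourier_eq fourier_eq)
  also have "\<dots> = (LINT y|lborel. LINT \<xi>|lborel. ?h \<xi> y)"
    by (rule lborel_pair.Fubini_integral[OF I, symmetric])
  also have "\<dots> = (LINT y|lborel. \<psi> y * of_real ((pi / t) powr (CARD('n) / 2) * gauss (pi\<^sup>2 / t) (x - y)))"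
  proof (intro Bochner_Integration.integral_cong refl)
    fix y
    have "?h \<xi> y = \<psi> y * (of_real (gauss t \<xi>) * wave (x - y) \<xi>)" for \<xi>
    proof -
      have "wave (- \<xi>) y * wave \<xi> x = wave (x - y) \<xi>"
        by (simp add: wave_def exp_add[symmetric] inner_diff_right inner_commute algebra_simps)
      then show ?thesis by (simp add: mult_ac)
    qed
    then show "(LINT \<xi>|lborel. ?h \<xi> y) = \<psi> y * of_real ((pi / t) powr (CARD('n) / 2) * gauss (pi\<^sup>2 / t) (x - y))"
      by (simp only: Bochner_Integration.integral_mult_right_zero integral_gauss_wave[OF t])
  qed
  finally show ?thesis by (simp only: mult.commute)
qed

text \<open>The limit t to 0 of \<open>heat_fourier\<close>, computed twice: on the Fourier side the
  damping tends to 1, and on the space side the heat kernel concentrates at x.\<close>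

lemma fourier_inversion:
  fixes \<psi> :: "real^'n::finite \<Rightarrow> complex"
  assumes \<psi>: "test_fun \<psi>"
  shows "inv_fourier (fourier \<psi>) = \<psi>"
proof
  fix x
  note [measurable] = test_fun_measurable[OF \<psi>] rapid_measurable[OF rapid_fourier[OF \<psi>]]
  obtain M where M: "M \<ge> 0" "\<And>x. norm (\<psi> x) \<le> M" using test_fun_bounded[OF \<psi>] by blast
  define t where "t = (\<lambda>n::nat. 1 / (real (Suc n))\<^sup>2)"
  have t: "t n > 0" for n by (simp add: t_def)
  have t0: "t \<longlonglongrightarrow> 0" unfolding t_def by real_asymp
  have s: "sqrt (t n) = 1 / real (Suc n)" for n by (simp add: t_def real_sqrt_divide)
  let ?h = "\<lambda>n. inv_fourier (\<lambda>\<xi>. of_real (gauss (t n) \<xi>) * fourier \<psi> \<xi>) x"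
  have "?h \<longlonglongrightarrow> inv_fourier (fourier \<psi>) x"
    unfolding inv_fourier_eq
  proof (rule integral_dominated_convergence[where w="\<lambda>\<xi>. norm (fourier \<psi> \<xi>)"])
    show "integrable lborel (\<lambda>\<xi>. norm (fourier \<psi> \<xi>))"
      by (intro integrable_norm rapid_integrable rapid_fourier \<psi>)
    show "AE \<xi> in lborel. (\<lambda>n. of_real (gauss (t n) \<xi>) * fourier \<psi> \<xi> * wave \<xi> x) \<longlonglongrightarrow> fourier \<psi> \<xi> * wave \<xi> x"
    proof (intro AE_I2)
      fix \<xi> :: "real^'n"
      have "(\<lambda>n. exp (- t n * (norm \<xi>)\<^sup>2)) \<longlonglongrightarrow> exp (- 0 * (norm \<xi>)\<^sup>2)" by (intro tendsto_intros t0)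
      then have "(\<lambda>n. gauss (t n) \<xi>) \<longlonglongrightarrow> 1" by (simp add: gauss_def)
      then have "(\<lambda>n. of_real (gauss (t n) \<xi>) * fourier \<psi> \<xi> * wave \<xi> x) \<longlonglongrightarrow> of_real 1 * fourier \<psi> \<xi> * wave \<xi> x"
        by (intro tendsto_intros)
      then show "(\<lambda>n. of_real (gauss (t n) \<xi>) * fourier \<psi> \<xi> * wave \<xi> x) \<longlonglongrightarrow> fourier \<psi> \<xi> * wave \<xi> x" by simp
    qed
    show "AE \<xi> in lborel. norm (of_real (gauss (t n) \<xi>) * fourier \<psi> \<xi> * wave \<xi> x) \<le> norm (fourier \<psi> \<xi>)" for n
    proof (intro AE_I2)
      fix \<xi> :: "real^'n"
      have "gauss (t n) \<xi> \<le> 1" using t[of n] by (simp add: gauss_def)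
      then have "gauss (t n) \<xi> * norm (fourier \<psi> \<xi>) \<le> 1 * norm (fourier \<psi> \<xi>)" by (intro mult_right_mono) auto
      then show "norm (of_real (gauss (t n) \<xi>) * fourier \<psi> \<xi> * wave \<xi> x) \<le> norm (fourier \<psi> \<xi>)"
        by (simp add: norm_mult abs_of_pos gauss_pos)
    qed
  qed measurable
  moreover have "?h \<longlonglongrightarrow> \<psi> x"
  proof -
    let ?c = "pi powr (CARD('n) / 2)"
    have h: "?h n = (LINT v|lborel. of_real (?c * gauss (pi\<^sup>2) v) * \<psi> (x + sqrt (t n) *\<^sub>R v))" for n
    proof -
      let ?k = "\<lambda>y. of_real ((pi / t n) powr (CARD('n) / 2) * gauss (pi\<^sup>2 / t n) (x - y)) * \<psi> y"
      have "?h n = (LINT y|lborel. ?k y)" by (rule heat_fourier[OF \<psi> t])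
      also have "\<dots> = \<bar>sqrt (t n)\<bar> ^ CARD('n) *\<^sub>R (LINT v|lborel. ?k (x + sqrt (t n) *\<^sub>R v))"
        using t[of n] by (intro integral_affine) auto
      also have "\<dots> = (LINT v|lborel. \<bar>sqrt (t n)\<bar> ^ CARD('n) *\<^sub>R ?k (x + sqrt (t n) *\<^sub>R v))"
        by (rule integral_scaleR_right[symmetric])
      also have "(\<lambda>v. \<bar>sqrt (t n)\<bar> ^ CARD('n) *\<^sub>R ?k (x + sqrt (t n) *\<^sub>R v)) =
          (\<lambda>v. of_real (?c * gauss (pi\<^sup>2) v) * \<psi> (x + sqrt (t n) *\<^sub>R v))"
      proof
        fix v :: "real^'n"
        have 1: "gauss (pi\<^sup>2 / t n) (x - (x + sqrt (t n) *\<^sub>R v)) = gauss (pi\<^sup>2) v"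
          using t[of n] by (simp add: gauss_def power_mult_distrib)
        \<comment> \<open>The Jacobian of y = x + sqrt(t) v cancels the power of t in the heat
          kernel; afterwards n occurs only in the argument of \<psi>.\<close>
        have 2: "\<bar>sqrt (t n)\<bar> ^ CARD('n) * (pi / t n) powr (CARD('n) / 2) = ?c"
          using t[of n] by (simp add: powr_divide powr_half_sqrt[symmetric] powr_powr powr_realpow[symmetric])
        show "\<bar>sqrt (t n)\<bar> ^ CARD('n) *\<^sub>R ?k (x + sqrt (t n) *\<^sub>R v) =
            of_real (?c * gauss (pi\<^sup>2) v) * \<psi> (x + sqrt (t n) *\<^sub>R v)"
          unfolding 1 2[symmetric] by (simp add: scaleR_conv_of_real)
      qed
      finally show ?thesis .
    qed
    have "(\<lambda>n. LINT v|lborel. of_real (?c * gauss (pi\<^sup>2) v) * \<psi> (x + sqrt (t n) *\<^sub>R v)) \<longlonglongrightarrow>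
        (LINT v|lborel. of_real (?c * gauss (pi\<^sup>2) (v::real^'n)) * \<psi> x)"
    proof (rule integral_dominated_convergence[where w="\<lambda>v. ?c * M * gauss (pi\<^sup>2) v"])
      show "integrable lborel (\<lambda>v::real^'n. ?c * M * gauss (pi\<^sup>2) v)"
        by (intro integrable_mult_right integrable_gauss) simp
      have cont: "continuous_on UNIV \<psi>" using test_fun_Ck[OF \<psi>, of 0] by (simp add: Ck_on_0)
      show "AE v in lborel. (\<lambda>n. of_real (?c * gauss (pi\<^sup>2) v) * \<psi> (x + sqrt (t n) *\<^sub>R v)) \<longlonglongrightarrow> of_real (?c * gauss (pi\<^sup>2) v) * \<psi> x"
      proof (intro AE_I2 tendsto_intros)
        fix v :: "real^'n"
        have "(\<lambda>n. x + sqrt (t n) *\<^sub>R v) \<longlonglongrightarrow> x + sqrt 0 *\<^sub>R v" by (intro tendsto_intros t0)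
        then have "(\<lambda>n. x + sqrt (t n) *\<^sub>R v) \<longlonglongrightarrow> x" by simp
        then show "(\<lambda>n. \<psi> (x + sqrt (t n) *\<^sub>R v)) \<longlonglongrightarrow> \<psi> x"
          by (rule continuous_on_tendsto_compose[OF cont]) auto
      qed
      show "AE v in lborel. norm (of_real (?c * gauss (pi\<^sup>2) v) * \<psi> (x + sqrt (t n) *\<^sub>R v)) \<le> ?c * M * gauss (pi\<^sup>2) v" for n
        using M(2) by (intro AE_I2) (simp add: norm_mult abs_of_pos gauss_pos mult_left_mono less_imp_le mult.commute mult.left_commute)
    qed measurable
    moreover have "(LINT v|lborel. of_real (?c * gauss (pi\<^sup>2) (v::real^'n)) * \<psi> x) = \<psi> x"
    proof -
      have "(LINT v|lborel. of_real (?c * gauss (pi\<^sup>2) (v::real^'n)) * \<psi> x) =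
          of_real (?c * (LINT v|lborel. gauss (pi\<^sup>2) (v::real^'n))) * \<psi> x"
        by (simp add: integral_complex_of_real)
      also have "?c * (LINT v|lborel. gauss (pi\<^sup>2) (v::real^'n)) = 1"
        by (subst integral_gauss) (simp_all add: powr_mult[symmetric] power2_eq_square)
      finally show ?thesis by simp
    qed
    ultimately show ?thesis by (simp only: h)
  qed
  ultimately show "inv_fourier (fourier \<psi>) x = \<psi> x" by (rule LIMSEQ_unique)
qed

section \<open>Gamma integrals\<close>

text \<open>Gives access to the change of variables theorem, which speaks of absolute
  integrability.\<close>

lemma has_bochner_integral_iff_absolutely:
  fixes f :: "real \<Rightarrow> real"
  assumes [measurable]: "f \<in> borel_measurable borel" "S \<in> sets borel"
  shows "has_bochner_integral lborel (\<lambda>x. indicator S x * f x) b \<longleftrightarrow>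
    f absolutely_integrable_on S \<and> integral S f = b"
proof -
  have 1: "f absolutely_integrable_on S \<longleftrightarrow> integrable lborel (\<lambda>x. indicator S x * f x)"
    by (simp add: set_integrable_def integrable_completion)
  have 2: "integral S f = (LINT x|lborel. indicator S x * f x)" if "f absolutely_integrable_on S"
    using set_lebesgue_integral_eq_integral(2)[OF that]
    by (simp add: set_lebesgue_integral_def integral_completion)
  show ?thesis unfolding has_bochner_integral_iff using 1 2 by auto
qed

lemma has_bochner_integral_Gamma:
  fixes a b :: real
  assumes a: "a > 0" and b: "b > 0"
  shows "has_bochner_integral lborel (\<lambda>t. indicator {0<..} t * (t powr (a - 1) * exp (- b * t))) (Gamma a * b powr (- a))"
proof -
  let ?f = "\<lambda>t::real. indicator {0..} t * (t powr (a - 1) / exp t)"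
  have "has_bochner_integral lborel ?f (Gamma a)"
    by (intro has_bochner_integral_of_has_integral Gamma_integral_real a) auto
  then have "has_bochner_integral lborel (\<lambda>t. ?f (0 + b * t)) (Gamma a /\<^sub>R \<bar>b\<bar>)"
    using b by (subst (asm) lborel_has_bochner_integral_real_affine_iff[of b _ _ 0]) auto
  then have "has_bochner_integral lborel (\<lambda>t. b powr (1 - a) * ?f (0 + b * t)) (b powr (1 - a) * (Gamma a /\<^sub>R \<bar>b\<bar>))"
    by (rule has_bochner_integral_mult_right)
  also have "b powr (1 - a) * (Gamma a /\<^sub>R \<bar>b\<bar>) = Gamma a * b powr (- a)"
    using b by (simp add: powr_diff powr_minus field_simps)
  also have "(\<lambda>t. b powr (1 - a) * ?f (0 + b * t)) = (\<lambda>t. indicator {0<..} t * (t powr (a - 1) * exp (- b * t)))"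
  proof
    fix t :: real
    consider "t < 0" | "t = 0" | "t > 0" by linarith
    then show "b powr (1 - a) * ?f (0 + b * t) = indicator {0<..} t * (t powr (a - 1) * exp (- b * t))"
    proof cases
      case 1
      then have "b * t < 0" using b by (simp add: mult_less_0_iff)
      then show ?thesis using 1 by simp
    next
      case 3
      have "b powr (1 - a) * (b * t) powr (a - 1) = (b powr (1 - a) * b powr (a - 1)) * t powr (a - 1)"
        using b 3 by (simp add: powr_mult)
      also have "b powr (1 - a) * b powr (a - 1) = 1" using b by (simp add: powr_add[symmetric])
      finally have "b powr (1 - a) * (b * t) powr (a - 1) = t powr (a - 1)" by simp
      then show ?thesis using 3 b by (simp add: exp_minus divide_inverse mult.assoc[symmetric])
    qed simp
  qed
  finally show ?thesis .
qed

text \<open>The Gamma integral after the substitution of 1 / t for t, whose Jacobian 1 / t^2 turns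
  t^(1-a) into t^(-a-1). This is the form in which heat kernels, with 1 / t in the exponent, are
  integrated over t.\<close>

lemma has_bochner_integral_inverse_Gamma:
  fixes a b :: real
  assumes a: "a > 0" and b: "b > 0"
  shows "has_bochner_integral lborel (\<lambda>t. indicator {0<..} t * (t powr (- a - 1) * exp (- b / t))) (Gamma a * b powr (- a))"
proof -
  let ?f = "\<lambda>u::real. u powr (a - 1) * exp (- b * u)"
  have img: "(\<lambda>t. 1 / t) ` {0<..} = {0::real<..}"
  proof (intro set_eqI iffI)
    fix u :: real assume "u \<in> {0<..}"
    then show "u \<in> (\<lambda>t. 1 / t) ` {0<..}" by (intro image_eqI[of _ _ "1 / u"]) auto
  qed auto
  have inj: "inj_on (\<lambda>t. 1 / t) {0::real<..}" by (auto intro!: inj_onI)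
  have der: "((\<lambda>t::real. 1 / t) has_field_derivative (- 1 / t\<^sup>2)) (at t within {0<..})" if "t \<in> {0<..}" for t
    using that by (auto intro!: derivative_eq_intros simp: power2_eq_square)
  have F: "?f absolutely_integrable_on {0<..} \<and> integral {0<..} ?f = Gamma a * b powr (- a)"
    by (subst has_bochner_integral_iff_absolutely[symmetric]) (use has_bochner_integral_Gamma[OF a b] in auto)
  let ?F = "\<lambda>t::real. \<bar>- 1 / t\<^sup>2\<bar> * ?f (1 / t)"
  have "?F absolutely_integrable_on {0<..} \<and> integral {0<..} ?F = Gamma a * b powr (- a)"
    by (subst has_absolute_integral_change_of_variables_1'[OF _ der inj]) (use F img in auto)
  then have "has_bochner_integral lborel (\<lambda>t. indicator {0<..} t * ?F t) (Gamma a * b powr (- a))"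
    by (subst has_bochner_integral_iff_absolutely) auto
  also have "(\<lambda>t. indicator {0<..} t * ?F t) = (\<lambda>t. indicator {0<..} t * (t powr (- a - 1) * exp (- b / t)))"
  proof
    fix t :: real
    have "1 / t\<^sup>2 * (1 / t) powr (a - 1) = t powr (- a - 1)" if "t > 0"
    proof -
      have "1 / t\<^sup>2 * (1 / t) powr (a - 1) = t powr (-2) * t powr (1 - a)"
        using that by (simp add: powr_divide powr_minus powr_numeral powr_diff field_simps)
      also have "\<dots> = t powr (- a - 1)"
        unfolding powr_add[symmetric] by (rule arg_cong[where f="\<lambda>e. t powr e"]) simp
      finally show ?thesis .
    qed
    then show "indicator {0<..} t * ?F t = indicator {0<..} t * (t powr (- a - 1) * exp (- b / t))"
      by (cases "t > 0") (simp_all add: mult.assoc[symmetric])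
  qed
  finally show ?thesis .
qed

text \<open>Integrating over \<open>t\<close> at \<open>b = \<parallel>\<xi>\<parallel>\<^sup>2\<close> produces the symbol \<open>\<parallel>\<xi>\<parallel>\<close> of the half Laplacian.\<close>

definition subordinator :: "real \<Rightarrow> real \<Rightarrow> real" where
  "subordinator b t = indicator {0<..} t * (t powr (-3/2) * (1 - exp (- b * t)))"

lemma subordinator_nonneg: "b \<ge> 0 \<Longrightarrow> subordinator b t \<ge> 0"
  by (auto simp: subordinator_def indicator_def)

lemma subordinator_measurable[measurable (raw)]:
  assumes [measurable]: "f \<in> borel_measurable M" "g \<in> borel_measurable M"
  shows "(\<lambda>w. subordinator (f w) (g w)) \<in> borel_measurable M"
  unfolding subordinator_def by measurable

text \<open>Near 0 the inequality 1 - exp(-t) \<le> t improves t^(-3/2) to t^(-1/2); at infinity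
  t^(-3/2) is integrable by itself.\<close>

lemma subordinator_integrable_1: "integrable lborel (subordinator 1)"
proof (rule Bochner_Integration.integrable_bound)
  let ?g = "\<lambda>t::real. indicator {0..1} t * t powr (-1/2) + indicator {1..} t * t powr (-3/2)"
  show "integrable lborel ?g"
    using has_bochner_integral_powr_atMost[of "-1/2" 1] has_bochner_integral_powr_atLeast[of "-3/2" 1]
    by (intro Bochner_Integration.integrable_add) (auto simp: has_bochner_integral_iff)
  have "subordinator 1 t \<le> ?g t" for t
  proof -
    consider "t \<le> 0" | "0 < t" "t \<le> 1" | "t > 1" by linarith
    then show ?thesis
    proof cases
      case 2
      have "1 - exp (- 1 * t) \<le> t" using exp_ge_add_one_self[of "- t"] by simp
      then have "t powr (-3/2) * (1 - exp (- 1 * t)) \<le> t powr (-3/2) * t" by (intro mult_left_mono) auto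
      also have "\<dots> = t powr (-3/2) * t powr 1" using 2 by simp
      also have "\<dots> = t powr (-1/2)" unfolding powr_add[symmetric] by simp
      also have "\<dots> \<le> ?g t" using 2 by (simp add: indicator_def)
      finally show ?thesis using 2 by (simp add: subordinator_def)
    next
      case 3
      have "t powr (-3/2) * (1 - exp (- 1 * t)) \<le> t powr (-3/2) * 1" by (intro mult_left_mono) auto
      then show ?thesis using 3 by (auto simp: subordinator_def indicator_def)
    qed (auto simp: subordinator_def indicator_def)
  qed
  then show "AE t in lborel. norm (subordinator 1 t) \<le> norm (?g t)"
    by (intro AE_I2) (simp add: abs_of_nonneg subordinator_nonneg)
qed measurable

text \<open>Kept as an unevaluated constant: it divides the constant in
  \<open>half_laplacian_decay\<close> and does not enter the identity.\<close>

definition subordinator_mass :: real where "subordinator_mass = integral\<^sup>L lborel (subordinator 1)"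

lemma subordinator_mass_pos: "subordinator_mass > 0"
proof -
  let ?c = "2 powr (-3/2) * (1 - exp (-1)) :: real"
  have "0 < (LINT t|lborel. indicator {1..2::real} t * ?c)" by simp
  also have "\<dots> \<le> subordinator_mass" unfolding subordinator_mass_def
  proof (rule integral_mono[OF _ subordinator_integrable_1])
    show "integrable lborel (\<lambda>t. indicator {1..2::real} t * ?c)"
      by (intro integrable_mult_left integrable_real_indicator emeasure_bounded_finite) simp_all
    show "indicator {1..2} t * ?c \<le> subordinator 1 t" for t
    proof (cases "t \<in> {1..2}")
      case True
      then have "?c \<le> t powr (-3/2) * (1 - exp (- 1 * t))" by (intro mult_mono powr_mono2') auto
      then show ?thesis using True by (simp add: subordinator_def)
    qed (simp add: subordinator_nonneg)
  qed
  finally show ?thesis .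
qed

lemma has_bochner_integral_subordinator:
  fixes b :: real
  assumes "b \<ge> 0"
  shows "has_bochner_integral lborel (subordinator b) (subordinator_mass * sqrt b)"
proof (cases "b = 0")
  case True
  then have "subordinator b = (\<lambda>t. 0)" by (simp add: subordinator_def fun_eq_iff)
  then show ?thesis using True by (simp add: has_bochner_integral_zero)
next
  case False
  then have b: "b > 0" using assms by simp
  have "has_bochner_integral lborel (subordinator 1) subordinator_mass"
    by (simp add: has_bochner_integral_iff subordinator_integrable_1 subordinator_mass_def)
  then have "has_bochner_integral lborel (\<lambda>t. subordinator 1 (0 + b * t)) (subordinator_mass /\<^sub>R \<bar>b\<bar>)"
    using b by (subst (asm) lborel_has_bochner_integral_real_affine_iff[of b _ _ 0]) auto
  then have "has_bochner_integral lborel (\<lambda>t. b powr (3/2) * subordinator 1 (0 + b * t)) (b powr (3/2) * (subordinator_mass /\<^sub>R \<bar>b\<bar>))"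
    by (rule has_bochner_integral_mult_right)
  also have "b powr (3/2) * (subordinator_mass /\<^sub>R \<bar>b\<bar>) = subordinator_mass * (b powr (3/2) * b powr (-1))"
    using b by (simp add: powr_minus field_simps)
  also have "b powr (3/2) * b powr (-1) = sqrt b"
    using b unfolding powr_add[symmetric] by (simp add: powr_half_sqrt)
  also have "(\<lambda>t. b powr (3/2) * subordinator 1 (0 + b * t)) = subordinator b"
  proof
    fix t
    show "b powr (3/2) * subordinator 1 (0 + b * t) = subordinator b t"
    proof (cases "t > 0")
      case True
      have "b powr (3/2) * (b * t) powr (-3/2) = (b powr (3/2) * b powr (-3/2)) * t powr (-3/2)"
        using b True by (simp add: powr_mult)
      also have "b powr (3/2) * b powr (-3/2) = 1" using b unfolding powr_add[symmetric] by simp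
      finally show ?thesis using True b by (simp add: subordinator_def mult.assoc[symmetric])
    next
      case False
      then have "b * t \<le> 0" using b by (simp add: mult_le_0_iff)
      then show ?thesis using False by (simp add: subordinator_def)
    qed
  qed
  finally show ?thesis .
qed

lemma norm_integral_le_of_bound:
  fixes f :: "'a \<Rightarrow> 'b::{banach, second_countable_topology}"
  assumes g: "integrable M g" and le: "\<And>x. norm (f x) \<le> g x"
  shows "norm (integral\<^sup>L M f) \<le> integral\<^sup>L M g"
proof (cases "integrable M f")
  case True
  have "norm (integral\<^sup>L M f) \<le> (LINT x|M. norm (f x))" by (rule integral_norm_bound)
  also have "\<dots> \<le> integral\<^sup>L M g" by (rule integral_mono[OF integrable_norm[OF True] g le])
  finally show ?thesis .
next
  case False
  have "0 \<le> integral\<^sup>L M g"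
    by (rule Bochner_Integration.integral_nonneg) (rule order_trans[OF norm_ge_zero le])
  then show ?thesis using False by (simp add: not_integrable_integral_eq)
qed

section \<open>Decay of the half Laplacian of a test function\<close>

lemma rapid_norm: "rapid w \<Longrightarrow> rapid (\<lambda>\<xi>. of_real (norm \<xi>) * w \<xi>)"
  by (rule rapid_mult[where c=1 and p=1]) auto

lemma rapid_gauss: "rapid w \<Longrightarrow> t \<ge> 0 \<Longrightarrow> rapid (\<lambda>\<xi>. of_real (gauss t \<xi>) * w \<xi>)"
  by (rule rapid_mult[where c=1 and p=0]) (auto simp: gauss_def)

lemma inv_fourier_integrable: "rapid w \<Longrightarrow> integrable lborel (\<lambda>\<xi>. w \<xi> * wave \<xi> x)"
  by (rule Bochner_Integration.integrable_bound[OF rapid_integrable])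
    (auto simp: norm_mult dest: rapid_measurable)

text \<open>Writing |\<xi>| as an integral of t^(-3/2) (1 - exp(-t |\<xi>|^2)) gives the difference
  of \<psi> and its heat evolution. At a zero of \<psi> the first term drops out by Fourier
  inversion, and only heat kernels remain.\<close>

lemma half_laplacian_subordination:
  fixes \<psi> :: "real^'n::finite \<Rightarrow> complex"
  assumes \<psi>: "test_fun \<psi>" and x: "\<psi> x = 0"
  shows "of_real subordinator_mass * inv_fourier (\<lambda>\<xi>. of_real (norm \<xi>) * fourier \<psi> \<xi>) x =
    - (LINT t|lborel. of_real (indicator {0<..} t * t powr (-3/2)) *
        inv_fourier (\<lambda>\<xi>. of_real (gauss t \<xi>) * fourier \<psi> \<xi>) x)"
proof -
  let ?v = "fourier \<psi>"
  have v: "rapid ?v" by (rule rapid_fourier[OF \<psi>])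
  note [measurable] = rapid_measurable[OF v]
  let ?h = "\<lambda>\<xi> t. of_real (subordinator ((norm \<xi>)\<^sup>2) t) * (?v \<xi> * wave \<xi> x)"
  have sub: "(LINT t|lborel. subordinator ((norm \<xi>)\<^sup>2) t) = subordinator_mass * norm \<xi>"
    "integrable lborel (subordinator ((norm \<xi>)\<^sup>2))" for \<xi> :: "real^'n"
    using has_bochner_integral_subordinator[of "(norm \<xi>)\<^sup>2"] by (simp_all add: has_bochner_integral_iff)
  have I: "integrable (lborel \<Otimes>\<^sub>M lborel) (\<lambda>(\<xi>, t). ?h \<xi> t)"
  proof (rule lborel_pair.Fubini_integrable)
    show "(\<lambda>(\<xi>, t). ?h \<xi> t) \<in> borel_measurable (lborel \<Otimes>\<^sub>M lborel)" by measurable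
    have eq: "(LINT t|lborel. norm (?h \<xi> t)) = subordinator_mass * norm (of_real (norm \<xi>) * ?v \<xi>)" for \<xi>
      by (simp add: norm_mult abs_of_nonneg subordinator_nonneg sub)
    show "integrable lborel (\<lambda>\<xi>. LINT t|lborel. norm (case (\<xi>, t) of (\<xi>, t) \<Rightarrow> ?h \<xi> t))"
      unfolding prod.case eq
      by (intro integrable_mult_right integrable_norm rapid_integrable rapid_norm v)
    show "AE \<xi> in lborel. integrable lborel (\<lambda>t. case (\<xi>, t) of (\<xi>, t) \<Rightarrow> ?h \<xi> t)"
      unfolding prod.case by (intro AE_I2 integrable_mult_left integrable_of_real sub)
  qed
  have "of_real subordinator_mass * inv_fourier (\<lambda>\<xi>. of_real (norm \<xi>) * ?v \<xi>) x = (LINT \<xi>|lborel. LINT t|lborel. ?h \<xi> t)"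
    unfolding inv_fourier_eq Bochner_Integration.integral_mult_right_zero[symmetric]
      Bochner_Integration.integral_mult_left_zero integral_complex_of_real sub
    by (simp add: mult.assoc)
  also have "\<dots> = (LINT t|lborel. LINT \<xi>|lborel. ?h \<xi> t)"
    by (rule lborel_pair.Fubini_integral[OF I, symmetric])
  also have "\<dots> = (LINT t|lborel. - (of_real (indicator {0<..} t * t powr (-3/2)) *
        inv_fourier (\<lambda>\<xi>. of_real (gauss t \<xi>) * ?v \<xi>) x))"
  proof (intro Bochner_Integration.integral_cong refl)
    fix t :: real
    show "(LINT \<xi>|lborel. ?h \<xi> t) = - (of_real (indicator {0<..} t * t powr (-3/2)) *
        inv_fourier (\<lambda>\<xi>. of_real (gauss t \<xi>) * ?v \<xi>) x)"
    proof (cases "t > 0")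
      case True
      have "?h \<xi> t = of_real (t powr (-3/2)) * (?v \<xi> * wave \<xi> x - of_real (gauss t \<xi>) * ?v \<xi> * wave \<xi> x)" for \<xi>
        using True by (simp add: subordinator_def gauss_def algebra_simps)
      then have "(LINT \<xi>|lborel. ?h \<xi> t) = of_real (t powr (-3/2)) *
          (inv_fourier ?v x - inv_fourier (\<lambda>\<xi>. of_real (gauss t \<xi>) * ?v \<xi>) x)"
        unfolding inv_fourier_eq
        using True inv_fourier_integrable[OF v, of x] inv_fourier_integrable[OF rapid_gauss[OF v], of t x]
        by (simp only: Bochner_Integration.integral_mult_right_zero Bochner_Integration.integral_diff less_imp_le)
      then show ?thesis using True x by (simp add: fourier_inversion[OF \<psi>])
    qed (simp add: subordinator_def)
  qed
  finally show ?thesis by simp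
qed

text \<open>If \<psi> lives in the ball of radius R and |x| > 2 R, then |x - y| \<ge> |x| / 2 on the
  support, so the heat evolution at x is at most a multiple of t^(-d/2) exp(- b / t) with b = pi^2
  |x|^2 / 4. Integration against t^(-3/2) yields b^(-(d+1)/2), a multiple of |x|^(-d-1). For smaller
  |x| boundedness is enough.\<close>

lemma half_laplacian_decay:
  fixes \<psi> :: "real^'n::finite \<Rightarrow> complex"
  assumes \<psi>: "test_fun \<psi>"
  shows "\<exists>C. \<forall>x. (1 + norm x ^ (CARD('n) + 1)) * norm (inv_fourier (\<lambda>\<xi>. of_real (norm \<xi>) * fourier \<psi> \<xi>) x) \<le> C"
proof -
  let ?f = "inv_fourier (\<lambda>\<xi>. of_real (norm \<xi>) * fourier \<psi> \<xi>)"
  note [measurable] = test_fun_measurable[OF \<psi>]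
  obtain R where R: "R \<ge> 0" "\<And>x. x \<notin> cball 0 R \<Longrightarrow> \<psi> x = 0" using test_fun_support[OF \<psi>] by blast
  define B where "B = (LINT \<xi>|lborel. norm (of_real (norm \<xi>) * fourier \<psi> \<xi>))"
  have fB: "norm (?f x) \<le> B" for x unfolding B_def by (rule norm_inv_fourier_le)
  define I where "I = (LINT y|lborel. norm (\<psi> y))"
  have I0: "I \<ge> 0" by (simp add: I_def)
  define d where "d = real CARD('n)"
  define D where "D = pi powr (d / 2) * I * (Gamma ((d + 1) / 2) * (pi\<^sup>2 / 4) powr (- ((d + 1) / 2))) / subordinator_mass"
  have d0: "(d + 1) / 2 > 0" by (simp add: d_def)
  have heat: "norm (inv_fourier (\<lambda>\<xi>. of_real (gauss t \<xi>) * fourier \<psi> \<xi>) x) \<le>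
      pi powr (d / 2) * I * (t powr (- d / 2) * exp (- (pi\<^sup>2 / 4 * (norm x)\<^sup>2) / t))"
    if t: "t > 0" and x: "norm x \<ge> 2 * R" for t x
  proof -
    let ?c = "(pi / t) powr (d / 2) * exp (- (pi\<^sup>2 / 4 * (norm x)\<^sup>2) / t)"
    have "norm (inv_fourier (\<lambda>\<xi>. of_real (gauss t \<xi>) * fourier \<psi> \<xi>) x) \<le>
        (LINT y|lborel. norm (of_real ((pi / t) powr (d / 2) * gauss (pi\<^sup>2 / t) (x - y)) * \<psi> y))"
      unfolding heat_fourier[OF \<psi> t] d_def by (rule integral_norm_bound)
    also have "\<dots> \<le> (LINT y|lborel. ?c * norm (\<psi> y))"
    proof (rule integral_mono)
      have le: "norm (of_real ((pi / t) powr (d / 2) * gauss (pi\<^sup>2 / t) (x - y)) * \<psi> y) \<le> ?c * norm (\<psi> y)" for y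
      proof (cases "\<psi> y = 0")
        case False
        then have "norm y \<le> R" using R(2)[of y] by (meson mem_cball_0)
        then have "norm x / 2 \<le> norm (x - y)" using x norm_triangle_ineq2[of x y] by linarith
        then have "(norm x / 2)\<^sup>2 \<le> (norm (x - y))\<^sup>2" by (intro power_mono) auto
        then have "(norm x)\<^sup>2 / 4 \<le> (norm (x - y))\<^sup>2" by (simp add: power_divide)
        then have "pi\<^sup>2 / t * ((norm x)\<^sup>2 / 4) \<le> pi\<^sup>2 / t * (norm (x - y))\<^sup>2" using t by (intro mult_left_mono) auto
        then have "gauss (pi\<^sup>2 / t) (x - y) \<le> exp (- (pi\<^sup>2 / 4 * (norm x)\<^sup>2) / t)"
          unfolding gauss_def by (simp add: field_simps)
        then show ?thesis
          by (simp add: norm_mult abs_mult abs_of_pos gauss_pos mult_left_mono mult_right_mono)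
      qed simp
      show "norm (of_real ((pi / t) powr (d / 2) * gauss (pi\<^sup>2 / t) (x - y)) * \<psi> y) \<le> ?c * norm (\<psi> y)" for y
        by (rule le)
      show int: "integrable lborel (\<lambda>y. ?c * norm (\<psi> y))"
        by (intro integrable_mult_right integrable_norm test_fun_integrable \<psi>)
      show "integrable lborel (\<lambda>y. norm (of_real ((pi / t) powr (d / 2) * gauss (pi\<^sup>2 / t) (x - y)) * \<psi> y))"
        by (rule Bochner_Integration.integrable_bound[OF int])
          (use le in \<open>auto intro!: AE_I2 intro: order_trans[OF _ abs_ge_self]\<close>)
    qed
    also have "\<dots> = ?c * I" by (simp add: I_def)
    finally have le: "norm (inv_fourier (\<lambda>\<xi>. of_real (gauss t \<xi>) * fourier \<psi> \<xi>) x) \<le> ?c * I" .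
    have "(pi / t) powr (d / 2) = pi powr (d / 2) * t powr (- d / 2)"
    proof -
      have "(pi / t) powr (d / 2) = pi powr (d / 2) / t powr (d / 2)" using t by (intro powr_divide)
      moreover have "t powr (- d / 2) = 1 / t powr (d / 2)" using powr_minus_divide[of t "d / 2"] by simp
      ultimately show ?thesis by simp
    qed
    then have "?c * I = pi powr (d / 2) * I * (t powr (- d / 2) * exp (- (pi\<^sup>2 / 4 * (norm x)\<^sup>2) / t))"
      by (simp only: mult_ac)
    with le show ?thesis by (simp only:)
  qed
  have far: "norm x ^ (CARD('n) + 1) * norm (?f x) \<le> D" if x: "norm x > 2 * R" for x
  proof -
    have x0: "norm x > 0" using x R by linarith
    have "norm x > R" using x R by linarith
    then have "\<psi> x = 0" using R(2)[of x] by simp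
    note hl = half_laplacian_subordination[OF \<psi> this]
    have eq: "subordinator_mass * norm (?f x) = norm (LINT t|lborel. of_real (indicator {0<..} t * t powr (-3/2)) *
        inv_fourier (\<lambda>\<xi>. of_real (gauss t \<xi>) * fourier \<psi> \<xi>) x)"
      (is "_ = norm ?J")
    proof -
      have "norm (complex_of_real subordinator_mass * ?f x) = norm ?J" unfolding hl by (rule norm_minus_cancel)
      then show ?thesis using subordinator_mass_pos by (simp only: norm_mult norm_of_real abs_of_pos)
    qed
    define b where "b = pi\<^sup>2 / 4 * (norm x)\<^sup>2"
    have b: "b > 0" using x0 by (simp add: b_def)
    let ?g = "\<lambda>t. pi powr (d / 2) * I * (indicator {0<..} t * (t powr (- ((d + 1) / 2) - 1) * exp (- b / t)))"
    have g: "has_bochner_integral lborel ?g (pi powr (d / 2) * I * (Gamma ((d + 1) / 2) * b powr (- ((d + 1) / 2))))"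
      by (intro has_bochner_integral_mult_right has_bochner_integral_inverse_Gamma d0 b)
    have le: "norm (of_real (indicator {0<..} t * t powr (-3/2)) *
        inv_fourier (\<lambda>\<xi>. of_real (gauss t \<xi>) * fourier \<psi> \<xi>) x) \<le> ?g t" for t
    proof (cases "t > 0")
      case True
      have "t powr (-3/2) * norm (inv_fourier (\<lambda>\<xi>. of_real (gauss t \<xi>) * fourier \<psi> \<xi>) x) \<le>
          t powr (-3/2) * (pi powr (d / 2) * I * (t powr (- d / 2) * exp (- b / t)))"
        using heat[OF True, of x] x unfolding b_def by (intro mult_left_mono) auto
      also have "\<dots> = pi powr (d / 2) * I * ((t powr (-3/2) * t powr (- d / 2)) * exp (- b / t))" by simp
      also have "t powr (-3/2) * t powr (- d / 2) = t powr (- ((d + 1) / 2) - 1)"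
        unfolding powr_add[symmetric] by (rule arg_cong[where f="\<lambda>e. t powr e"]) (simp add: field_simps)
      finally show ?thesis using True by (simp add: norm_mult)
    qed simp
    have "subordinator_mass * norm (?f x) \<le> integral\<^sup>L lborel ?g"
      unfolding eq
      by (rule norm_integral_le_of_bound[OF integrable.intros[OF g] le])
    also have "\<dots> = pi powr (d / 2) * I * (Gamma ((d + 1) / 2) * b powr (- ((d + 1) / 2)))"
      by (rule has_bochner_integral_integral_eq[OF g])
    finally have le2: "subordinator_mass * norm (?f x) \<le> pi powr (d / 2) * I * (Gamma ((d + 1) / 2) * b powr (- ((d + 1) / 2)))" .
    have bp: "b powr (- ((d + 1) / 2)) = (pi\<^sup>2 / 4) powr (- ((d + 1) / 2)) * inverse (norm x ^ (CARD('n) + 1))"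
    proof -
      have "b powr (- ((d + 1) / 2)) = (pi\<^sup>2 / 4) powr (- ((d + 1) / 2)) * ((norm x)\<^sup>2) powr (- ((d + 1) / 2))"
        unfolding b_def by (intro powr_mult)
      also have "((norm x)\<^sup>2) powr (- ((d + 1) / 2)) = norm x powr (- (d + 1))"
      proof -
        have "(norm x)\<^sup>2 = norm x powr 2" using x0 powr_realpow[of "norm x" 2] by simp
        then have "((norm x)\<^sup>2) powr (- ((d + 1) / 2)) = norm x powr (2 * (- ((d + 1) / 2)))"
          by (simp only: powr_powr)
        also have "2 * (- ((d + 1) / 2)) = - (d + 1)" by (simp add: field_simps)
        finally show ?thesis .
      qed
      also have "\<dots> = inverse (norm x ^ (CARD('n) + 1))"
      proof -
        have "d + 1 = real (CARD('n) + 1)" by (simp add: d_def)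
        then show ?thesis using powr_realpow[OF x0, of "CARD('n) + 1"] by (simp only: powr_minus)
      qed
      finally show ?thesis .
    qed
    have "norm (?f x) \<le> pi powr (d / 2) * I * (Gamma ((d + 1) / 2) * b powr (- ((d + 1) / 2))) / subordinator_mass"
      using le2 subordinator_mass_pos by (simp only: pos_le_divide_eq mult.commute)
    then have "norm (?f x) \<le> D * inverse (norm x ^ (CARD('n) + 1))"
      by (simp only: bp D_def times_divide_eq_left times_divide_eq_right mult_ac)
    then have "norm x ^ (CARD('n) + 1) * norm (?f x) \<le> norm x ^ (CARD('n) + 1) * (D * inverse (norm x ^ (CARD('n) + 1)))"
      by (intro mult_left_mono) auto
    then show ?thesis using x0 by (simp add: field_simps)
  qed
  have D0: "D \<ge> 0" unfolding D_def using I0 subordinator_mass_pos Gamma_real_pos[OF d0]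
    by (intro divide_nonneg_pos mult_nonneg_nonneg) auto
  have B0: "B \<ge> 0" by (simp add: B_def)
  have "(1 + norm x ^ (CARD('n) + 1)) * norm (?f x) \<le> B + D + (2 * R) ^ (CARD('n) + 1) * B" for x
  proof -
    have "norm x ^ (CARD('n) + 1) * norm (?f x) \<le> D + (2 * R) ^ (CARD('n) + 1) * B"
    proof (cases "norm x > 2 * R")
      case True
      then show ?thesis using far[OF True] R(1) B0 by (auto intro: add_increasing2)
    next
      case False
      then have "norm x ^ (CARD('n) + 1) * norm (?f x) \<le> (2 * R) ^ (CARD('n) + 1) * B"
        using R(1) by (intro mult_mono power_mono fB) auto
      then show ?thesis using D0 by linarith
    qed
    then show ?thesis using fB[of x] by (simp add: distrib_right)
  qed
  then show ?thesis by blast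
qed

section \<open>The fundamental solution\<close>

definition spatial_sign :: "'n::finite \<Rightarrow> real^'n \<Rightarrow> real" where
  "spatial_sign i y = y $ i / norm y"

lemma spatial_sign_measurable[measurable (raw)]:
  assumes [measurable]: "f \<in> borel_measurable M"
  shows "(\<lambda>w. spatial_sign i (f w)) \<in> borel_measurable M"
  unfolding spatial_sign_def by measurable

lemma spatial_sign_le: "\<bar>spatial_sign i y\<bar> \<le> 1"
  using component_le_norm_cart[of y i] by (simp add: spatial_sign_def divide_le_eq_1)

text \<open>The Gamma integral with a = 1/2 and b = |y|^2, where Gamma(1/2) = sqrt(pi) and b^(-1/2)
  = 1 / |y|. The absolute version is there for Fubini.\<close>

lemma spatial_sign_subordination:
  fixes y :: "real^'n::finite"
  shows "has_bochner_integral lborel (\<lambda>t. indicator {0<..} t * t powr (-1/2) * (y $ i * gauss t y)) (sqrt pi * spatial_sign i y)"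
    and "has_bochner_integral lborel (\<lambda>t. \<bar>indicator {0<..} t * t powr (-1/2) * (y $ i * gauss t y)\<bar>) (sqrt pi * \<bar>spatial_sign i y\<bar>)"
proof -
  have *: "has_bochner_integral lborel (\<lambda>t. c * (indicator {0<..} t * (t powr (1/2 - 1) * exp (- (norm y)\<^sup>2 * t)))) (sqrt pi * (c / norm y))"
    if "y \<noteq> 0" for c
  proof -
    have "(norm y)\<^sup>2 > 0" using that by simp
    from has_bochner_integral_mult_right[OF has_bochner_integral_Gamma[OF _ this, of "1/2"], of c]
    have "has_bochner_integral lborel (\<lambda>t. c * (indicator {0<..} t * (t powr (1/2 - 1) * exp (- (norm y)\<^sup>2 * t))))
        (c * (Gamma (1/2) * ((norm y)\<^sup>2) powr (- (1/2))))" by simp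
    moreover have "((norm y)\<^sup>2) powr (- (1/2)) = 1 / norm y"
      by (simp add: powr_minus_divide powr_half_sqrt)
    ultimately show ?thesis by (simp add: Gamma_one_half_real mult.commute[of "sqrt pi"])
  qed
  have e: "indicator {0<..} t * t powr (-1/2) * (y $ i * gauss t y) =
      y $ i * (indicator {0<..} t * (t powr (1/2 - 1) * exp (- (norm y)\<^sup>2 * t)))" for t
    by (simp add: gauss_def mult_ac)
  have e': "\<bar>indicator {0<..} t * t powr (-1/2) * (y $ i * gauss t y)\<bar> =
      \<bar>y $ i\<bar> * (indicator {0<..} t * (t powr (1/2 - 1) * exp (- (norm y)\<^sup>2 * t)))" for t
    unfolding e by (simp add: abs_mult)
  show "has_bochner_integral lborel (\<lambda>t. indicator {0<..} t * t powr (-1/2) * (y $ i * gauss t y)) (sqrt pi * spatial_sign i y)"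
    unfolding e spatial_sign_def using * by (cases "y = 0") (auto simp: has_bochner_integral_zero)
  show "has_bochner_integral lborel (\<lambda>t. \<bar>indicator {0<..} t * t powr (-1/2) * (y $ i * gauss t y)\<bar>) (sqrt pi * \<bar>spatial_sign i y\<bar>)"
    unfolding e' spatial_sign_def using * by (cases "y = 0") (auto simp: has_bochner_integral_zero)
qed

text \<open>For fixed t the kernel is integrable, so Fubini moves the pairing to the Fourier side;
  the translation by z comes out as the factor \<open>wave \<xi> z\<close>.\<close>

lemma spatial_sign_pairing_layer:
  fixes v :: "real^'n::finite \<Rightarrow> complex"
  assumes v: "rapid v" and t: "t > 0"
  shows "(LINT x|lborel. of_real ((x - z) $ i * gauss t (x - z)) * inv_fourier v x) =
    (LINT \<xi>|lborel. v \<xi> * wave \<xi> z *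
      (\<i> * of_real (pi * \<xi> $ i / t * ((pi / t) powr (CARD('n) / 2) * gauss (pi\<^sup>2 / t) \<xi>))))"
proof -
  note [measurable] = rapid_measurable[OF v]
  let ?h = "\<lambda>x \<xi>. of_real ((x - z) $ i * gauss t (x - z)) * (v \<xi> * wave \<xi> x)"
  have int_g: "integrable lborel (\<lambda>x::real^'n. x $ i * gauss t x)"
    by (rule Bochner_Integration.integrable_bound[OF integrable_norm_gauss[OF t]])
      (auto simp: abs_mult intro!: AE_I2 mult_right_mono component_le_norm_cart)
  have int_gz: "integrable lborel (\<lambda>x::real^'n. (x - z) $ i * gauss t (x - z))"
  proof -
    have "integrable lborel (\<lambda>x::real^'n. (- z + 1 *\<^sub>R x) $ i * gauss t (- z + 1 *\<^sub>R x))"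
      using int_g by (subst integrable_affine[of "\<lambda>x. x $ i * gauss t x" 1 "- z"]) auto
    moreover have "- z + 1 *\<^sub>R x = x - z" for x by simp
    ultimately show ?thesis by (simp only:)
  qed
  have I: "integrable (lborel \<Otimes>\<^sub>M lborel) (\<lambda>(x, \<xi>). ?h x \<xi>)"
  proof (rule lborel_pair.Fubini_integrable)
    show "(\<lambda>(x, \<xi>). ?h x \<xi>) \<in> borel_measurable (lborel \<Otimes>\<^sub>M lborel)" by measurable
    have eq: "(LINT \<xi>|lborel. norm (?h x \<xi>)) = \<bar>(x - z) $ i * gauss t (x - z)\<bar> * (LINT \<xi>|lborel. norm (v \<xi>))" for x
      by (simp only: norm_mult norm_of_real norm_wave mult_1_right Bochner_Integration.integral_mult_right_zero)
    show "integrable lborel (\<lambda>x. LINT \<xi>|lborel. norm (case (x, \<xi>) of (x, \<xi>) \<Rightarrow> ?h x \<xi>))"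
      unfolding prod.case eq by (intro integrable_mult_left integrable_abs int_gz)
    show "AE x in lborel. integrable lborel (\<lambda>\<xi>. case (x, \<xi>) of (x, \<xi>) \<Rightarrow> ?h x \<xi>)"
      unfolding prod.case by (intro AE_I2 integrable_mult_right inv_fourier_integrable v)
  qed
  have "(LINT x|lborel. of_real ((x - z) $ i * gauss t (x - z)) * inv_fourier v x) = (LINT x|lborel. LINT \<xi>|lborel. ?h x \<xi>)"
    unfolding inv_fourier_eq Bochner_Integration.integral_mult_right_zero ..
  also have "\<dots> = (LINT \<xi>|lborel. LINT x|lborel. ?h x \<xi>)"
    by (rule lborel_pair.Fubini_integral[OF I, symmetric])
  also have "\<dots> = (LINT \<xi>|lborel. v \<xi> * wave \<xi> z *
      (\<i> * of_real (pi * \<xi> $ i / t * ((pi / t) powr (CARD('n) / 2) * gauss (pi\<^sup>2 / t) \<xi>))))"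
  proof (intro Bochner_Integration.integral_cong refl)
    fix \<xi> :: "real^'n"
    have "(LINT x|lborel. ?h x \<xi>) = (LINT x|lborel. ?h (z + x) \<xi>)"
      by (rule integral_translate[symmetric]) measurable
    also have "\<dots> = (LINT x|lborel. v \<xi> * wave \<xi> z * (of_real (x $ i * gauss t x) * wave \<xi> x))"
      by (intro Bochner_Integration.integral_cong refl) (simp add: wave_add)
    finally show "(LINT x|lborel. ?h x \<xi>) = v \<xi> * wave \<xi> z *
      (\<i> * of_real (pi * \<xi> $ i / t * ((pi / t) powr (CARD('n) / 2) * gauss (pi\<^sup>2 / t) \<xi>)))"
      unfolding Bochner_Integration.integral_mult_right_zero integral_nth_gauss_wave[OF t] .
  qed
  finally show ?thesis .
qed

definition inv_gamma_const :: "nat \<Rightarrow> real" where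
  "inv_gamma_const d = 2 ^ d * pi powr ((real d - 1) / 2) * Gamma ((real d + 1) / 2)"

lemma inv_gamma_const_pos: "inv_gamma_const d > 0"
  unfolding inv_gamma_const_def by (intro mult_pos_pos Gamma_real_pos) auto

lemma gamma_const_eq: "gamma_const d = 1 / inv_gamma_const d"
  by (simp add: gamma_const_def inv_gamma_const_def inverse_eq_divide)

text \<open>The powers t^(-1/2), t^(-1) and t^(-d/2) combine to the exponent of the inverse Gamma
  integral with a = (d + 1) / 2; the result is a multiple of |\<xi>_i| |\<xi>|^(-d-1), the modulus
  of the formal transform of the spatial sign. Taking |\<xi>_i| makes the integrand nonnegative, so
  that it also controls the absolute integral.\<close>

lemma layer_symbol_integral:
  fixes \<xi> :: "real^'n::finite" and i :: 'n
  defines "s \<equiv> \<lambda>t. indicator {0<..} t * t powr (-1/2) * (pi * \<bar>\<xi> $ i\<bar> / t * ((pi / t) powr (CARD('n) / 2) * gauss (pi\<^sup>2 / t) \<xi>))"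
  assumes "\<xi> \<noteq> 0"
  shows "has_bochner_integral lborel s
    (\<bar>\<xi> $ i\<bar> * (pi * pi powr (CARD('n) / 2) * (Gamma ((real CARD('n) + 1) / 2) * (pi * norm \<xi>) powr (- (real CARD('n) + 1)))))"
proof -
  let ?a = "(real CARD('n) + 1) / 2" and ?b = "pi\<^sup>2 * (norm \<xi>)\<^sup>2"
  have b: "?b > 0" using assms by simp
  have "has_bochner_integral lborel (\<lambda>t. \<bar>\<xi> $ i\<bar> * (pi * pi powr (CARD('n) / 2) * (indicator {0<..} t * (t powr (- ?a - 1) * exp (- ?b / t)))))
      (\<bar>\<xi> $ i\<bar> * (pi * pi powr (CARD('n) / 2) * (Gamma ?a * ?b powr (- ?a))))"
    by (intro has_bochner_integral_mult_right has_bochner_integral_inverse_Gamma b) simp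
  also have "(\<lambda>t. \<bar>\<xi> $ i\<bar> * (pi * pi powr (CARD('n) / 2) * (indicator {0<..} t * (t powr (- ?a - 1) * exp (- ?b / t))))) = s"
  proof
    fix t :: real
    show "\<bar>\<xi> $ i\<bar> * (pi * pi powr (CARD('n) / 2) * (indicator {0<..} t * (t powr (- ?a - 1) * exp (- ?b / t)))) = s t"
    proof (cases "t > 0")
      case True
      let ?X = "(pi / t) powr (CARD('n) / 2)" and ?Y = "pi powr (CARD('n) / 2)" and ?A = "t powr (-1/2)"
      have "?X = ?Y / t powr (CARD('n) / 2)" using True by (intro powr_divide)
      then have X: "?X = ?Y * t powr (- (CARD('n) / 2))"
        by (simp only: powr_minus_divide times_divide_eq_right mult_1_right)
      have "1 / t = t powr (-1)" using True by (simp add: powr_minus_divide)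
      then have "?A * (1 / t) * ?X = ?Y * (?A * t powr (-1) * t powr (- (CARD('n) / 2)))"
        unfolding X by (simp only: mult_ac)
      also have "?A * t powr (-1) * t powr (- (CARD('n) / 2)) = t powr (- ?a - 1)"
        unfolding powr_add[symmetric] by (rule arg_cong[where f="\<lambda>e. t powr e"]) (simp add: field_simps)
      finally have 1: "?A * (1 / t) * ?X = ?Y * t powr (- ?a - 1)" .
      have E: "gauss (pi\<^sup>2 / t) \<xi> = exp (- ?b / t)" by (simp add: gauss_def)
      have "s t = \<bar>\<xi> $ i\<bar> * (pi * (?A * (1 / t) * ?X) * exp (- ?b / t))"
        using True unfolding s_def E by (simp only: indicator_simps greaterThan_iff mult_1_left divide_inverse mult_ac)
      then show ?thesis using True unfolding 1
        by (simp only: indicator_simps greaterThan_iff mult_1_left mult_ac)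
    qed (simp add: s_def)
  qed
  also have "?b powr (- ?a) = (pi * norm \<xi>) powr (- (real CARD('n) + 1))"
  proof -
    have "?b = (pi * norm \<xi>) powr 2" using assms by (simp add: power_mult_distrib)
    then have "?b powr (- ?a) = (pi * norm \<xi>) powr (2 * (- ?a))" by (simp only: powr_powr)
    also have "2 * (- ?a) = - (real CARD('n) + 1)" by (simp add: field_simps)
    finally show ?thesis .
  qed
  finally show ?thesis .
qed

text \<open>The origin of gamma_d. The factors are 2 pi from one derivative, (2 pi r)^(d-1) from the
  power of the Laplacian, the value of \<open>layer_symbol_integral\<close>, and r^2 from \<xi>_i^2;
  all powers of r cancel. The factor sqrt(pi) belongs to the subordination of the spatial
  sign.\<close>

lemma constant_identity:
  assumes "r > 0" and that: "d \<ge> 1"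
  shows "2 * pi * (2 * pi * r) ^ (d - 1) * (pi * pi powr (d / 2) * (Gamma ((real d + 1) / 2) * (pi * r) powr (- (real d + 1)))) * r\<^sup>2
    = sqrt pi * inv_gamma_const d"
proof -
  have p: "(2 * pi * r) ^ (d - 1) = (2 * pi * r) powr (real d - 1)"
    using assms that by (subst powr_realpow[symmetric]) (auto simp: of_nat_diff)
  have "2 * pi * (2 * pi * r) ^ (d - 1) * (pi * pi powr (d / 2) * (Gamma ((real d + 1) / 2) * (pi * r) powr (- (real d + 1)))) * r\<^sup>2
    = Gamma ((real d + 1) / 2) * (2 powr 1 * 2 powr (real d - 1)) *
      (pi powr 1 * pi powr (real d - 1) * pi powr 1 * pi powr (d / 2) * pi powr (- (real d + 1))) *
      (r powr (real d - 1) * r powr (- (real d + 1)) * r powr 2)"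
    unfolding p using assms by (simp add: powr_mult)
  also have "2 powr 1 * 2 powr (real d - 1) = 2 ^ d"
    unfolding powr_add[symmetric] by (simp add: powr_realpow)
  also have "pi powr 1 * pi powr (real d - 1) * pi powr 1 * pi powr (d / 2) * pi powr (- (real d + 1)) = pi powr (1/2) * pi powr ((real d - 1) / 2)"
    unfolding powr_add[symmetric] by (rule arg_cong[where f="\<lambda>e. pi powr e"]) (simp add: field_simps)
  also have "r powr (real d - 1) * r powr (- (real d + 1)) * r powr 2 = 1"
    unfolding powr_add[symmetric] using assms by simp
  finally show ?thesis unfolding inv_gamma_const_def
    by (simp only: powr_half_sqrt[OF pi_ge_zero] mult_ac mult_1_right)
qed

text \<open>Two exchanges of integrals. In x and t the integrability of \<open>inv_fourier v\<close>
  suffices, the spatial sign being bounded. In \<xi> and t the symbol of v compensates the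
  singularity at 0: what is left is the bounded function (\<xi>_i / |\<xi>|)^2 times u.\<close>

lemma spatial_sign_pairing:
  fixes u :: "real^'n::finite \<Rightarrow> complex" and i :: 'n
  assumes u: "rapid u"
  defines "v \<equiv> \<lambda>\<xi>. deriv_symbol i \<xi> * (of_real ((2 * pi * norm \<xi>) ^ (CARD('n) - 1)) * u \<xi>)"
  assumes D: "integrable lborel (inv_fourier v)"
  shows "(LINT x|lborel. of_real (spatial_sign i (x - z)) * inv_fourier v x) =
    - (of_real (inv_gamma_const CARD('n)) * (LINT \<xi>|lborel. of_real ((spatial_sign i \<xi>)\<^sup>2) * (u \<xi> * wave \<xi> z)))"
proof -
  define d where "d = CARD('n)"
  have d1: "d \<ge> 1" by (simp add: d_def Suc_le_eq)
  have v: "rapid v"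
  proof -
    have "rapid (\<lambda>\<xi>. (deriv_symbol i \<xi> * of_real ((2 * pi * norm \<xi>) ^ (CARD('n) - 1))) * u \<xi>)"
    proof (rule rapid_mult[OF u, where c="2 * pi * (2 * pi) ^ (CARD('n) - 1)" and p="1 + (CARD('n) - 1)"])
      fix \<xi> :: "real^'n"
      have "(2 * pi * norm \<xi>) ^ (CARD('n) - 1) \<le> (2 * pi * (1 + norm \<xi>)) ^ (CARD('n) - 1)"
        by (intro power_mono mult_left_mono) auto
      then have "norm (deriv_symbol i \<xi>) * (2 * pi * norm \<xi>) ^ (CARD('n) - 1) \<le> (2 * pi * (1 + norm \<xi>)) * (2 * pi * (1 + norm \<xi>)) ^ (CARD('n) - 1)"
        by (intro mult_mono norm_deriv_symbol_le) auto
      then show "norm (deriv_symbol i \<xi> * of_real ((2 * pi * norm \<xi>) ^ (CARD('n) - 1))) \<le>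
          2 * pi * (2 * pi) ^ (CARD('n) - 1) * (1 + norm \<xi>) ^ (1 + (CARD('n) - 1))"
        unfolding norm_mult norm_of_real power_mult_distrib power_add power_one_right
        by (simp only: abs_mult power_abs abs_power2 abs_norm_cancel abs_of_nonneg[OF pi_ge_zero] abs_numeral
            zero_le_power zero_le_mult_iff mult_ac)
    qed measurable
    then show ?thesis by (simp add: v_def mult.assoc)
  qed
  note [measurable] = rapid_measurable[OF v] rapid_measurable[OF u]
  have [measurable]: "inv_fourier v \<in> borel_measurable borel" using D by simp
  let ?k = "\<lambda>t y. indicator {0<..} t * t powr (-1/2) * (y $ i * gauss t (y::real^'n))"
  let ?h = "\<lambda>x t. of_real (?k t (x - z)) * inv_fourier v x"
  have sub: "integrable lborel (\<lambda>t. ?k t y)" "(LINT t|lborel. ?k t y) = sqrt pi * spatial_sign i y"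
    "(LINT t|lborel. \<bar>?k t y\<bar>) = sqrt pi * \<bar>spatial_sign i y\<bar>" for y
    using spatial_sign_subordination[of y i] by (simp_all only: has_bochner_integral_iff)
  have IA: "integrable (lborel \<Otimes>\<^sub>M lborel) (\<lambda>(x, t). ?h x t)"
  proof (rule lborel_pair.Fubini_integrable)
    show "(\<lambda>(x, t). ?h x t) \<in> borel_measurable (lborel \<Otimes>\<^sub>M lborel)" by measurable
    have eq: "(LINT t|lborel. norm (?h x t)) = (sqrt pi * \<bar>spatial_sign i (x - z)\<bar>) * norm (inv_fourier v x)" for x
      unfolding norm_mult norm_of_real Bochner_Integration.integral_mult_left_zero sub ..
    show "integrable lborel (\<lambda>x. LINT t|lborel. norm (case (x, t) of (x, t) \<Rightarrow> ?h x t))"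
      unfolding prod.case eq
    proof (rule Bochner_Integration.integrable_bound[OF integrable_mult_right[OF integrable_norm[OF D], of "sqrt pi"]])
      have "(sqrt pi * \<bar>spatial_sign i (x - z)\<bar>) * norm (inv_fourier v x) \<le> (sqrt pi * 1) * norm (inv_fourier v x)" for x
        by (intro mult_right_mono mult_left_mono spatial_sign_le) auto
      then show "AE x in lborel. norm ((sqrt pi * \<bar>spatial_sign i (x - z)\<bar>) * norm (inv_fourier v x)) \<le> norm (sqrt pi * norm (inv_fourier v x))"
        by (intro AE_I2) simp
    qed measurable
    show "AE x in lborel. integrable lborel (\<lambda>t. case (x, t) of (x, t) \<Rightarrow> ?h x t)"
      unfolding prod.case by (intro AE_I2 integrable_mult_left integrable_of_real sub)
  qed
  let ?m = "\<lambda>t \<xi>. pi * \<xi> $ i / t * ((pi / t) powr (CARD('n) / 2) * gauss (pi\<^sup>2 / t) (\<xi>::real^'n))"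
  let ?q = "\<lambda>\<xi> t. of_real (indicator {0<..} t * t powr (-1/2)) * (v \<xi> * wave \<xi> z * (\<i> * of_real (?m t \<xi>)))"
  let ?s = "\<lambda>\<xi> t. indicator {0<..} t * t powr (-1/2) * (pi * \<bar>\<xi> $ i\<bar> / t * ((pi / t) powr (CARD('n) / 2) * gauss (pi\<^sup>2 / t) (\<xi>::real^'n)))"
  let ?c = "\<lambda>\<xi>. pi * pi powr (d / 2) * (Gamma ((real d + 1) / 2) * (pi * norm (\<xi>::real^'n)) powr (- (real d + 1)))"
  have s: "integrable lborel (?s \<xi>)" "(LINT t|lborel. ?s \<xi> t) = \<bar>\<xi> $ i\<bar> * ?c \<xi>" if "\<xi> \<noteq> 0" for \<xi>
    using layer_symbol_integral[OF that, of i] unfolding d_def by (simp_all only: has_bochner_integral_iff)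
  have v0: "v 0 = 0" by (simp add: v_def deriv_symbol_def)
  have nq: "norm (?q \<xi> t) = norm (v \<xi>) * ?s \<xi> t" for \<xi> t
    by (simp add: norm_mult norm_divide abs_mult abs_of_pos gauss_pos indicator_def)
  have sq: "\<xi> $ i * \<xi> $ i = (spatial_sign i \<xi>)\<^sup>2 * (norm \<xi>)\<^sup>2" for \<xi> :: "real^'n"
    by (simp add: spatial_sign_def power_divide power2_eq_square)
  have amp: "2 * pi * (2 * pi * norm \<xi>) ^ (d - 1) * ?c \<xi> * (\<xi> $ i * \<xi> $ i) = sqrt pi * inv_gamma_const d * (spatial_sign i \<xi>)\<^sup>2"
    if "\<xi> \<noteq> 0" for \<xi> :: "real^'n"
  proof -
    have "2 * pi * (2 * pi * norm \<xi>) ^ (d - 1) * ?c \<xi> * (norm \<xi>)\<^sup>2 = sqrt pi * inv_gamma_const d"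
      using that d1 by (intro constant_identity) auto
    moreover have "2 * pi * (2 * pi * norm \<xi>) ^ (d - 1) * ?c \<xi> * (\<xi> $ i * \<xi> $ i) =
        2 * pi * (2 * pi * norm \<xi>) ^ (d - 1) * ?c \<xi> * (norm \<xi>)\<^sup>2 * (spatial_sign i \<xi>)\<^sup>2"
      unfolding sq by (simp only: mult_ac)
    ultimately show ?thesis by (simp only:)
  qed
  have IC: "integrable (lborel \<Otimes>\<^sub>M lborel) (\<lambda>(\<xi>, t). ?q \<xi> t)"
  proof (rule lborel_pair.Fubini_integrable)
    show "(\<lambda>(\<xi>, t). ?q \<xi> t) \<in> borel_measurable (lborel \<Otimes>\<^sub>M lborel)" by measurable
    have eq: "(LINT t|lborel. norm (?q \<xi> t)) = sqrt pi * inv_gamma_const d * (spatial_sign i \<xi>)\<^sup>2 * norm (u \<xi>)" for \<xi>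
    proof (cases "\<xi> = 0")
      case True
      then show ?thesis by (simp add: v0 spatial_sign_def)
    next
      case False
      have nv: "norm (v \<xi>) = 2 * pi * \<bar>\<xi> $ i\<bar> * (2 * pi * norm \<xi>) ^ (d - 1) * norm (u \<xi>)"
        by (simp add: v_def deriv_symbol_def d_def norm_mult norm_power abs_mult)
      have "(LINT t|lborel. norm (?q \<xi> t)) = norm (v \<xi>) * (\<bar>\<xi> $ i\<bar> * ?c \<xi>)"
        unfolding nq Bochner_Integration.integral_mult_right_zero s(2)[OF False] ..
      also have "\<dots> = (2 * pi * (2 * pi * norm \<xi>) ^ (d - 1) * ?c \<xi> * (\<bar>\<xi> $ i\<bar> * \<bar>\<xi> $ i\<bar>)) * norm (u \<xi>)"
        unfolding nv by (simp only: mult_ac)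
      also have "\<bar>\<xi> $ i\<bar> * \<bar>\<xi> $ i\<bar> = \<xi> $ i * \<xi> $ i" by (rule abs_mult_self_eq)
      finally show ?thesis unfolding amp[OF False] .
    qed
    show "integrable lborel (\<lambda>\<xi>. LINT t|lborel. norm (case (\<xi>, t) of (\<xi>, t) \<Rightarrow> ?q \<xi> t))"
      unfolding prod.case eq
    proof (rule Bochner_Integration.integrable_bound[OF integrable_mult_right[OF integrable_norm[OF rapid_integrable[OF u]], of "sqrt pi * inv_gamma_const d"]])
      have r2: "(spatial_sign i \<xi>)\<^sup>2 \<le> 1" for \<xi> :: "real^'n"
        using spatial_sign_le[of i \<xi>] by (simp add: abs_square_le_1)
      have "sqrt pi * inv_gamma_const d * (spatial_sign i \<xi>)\<^sup>2 * norm (u \<xi>) \<le> sqrt pi * inv_gamma_const d * 1 * norm (u \<xi>)" for \<xi>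
        using inv_gamma_const_pos[of d] by (intro mult_right_mono mult_left_mono r2) auto
      then show "AE \<xi> in lborel. norm (sqrt pi * inv_gamma_const d * (spatial_sign i \<xi>)\<^sup>2 * norm (u \<xi>)) \<le> norm (sqrt pi * inv_gamma_const d * norm (u \<xi>))"
        using inv_gamma_const_pos[of d] by (intro AE_I2) (simp add: abs_mult)
    qed measurable
    show "AE \<xi> in lborel. integrable lborel (\<lambda>t. case (\<xi>, t) of (\<xi>, t) \<Rightarrow> ?q \<xi> t)"
      unfolding prod.case
    proof (intro AE_I2)
      fix \<xi> :: "real^'n"
      show "integrable lborel (?q \<xi>)"
      proof (cases "\<xi> = 0")
        case False
        show ?thesis
        proof (rule Bochner_Integration.integrable_bound[OF integrable_mult_right[OF s(1)[OF False], of "norm (v \<xi>)"]])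
          show "AE t in lborel. norm (?q \<xi> t) \<le> norm (norm (v \<xi>) * ?s \<xi> t)"
            unfolding nq by (intro AE_I2) (simp only: real_norm_def abs_ge_self)
        qed measurable
      qed (simp add: v0)
    qed
  qed
  have "of_real (sqrt pi) * (LINT x|lborel. of_real (spatial_sign i (x - z)) * inv_fourier v x) = (LINT x|lborel. LINT t|lborel. ?h x t)"
    unfolding Bochner_Integration.integral_mult_left_zero integral_complex_of_real sub
      Bochner_Integration.integral_mult_right_zero[symmetric]
    by (simp add: mult.assoc)
  also have "\<dots> = (LINT t|lborel. LINT x|lborel. ?h x t)"
    by (rule lborel_pair.Fubini_integral[OF IA, symmetric])
  also have "\<dots> = (LINT t|lborel. LINT \<xi>|lborel. ?q \<xi> t)"
  proof (rule Bochner_Integration.integral_cong[OF refl])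
    fix t :: real
    show "(LINT x|lborel. ?h x t) = (LINT \<xi>|lborel. ?q \<xi> t)"
    proof (cases "t > 0")
      case True
      have "(LINT x|lborel. ?h x t) = (LINT x|lborel. of_real (indicator {0<..} t * t powr (-1/2)) * (of_real ((x - z) $ i * gauss t (x - z)) * inv_fourier v x))"
        by (intro Bochner_Integration.integral_cong refl) (simp only: of_real_mult mult.assoc)
      then show ?thesis
        unfolding Bochner_Integration.integral_mult_right_zero spatial_sign_pairing_layer[OF v True] .
    qed simp
  qed
  also have "\<dots> = (LINT \<xi>|lborel. LINT t|lborel. ?q \<xi> t)"
    by (rule lborel_pair.Fubini_integral[OF IC])
  also have "\<dots> = (LINT \<xi>|lborel. of_real (sqrt pi) * (- (of_real (inv_gamma_const d) * (of_real ((spatial_sign i \<xi>)\<^sup>2) * (u \<xi> * wave \<xi> z)))))"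
  proof (intro Bochner_Integration.integral_cong refl)
    fix \<xi> :: "real^'n"
    show "(LINT t|lborel. ?q \<xi> t) = of_real (sqrt pi) * (- (of_real (inv_gamma_const d) * (of_real ((spatial_sign i \<xi>)\<^sup>2) * (u \<xi> * wave \<xi> z))))"
    proof (cases "\<xi> = 0")
      case True
      then show ?thesis by (simp add: v0 spatial_sign_def)
    next
      case False
      \<comment> \<open>The signed integrand is reduced to the nonnegative one, whose integral over
        t is known.\<close>
      have sgn: "?m t \<xi> * (indicator {0<..} t * t powr (-1/2)) = sgn (\<xi> $ i) * ?s \<xi> t" for t
      proof -
        have "sgn (\<xi> $ i) * ?s \<xi> t = (sgn (\<xi> $ i) * \<bar>\<xi> $ i\<bar>) * (indicator {0<..} t * t powr (-1/2) *
            (pi / t * ((pi / t) powr (CARD('n) / 2) * gauss (pi\<^sup>2 / t) \<xi>)))"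
          by (simp only: divide_inverse mult_ac)
        also have "\<dots> = ?m t \<xi> * (indicator {0<..} t * t powr (-1/2))"
          unfolding sgn_mult_abs by (simp only: divide_inverse mult_ac)
        finally show ?thesis ..
      qed
      have q: "?q \<xi> t = (\<i> * (v \<xi> * wave \<xi> z) * of_real (sgn (\<xi> $ i))) * of_real (?s \<xi> t)" for t
      proof -
        have "?q \<xi> t = \<i> * (v \<xi> * wave \<xi> z) * of_real (?m t \<xi> * (indicator {0<..} t * t powr (-1/2)))"
          unfolding of_real_mult by (simp only: mult_ac)
        then show ?thesis unfolding sgn of_real_mult by (simp only: mult.assoc)
      qed
      have "(LINT t|lborel. ?q \<xi> t) = (\<i> * (v \<xi> * wave \<xi> z) * of_real (sgn (\<xi> $ i))) * of_real (\<bar>\<xi> $ i\<bar> * ?c \<xi>)"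
        unfolding q Bochner_Integration.integral_mult_right_zero integral_complex_of_real s(2)[OF False] ..
      also have "\<dots> = \<i> * (v \<xi> * wave \<xi> z) * of_real (sgn (\<xi> $ i) * \<bar>\<xi> $ i\<bar> * ?c \<xi>)"
        unfolding of_real_mult by (simp only: mult.assoc)
      also have "sgn (\<xi> $ i) * \<bar>\<xi> $ i\<bar> = \<xi> $ i" by (rule sgn_mult_abs)
      \<comment> \<open>One imaginary unit stems from the transform of x_i times a Gaussian, the
        other from the derivative symbol in v; their product is the minus sign of the
        statement.\<close>
      also have "\<i> * (v \<xi> * wave \<xi> z) * of_real (\<xi> $ i * ?c \<xi>) =
          (\<i> * \<i>) * (of_real (2 * pi * (2 * pi * norm \<xi>) ^ (d - 1) * ?c \<xi> * (\<xi> $ i * \<xi> $ i)) * (u \<xi> * wave \<xi> z))"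
        unfolding v_def deriv_symbol_def d_def of_real_mult by (simp only: mult_ac of_real_numeral)
      also have "\<dots> = - (of_real (sqrt pi * inv_gamma_const d * (spatial_sign i \<xi>)\<^sup>2) * (u \<xi> * wave \<xi> z))"
        unfolding amp[OF False] by simp
      finally show ?thesis unfolding of_real_mult by (simp only: mult.assoc mult_minus_right)
    qed
  qed
  also have "\<dots> = of_real (sqrt pi) * - (of_real (inv_gamma_const d) * (LINT \<xi>|lborel. of_real ((spatial_sign i \<xi>)\<^sup>2) * (u \<xi> * wave \<xi> z)))"
    unfolding Bochner_Integration.integral_mult_right_zero Bochner_Integration.integral_minus ..
  finally show ?thesis unfolding d_def mult_cancel_left by simp
qed

lemma sum_spatial_sign_sq: "\<xi> \<noteq> 0 \<Longrightarrow> (\<Sum>i\<in>UNIV. (spatial_sign i \<xi>)\<^sup>2) = 1"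
proof -
  assume "\<xi> \<noteq> 0"
  moreover have N: "(norm \<xi>)\<^sup>2 = (\<Sum>i\<in>UNIV. (\<xi> $ i)\<^sup>2)"
    unfolding power2_norm_eq_inner inner_vec_def by (simp add: power2_eq_square)
  ultimately show ?thesis
    by (simp add: spatial_sign_def power_divide sum_divide_distrib[symmetric] N[symmetric])
qed

text \<open>The squared components of \<xi> / |\<xi>| sum to 1 except at the origin, a null set.
  Summation over i therefore turns the multipliers into the identity.\<close>

lemma spatial_sign_pairing_sum:
  fixes u :: "real^'n::finite \<Rightarrow> complex"
  assumes u: "rapid u"
  defines "v \<equiv> \<lambda>i \<xi>. deriv_symbol i \<xi> * (of_real ((2 * pi * norm \<xi>) ^ (CARD('n) - 1)) * u \<xi>)"
  assumes D: "\<And>i. integrable lborel (inv_fourier (v i))"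
  shows "(\<Sum>i\<in>UNIV. LINT x|lborel. of_real (spatial_sign i (x - z)) * inv_fourier (v i) x) =
    - (of_real (inv_gamma_const CARD('n)) * inv_fourier u z)"
proof -
  note [measurable] = rapid_measurable[OF u]
  have int: "integrable lborel (\<lambda>\<xi>. of_real ((spatial_sign i \<xi>)\<^sup>2) * (u \<xi> * wave \<xi> z))" for i
  proof (rule Bochner_Integration.integrable_bound[OF rapid_integrable[OF u]])
    have "(spatial_sign i \<xi>)\<^sup>2 * norm (u \<xi>) \<le> 1 * norm (u \<xi>)" for \<xi>
      using spatial_sign_le[of i \<xi>] by (intro mult_right_mono) (simp_all add: abs_square_le_1)
    then show "AE \<xi> in lborel. norm (of_real ((spatial_sign i \<xi>)\<^sup>2) * (u \<xi> * wave \<xi> z)) \<le> norm (u \<xi>)"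
      by (intro AE_I2) (simp add: norm_mult norm_power)
  qed measurable
  have "(\<Sum>i\<in>UNIV. LINT x|lborel. of_real (spatial_sign i (x - z)) * inv_fourier (v i) x) =
      (\<Sum>i\<in>UNIV. - (of_real (inv_gamma_const CARD('n)) * (LINT \<xi>|lborel. of_real ((spatial_sign i \<xi>)\<^sup>2) * (u \<xi> * wave \<xi> z))))"
    unfolding v_def by (intro sum.cong refl spatial_sign_pairing[OF u D[unfolded v_def]])
  also have "\<dots> = - (of_real (inv_gamma_const CARD('n)) * (\<Sum>i\<in>UNIV. LINT \<xi>|lborel. of_real ((spatial_sign i \<xi>)\<^sup>2) * (u \<xi> * wave \<xi> z)))"
    by (simp only: sum_negf sum_distrib_left)
  also have "(\<Sum>i\<in>UNIV. LINT \<xi>|lborel. of_real ((spatial_sign i \<xi>)\<^sup>2) * (u \<xi> * wave \<xi> z)) =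
      (LINT \<xi>|lborel. (\<Sum>i\<in>UNIV. of_real ((spatial_sign i \<xi>)\<^sup>2) * (u \<xi> * wave \<xi> z)))"
    by (rule Bochner_Integration.integral_sum[symmetric]) (rule int)
  also have "\<dots> = inv_fourier u z" unfolding inv_fourier_eq
  proof (rule integral_cong_AE)
    have "AE \<xi> in lborel. \<xi> \<noteq> (0::real^'n)" by (rule AE_lborel_singleton)
    then show "AE \<xi> in lborel. (\<Sum>i\<in>UNIV. of_real ((spatial_sign i \<xi>)\<^sup>2) * (u \<xi> * wave \<xi> z)) = u \<xi> * wave \<xi> z"
    proof eventually_elim
      case (elim \<xi>)
      have "(\<Sum>i\<in>UNIV. of_real ((spatial_sign i \<xi>)\<^sup>2) * (u \<xi> * wave \<xi> z)) = of_real (\<Sum>i\<in>UNIV. (spatial_sign i \<xi>)\<^sup>2) * (u \<xi> * wave \<xi> z)"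
        by (simp only: sum_distrib_right of_real_sum)
      then show ?case by (simp add: sum_spatial_sign_sq[OF elim])
    qed
  qed measurable
  finally show ?thesis .
qed

section \<open>Inverse Fourier transforms that lie in the test space\<close>

text \<open>Membership of the inverse Fourier transform in \<^term>\<open>S_half\<close>, expressed on the Fourier side.\<close>

definition S_half_symbol :: "(real^'n::finite \<Rightarrow> complex) \<Rightarrow> bool" where
  "S_half_symbol w \<longleftrightarrow> rapid w \<and> (\<forall>\<alpha>. \<exists>C. \<forall>x.
     (1 + norm x ^ (CARD('n) + 1)) * norm (inv_fourier (\<lambda>\<xi>. deriv_symbols \<alpha> \<xi> * w \<xi>) x) \<le> C)"

lemma S_half_symbol_rapid: "S_half_symbol w \<Longrightarrow> rapid w" by (simp add: S_half_symbol_def)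

lemma S_half_symbol_S_half:
  fixes w :: "real^'n::finite \<Rightarrow> complex"
  assumes "S_half_symbol w" shows "inv_fourier w \<in> S_half"
proof -
  have "bounded (range (\<lambda>x. (1 + norm x ^ (CARD('n) + 1)) *\<^sub>R iter_partial \<alpha> (inv_fourier w) x))" for \<alpha>
  proof -
    obtain C where C: "\<And>x. (1 + norm x ^ (CARD('n) + 1)) * norm (inv_fourier (\<lambda>\<xi>. deriv_symbols \<alpha> \<xi> * w \<xi>) x) \<le> C"
      using assms unfolding S_half_symbol_def by blast
    have "norm ((1 + norm x ^ (CARD('n) + 1)) *\<^sub>R iter_partial \<alpha> (inv_fourier w) x) \<le> C" for x
      using C[of x] unfolding iter_partial_inv_fourier[OF S_half_symbol_rapid[OF assms]] norm_scaleR
      by (simp only: abs_of_nonneg add_nonneg_nonneg zero_le_one zero_le_power norm_ge_zero)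
    then show ?thesis by (intro boundedI) auto
  qed
  then show ?thesis using smooth_inv_fourier[OF S_half_symbol_rapid[OF assms]] by (simp add: S_half_def)
qed

lemma S_half_symbol_integrable:
  fixes w :: "real^'n::finite \<Rightarrow> complex"
  assumes "S_half_symbol w" shows "integrable lborel (inv_fourier w)"
proof -
  obtain C where C: "\<And>x. (1 + norm x ^ (CARD('n) + 1)) * norm (inv_fourier (\<lambda>\<xi>. deriv_symbols [] \<xi> * w \<xi>) x) \<le> C"
    using assms unfolding S_half_symbol_def by blast
  have "Ck_on 0 UNIV (inv_fourier w)" using smooth_inv_fourier[OF S_half_symbol_rapid[OF assms]] by (simp add: smooth_def)
  then have meas: "inv_fourier w \<in> borel_measurable borel"
    by (auto simp: Ck_on_0 intro: borel_measurable_continuous_onI)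
  \<comment> \<open>\<open>S_half\<close> uses the weight 1 + r^m, the integrability criterion the
    weight (1 + r)^m.\<close>
  have le: "(1 + r) ^ m \<le> 2 ^ m * (1 + r ^ m)" if "r \<ge> 0" for r :: real and m
  proof (cases "r \<le> 1")
    case True
    then have "(1 + r) ^ m \<le> 2 ^ m" using that by (intro power_mono) auto
    also have "\<dots> \<le> 2 ^ m * (1 + r ^ m)" using that by simp
    finally show ?thesis .
  next
    case False
    then have "(1 + r) ^ m \<le> (2 * r) ^ m" by (intro power_mono) auto
    also have "\<dots> \<le> 2 ^ m * (1 + r ^ m)" by (simp add: power_mult_distrib)
    finally show ?thesis .
  qed
  show ?thesis
  proof (rule integrable_of_decay[OF meas, of "2 ^ (CARD('n) + 1) * C"])
    fix x :: "real^'n"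
    have "(1 + norm x) ^ (CARD('n) + 1) * norm (inv_fourier w x) \<le>
        (2 ^ (CARD('n) + 1) * (1 + norm x ^ (CARD('n) + 1))) * norm (inv_fourier w x)"
      by (intro mult_right_mono le) auto
    also have "\<dots> = 2 ^ (CARD('n) + 1) * ((1 + norm x ^ (CARD('n) + 1)) * norm (inv_fourier w x))"
      by (simp only: mult.assoc)
    also have "\<dots> \<le> 2 ^ (CARD('n) + 1) * C" using C[of x] by (intro mult_left_mono) simp_all
    finally show "(1 + norm x) ^ (CARD('n) + 1) * norm (inv_fourier w x) \<le> 2 ^ (CARD('n) + 1) * C" .
  qed
qed

lemma S_half_symbol_deriv_symbol:
  assumes "S_half_symbol w" shows "S_half_symbol (\<lambda>\<xi>. deriv_symbol i \<xi> * w \<xi>)"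
proof -
  have "rapid (\<lambda>\<xi>. deriv_symbol i \<xi> * w \<xi>)" using rapid_deriv_symbols[OF S_half_symbol_rapid[OF assms], of "[i]"] by simp
  moreover have "(\<lambda>\<xi>. deriv_symbols \<alpha> \<xi> * (deriv_symbol i \<xi> * w \<xi>)) = (\<lambda>\<xi>. deriv_symbols (i # \<alpha>) \<xi> * w \<xi>)" for \<alpha>
    by (simp add: fun_eq_iff)
  ultimately show ?thesis using assms unfolding S_half_symbol_def by (simp del: deriv_symbols_simps)
qed

lemma partial_deriv_inv_fourier:
  "rapid w \<Longrightarrow> partial_deriv i (inv_fourier w) = inv_fourier (\<lambda>\<xi>. deriv_symbol i \<xi> * w \<xi>)"
  using iter_partial_inv_fourier[of w "[i]"] by simp

lemma inv_fourier_sum: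
  assumes "\<And>i. i \<in> I \<Longrightarrow> rapid (w i)"
  shows "inv_fourier (\<lambda>\<xi>. \<Sum>i\<in>I. w i \<xi>) x = (\<Sum>i\<in>I. inv_fourier (w i) x)"
  unfolding inv_fourier_eq sum_distrib_right
  by (rule Bochner_Integration.integral_sum) (intro inv_fourier_integrable assms)

lemma inv_fourier_cmult: "inv_fourier (\<lambda>\<xi>. c * w \<xi>) x = c * inv_fourier w x"
  unfolding inv_fourier_eq mult.assoc Bochner_Integration.integral_mult_right_zero ..

lemma rapid_cmult: "rapid w \<Longrightarrow> rapid (\<lambda>\<xi>. c * w \<xi>)"
  by (rule rapid_mult[where c="norm c" and p=0]) auto

lemma rapid_add:
  assumes "rapid v" "rapid w" shows "rapid (\<lambda>\<xi>. v \<xi> + w \<xi>)"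
  unfolding rapid_def
proof (intro conjI allI)
  note [measurable] = rapid_measurable[OF assms(1)] rapid_measurable[OF assms(2)]
  show "(\<lambda>\<xi>. v \<xi> + w \<xi>) \<in> borel_measurable borel" by measurable
  fix m
  obtain C D where C: "\<And>\<xi>. (1 + norm \<xi>) ^ m * norm (v \<xi>) \<le> C" and D: "\<And>\<xi>. (1 + norm \<xi>) ^ m * norm (w \<xi>) \<le> D"
    using assms unfolding rapid_def by meson
  have "(1 + norm \<xi>) ^ m * norm (v \<xi> + w \<xi>) \<le> C + D" for \<xi>
  proof -
    have "(1 + norm \<xi>) ^ m * norm (v \<xi> + w \<xi>) \<le> (1 + norm \<xi>) ^ m * (norm (v \<xi>) + norm (w \<xi>))"
      by (intro mult_left_mono norm_triangle_ineq) auto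
    also have "\<dots> \<le> C + D" using C[of \<xi>] D[of \<xi>] unfolding distrib_left by linarith
    finally show ?thesis .
  qed
  then show "\<exists>C. \<forall>\<xi>. (1 + norm \<xi>) ^ m * norm (v \<xi> + w \<xi>) \<le> C" by blast
qed

lemma S_half_symbol_add:
  fixes v w :: "real^'n::finite \<Rightarrow> complex"
  assumes "S_half_symbol v" "S_half_symbol w" shows "S_half_symbol (\<lambda>\<xi>. v \<xi> + w \<xi>)"
proof -
  have "\<exists>C. \<forall>x. (1 + norm x ^ (CARD('n) + 1)) * norm (inv_fourier (\<lambda>\<xi>. deriv_symbols \<alpha> \<xi> * (v \<xi> + w \<xi>)) x) \<le> C" for \<alpha>
  proof -
    obtain C D where C: "\<And>x. (1 + norm x ^ (CARD('n) + 1)) * norm (inv_fourier (\<lambda>\<xi>. deriv_symbols \<alpha> \<xi> * v \<xi>) x) \<le> C"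
      and D: "\<And>x. (1 + norm x ^ (CARD('n) + 1)) * norm (inv_fourier (\<lambda>\<xi>. deriv_symbols \<alpha> \<xi> * w \<xi>) x) \<le> D"
      using assms unfolding S_half_symbol_def by meson
    have "(1 + norm x ^ (CARD('n) + 1)) * norm (inv_fourier (\<lambda>\<xi>. deriv_symbols \<alpha> \<xi> * (v \<xi> + w \<xi>)) x) \<le> C + D" for x
    proof -
      have "inv_fourier (\<lambda>\<xi>. deriv_symbols \<alpha> \<xi> * (v \<xi> + w \<xi>)) x =
          inv_fourier (\<lambda>\<xi>. deriv_symbols \<alpha> \<xi> * v \<xi>) x + inv_fourier (\<lambda>\<xi>. deriv_symbols \<alpha> \<xi> * w \<xi>) x"
        unfolding inv_fourier_eq distrib_left distrib_right
        by (intro Bochner_Integration.integral_add inv_fourier_integrable rapid_deriv_symbols S_half_symbol_rapid assms)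
      then have "(1 + norm x ^ (CARD('n) + 1)) * norm (inv_fourier (\<lambda>\<xi>. deriv_symbols \<alpha> \<xi> * (v \<xi> + w \<xi>)) x) \<le>
          (1 + norm x ^ (CARD('n) + 1)) * (norm (inv_fourier (\<lambda>\<xi>. deriv_symbols \<alpha> \<xi> * v \<xi>) x) + norm (inv_fourier (\<lambda>\<xi>. deriv_symbols \<alpha> \<xi> * w \<xi>) x))"
        by (simp only:) (intro mult_left_mono norm_triangle_ineq add_nonneg_nonneg zero_le_one zero_le_power norm_ge_zero)
      also have "\<dots> \<le> C + D" using C[of x] D[of x] unfolding distrib_left by linarith
      finally show ?thesis .
    qed
    then show ?thesis by blast
  qed
  moreover have "rapid (\<lambda>\<xi>. v \<xi> + w \<xi>)" by (intro rapid_add S_half_symbol_rapid assms)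
  ultimately show ?thesis unfolding S_half_symbol_def by blast
qed

lemma S_half_symbol_cmult:
  fixes w :: "real^'n::finite \<Rightarrow> complex"
  assumes "S_half_symbol w" shows "S_half_symbol (\<lambda>\<xi>. c * w \<xi>)"
proof -
  have "\<exists>C. \<forall>x. (1 + norm x ^ (CARD('n) + 1)) * norm (inv_fourier (\<lambda>\<xi>. deriv_symbols \<alpha> \<xi> * (c * w \<xi>)) x) \<le> C" for \<alpha>
  proof -
    obtain C where C: "\<And>x. (1 + norm x ^ (CARD('n) + 1)) * norm (inv_fourier (\<lambda>\<xi>. deriv_symbols \<alpha> \<xi> * w \<xi>) x) \<le> C"
      using assms unfolding S_half_symbol_def by blast
    have "(1 + norm x ^ (CARD('n) + 1)) * norm (inv_fourier (\<lambda>\<xi>. deriv_symbols \<alpha> \<xi> * (c * w \<xi>)) x) \<le> norm c * C" for x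
    proof -
      have "inv_fourier (\<lambda>\<xi>. deriv_symbols \<alpha> \<xi> * (c * w \<xi>)) x = c * inv_fourier (\<lambda>\<xi>. deriv_symbols \<alpha> \<xi> * w \<xi>) x"
        unfolding mult.left_commute[of _ c] by (rule inv_fourier_cmult)
      then have "(1 + norm x ^ (CARD('n) + 1)) * norm (inv_fourier (\<lambda>\<xi>. deriv_symbols \<alpha> \<xi> * (c * w \<xi>)) x) =
          norm c * ((1 + norm x ^ (CARD('n) + 1)) * norm (inv_fourier (\<lambda>\<xi>. deriv_symbols \<alpha> \<xi> * w \<xi>) x))"
        by (simp only: norm_mult mult.left_commute)
      also have "\<dots> \<le> norm c * C" by (intro mult_left_mono C) simp
      finally show ?thesis .
    qed
    then show ?thesis by blast
  qed
  then show ?thesis using rapid_cmult[OF S_half_symbol_rapid[OF assms]] unfolding S_half_symbol_def by blast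
qed

lemma S_half_symbol_zero: "S_half_symbol (\<lambda>\<xi>. 0)"
  by (auto simp: S_half_symbol_def rapid_def inv_fourier_eq)

lemma S_half_symbol_sum: "(\<And>i. i \<in> I \<Longrightarrow> S_half_symbol (w i)) \<Longrightarrow> S_half_symbol (\<lambda>\<xi>. \<Sum>i\<in>I. w i \<xi>)"
  by (induction I rule: infinite_finite_induct) (simp_all add: S_half_symbol_zero S_half_symbol_add)

definition laplace_symbol :: "real^'n::finite \<Rightarrow> complex" where
  "laplace_symbol \<xi> = of_real ((2 * pi * norm \<xi>)\<^sup>2)"

lemma sum_deriv_symbol_sq: "(\<Sum>i\<in>UNIV. deriv_symbol i \<xi> * deriv_symbol i \<xi>) = - laplace_symbol \<xi>"
proof -
  have N: "(norm \<xi>)\<^sup>2 = (\<Sum>i\<in>UNIV. \<xi> $ i * \<xi> $ i)"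
    unfolding power2_norm_eq_inner inner_vec_def by simp
  have "deriv_symbol i \<xi> * deriv_symbol i \<xi> = - of_real ((2 * pi)\<^sup>2) * of_real (\<xi> $ i * \<xi> $ i)" for i
    by (simp add: deriv_symbol_def power2_eq_square algebra_simps)
  then have "(\<Sum>i\<in>UNIV. deriv_symbol i \<xi> * deriv_symbol i \<xi>) = - of_real ((2 * pi)\<^sup>2) * of_real ((norm \<xi>)\<^sup>2)"
    unfolding N by (simp only: sum_distrib_left[symmetric] of_real_sum)
  then show ?thesis by (simp add: laplace_symbol_def power_mult_distrib)
qed

text \<open>(2 pi |\<xi>|)^2 is minus the sum of the squared derivative symbols, so closure under
  derivatives, sums and multiples suffices.\<close>

lemma S_half_symbol_laplace_symbol:
  assumes "S_half_symbol w" shows "S_half_symbol (\<lambda>\<xi>. laplace_symbol \<xi> * w \<xi>)"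
proof -
  have "laplace_symbol \<xi> * w \<xi> = (\<Sum>i\<in>UNIV. (-1) * (deriv_symbol i \<xi> * (deriv_symbol i \<xi> * w \<xi>)))" for \<xi>
  proof -
    have "(\<Sum>i\<in>UNIV. (-1) * (deriv_symbol i \<xi> * (deriv_symbol i \<xi> * w \<xi>))) = - ((\<Sum>i\<in>UNIV. deriv_symbol i \<xi> * deriv_symbol i \<xi>) * w \<xi>)"
      by (simp add: sum_distrib_right sum_negf mult.assoc)
    then show ?thesis by (simp add: sum_deriv_symbol_sq)
  qed
  then show ?thesis using assms by (simp only:) (intro S_half_symbol_sum S_half_symbol_cmult S_half_symbol_deriv_symbol)
qed

lemma S_half_symbol_laplace_symbol_power: "S_half_symbol w \<Longrightarrow> S_half_symbol (\<lambda>\<xi>. laplace_symbol \<xi> ^ m * w \<xi>)"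
  by (induction m) (simp_all add: mult.assoc S_half_symbol_laplace_symbol)

section \<open>Evaluation of the distributional operator\<close>

lemma distr_deriv_twice:
  assumes "S_half_symbol w"
  shows "distr_deriv i (distr_deriv i T) (inv_fourier w) = T (inv_fourier (\<lambda>\<xi>. deriv_symbol i \<xi> * (deriv_symbol i \<xi> * w \<xi>)))"
  by (simp add: distr_deriv_def S_half_symbol_S_half S_half_symbol_deriv_symbol assms partial_deriv_inv_fourier S_half_symbol_rapid)

text \<open>On functions \<open>inv_fourier w\<close> every operation becomes a multiplication of w,
  and \<open>S_half_symbol\<close> guarantees that the restricted functionals are evaluated inside
  \<open>S_half\<close>. The outermost Laplacian acts first on the test function, hence the
  induction with arbitrary w. The one surviving minus sign is that of the divergence.\<close>

lemma distr_eval: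
  fixes V :: "real^'n::finite \<Rightarrow> real^'n"
  assumes meas: "\<And>j. (\<lambda>x. V x $ j) \<in> borel_measurable borel" and bd: "\<And>j x. \<bar>V x $ j\<bar> \<le> B"
    and w: "S_half_symbol w"
  shows "(distr_neg_laplacian ^^ m) (distr_divergence V) (inv_fourier w) =
    - (\<Sum>j\<in>UNIV. LINT x|lborel. of_real (V x $ j) * inv_fourier (\<lambda>\<xi>. deriv_symbol j \<xi> * (laplace_symbol \<xi> ^ m * w \<xi>)) x)"
  using w
proof (induction m arbitrary: w)
  case 0
  have "distr_divergence V (inv_fourier w) = (\<Sum>j\<in>UNIV. - (LINT x|lborel. of_real (V x $ j) * inv_fourier (\<lambda>\<xi>. deriv_symbol j \<xi> * w \<xi>) x))"
    using 0 by (simp add: distr_divergence_def distr_deriv_def distr_of_fun_def S_half_symbol_S_half S_half_symbol_deriv_symbol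
        partial_deriv_inv_fourier S_half_symbol_rapid)
  then show ?case by (simp add: sum_negf)
next
  case (Suc m)
  note w = Suc.prems
  let ?T = "(distr_neg_laplacian ^^ m) (distr_divergence V)"
  let ?g = "\<lambda>i j. inv_fourier (\<lambda>\<xi>. deriv_symbol j \<xi> * (laplace_symbol \<xi> ^ m * (deriv_symbol i \<xi> * (deriv_symbol i \<xi> * w \<xi>))))"
  have int: "integrable lborel (\<lambda>x. of_real (V x $ j) * ?g i j x)" for i j
  proof (rule Bochner_Integration.integrable_bound)
    have g: "integrable lborel (?g i j)" by (intro S_half_symbol_integrable S_half_symbol_deriv_symbol S_half_symbol_laplace_symbol_power w)
    show "integrable lborel (\<lambda>x. B * norm (?g i j x))" by (intro integrable_mult_right integrable_norm g)
    note [measurable] = meas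
    have [measurable]: "?g i j \<in> borel_measurable borel" using g by simp
    show "(\<lambda>x. of_real (V x $ j) * ?g i j x) \<in> borel_measurable lborel" by measurable
    show "AE x in lborel. norm (of_real (V x $ j) * ?g i j x) \<le> norm (B * norm (?g i j x))"
    proof (intro AE_I2)
      fix x
      have "\<bar>V x $ j\<bar> * norm (?g i j x) \<le> B * norm (?g i j x)" by (intro mult_right_mono bd) simp
      then show "norm (of_real (V x $ j) * ?g i j x) \<le> norm (B * norm (?g i j x))"
        unfolding norm_mult norm_of_real real_norm_def by (rule order_trans) simp
    qed
  qed
  have "(distr_neg_laplacian ^^ Suc m) (distr_divergence V) (inv_fourier w) =
      - (\<Sum>i\<in>UNIV. ?T (inv_fourier (\<lambda>\<xi>. deriv_symbol i \<xi> * (deriv_symbol i \<xi> * w \<xi>))))"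
    by (simp add: distr_neg_laplacian_def[of ?T] S_half_symbol_S_half[OF w] distr_deriv_twice[OF w])
  also have "\<dots> = (\<Sum>i\<in>UNIV. \<Sum>j\<in>UNIV. LINT x|lborel. of_real (V x $ j) * ?g i j x)"
  proof -
    have "?T (inv_fourier (\<lambda>\<xi>. deriv_symbol i \<xi> * (deriv_symbol i \<xi> * w \<xi>))) =
        - (\<Sum>j\<in>UNIV. LINT x|lborel. of_real (V x $ j) * ?g i j x)" for i
      by (rule Suc.IH) (intro S_half_symbol_deriv_symbol w)
    then show ?thesis by (simp only: sum_negf minus_minus)
  qed
  also have "\<dots> = (\<Sum>j\<in>UNIV. \<Sum>i\<in>UNIV. LINT x|lborel. of_real (V x $ j) * ?g i j x)"
    by (rule sum.swap)
  also have "\<dots> = (\<Sum>j\<in>UNIV. - (LINT x|lborel. of_real (V x $ j) * inv_fourier (\<lambda>\<xi>. deriv_symbol j \<xi> * (laplace_symbol \<xi> ^ Suc m * w \<xi>)) x))"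
  proof (rule sum.cong[OF refl])
    fix j :: 'n
    have g: "(\<Sum>i\<in>UNIV. ?g i j x) = - inv_fourier (\<lambda>\<xi>. deriv_symbol j \<xi> * (laplace_symbol \<xi> ^ Suc m * w \<xi>)) x" for x
    proof -
      have "(\<Sum>i\<in>UNIV. ?g i j x) = inv_fourier (\<lambda>\<xi>. \<Sum>i\<in>UNIV. deriv_symbol j \<xi> * (laplace_symbol \<xi> ^ m * (deriv_symbol i \<xi> * (deriv_symbol i \<xi> * w \<xi>)))) x"
        by (rule inv_fourier_sum[symmetric]) (intro S_half_symbol_rapid S_half_symbol_deriv_symbol S_half_symbol_laplace_symbol_power w)
      also have "(\<lambda>\<xi>. \<Sum>i\<in>UNIV. deriv_symbol j \<xi> * (laplace_symbol \<xi> ^ m * (deriv_symbol i \<xi> * (deriv_symbol i \<xi> * w \<xi>)))) =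
          (\<lambda>\<xi>. (-1) * (deriv_symbol j \<xi> * (laplace_symbol \<xi> ^ Suc m * w \<xi>)))"
      proof
        fix \<xi>
        have "(\<Sum>i\<in>UNIV. deriv_symbol j \<xi> * (laplace_symbol \<xi> ^ m * (deriv_symbol i \<xi> * (deriv_symbol i \<xi> * w \<xi>)))) =
            deriv_symbol j \<xi> * (laplace_symbol \<xi> ^ m * ((\<Sum>i\<in>UNIV. deriv_symbol i \<xi> * deriv_symbol i \<xi>) * w \<xi>))"
          by (simp only: sum_distrib_left sum_distrib_right mult.assoc)
        then show "(\<Sum>i\<in>UNIV. deriv_symbol j \<xi> * (laplace_symbol \<xi> ^ m * (deriv_symbol i \<xi> * (deriv_symbol i \<xi> * w \<xi>)))) =
            (-1) * (deriv_symbol j \<xi> * (laplace_symbol \<xi> ^ Suc m * w \<xi>))" by (simp add: sum_deriv_symbol_sq)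
      qed
      finally show ?thesis unfolding inv_fourier_cmult by simp
    qed
    have "(\<Sum>i\<in>UNIV. LINT x|lborel. of_real (V x $ j) * ?g i j x) = (LINT x|lborel. (\<Sum>i\<in>UNIV. of_real (V x $ j) * ?g i j x))"
      by (rule Bochner_Integration.integral_sum[symmetric]) (rule int)
    also have "\<dots> = (LINT x|lborel. - (of_real (V x $ j) * inv_fourier (\<lambda>\<xi>. deriv_symbol j \<xi> * (laplace_symbol \<xi> ^ Suc m * w \<xi>)) x))"
      unfolding sum_distrib_left[symmetric] g by simp
    finally show "(\<Sum>i\<in>UNIV. LINT x|lborel. of_real (V x $ j) * ?g i j x) =
        - (LINT x|lborel. of_real (V x $ j) * inv_fourier (\<lambda>\<xi>. deriv_symbol j \<xi> * (laplace_symbol \<xi> ^ Suc m * w \<xi>)) x)"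
      by (simp only: Bochner_Integration.integral_minus)
  qed
  finally show ?case by (simp only: sum_negf)
qed

section \<open>Test functions and their half Laplacians in the test space\<close>

lemma test_fun_weighted_bound:
  assumes "test_fun \<psi>" "\<And>r. 0 \<le> r \<Longrightarrow> 0 \<le> p r" "\<And>r s. 0 \<le> r \<Longrightarrow> r \<le> s \<Longrightarrow> p r \<le> p s"
  shows "\<exists>C. \<forall>x. p (norm x) * norm (\<psi> x) \<le> C"
proof -
  obtain R where R: "R \<ge> 0" "\<And>x. x \<notin> cball 0 R \<Longrightarrow> \<psi> x = 0" using test_fun_support[OF assms(1)] by blast
  obtain M where M: "M \<ge> 0" "\<And>x. norm (\<psi> x) \<le> M" using test_fun_bounded[OF assms(1)] by blast
  have "p (norm x) * norm (\<psi> x) \<le> p R * M" for x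
  proof (cases "norm x \<le> R")
    case True
    then show ?thesis using M assms(2,3) R(1) by (intro mult_mono) auto
  next
    case False
    then show ?thesis using R M assms(2) by simp
  qed
  then show ?thesis by blast
qed

lemma test_fun_schwartz:
  assumes "test_fun \<psi>" shows "\<psi> \<in> schwartz"
proof -
  have "bounded (range (\<lambda>x. (1 + norm x) ^ N *\<^sub>R iter_partial \<alpha> \<psi> x))" for N \<alpha>
  proof -
    obtain C where "\<And>x. (1 + norm x) ^ N * norm (iter_partial \<alpha> \<psi> x) \<le> C"
      using test_fun_weighted_bound[OF test_fun_iter_partial[OF assms], of "\<lambda>r. (1 + r) ^ N" \<alpha>]
      by (auto simp: power_mono)
    then show ?thesis by (intro boundedI[of _ C]) (auto simp: abs_of_nonneg)
  qed
  then show ?thesis using assms by (simp add: schwartz_def test_fun_def)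
qed

lemma S_half_symbol_fourier:
  fixes \<psi> :: "real^'n::finite \<Rightarrow> complex"
  assumes \<psi>: "test_fun \<psi>" shows "S_half_symbol (fourier \<psi>)"
proof -
  have "(\<lambda>\<xi>. deriv_symbols \<alpha> \<xi> * fourier \<psi> \<xi>) = fourier (iter_partial \<alpha> \<psi>)" for \<alpha>
    by (simp add: fourier_iter_partial[OF \<psi>] fun_eq_iff)
  moreover have "\<exists>C. \<forall>x. (1 + norm x ^ (CARD('n) + 1)) * norm (iter_partial \<alpha> \<psi> x) \<le> C" for \<alpha>
    by (rule test_fun_weighted_bound[OF test_fun_iter_partial[OF \<psi>], of "\<lambda>r. 1 + r ^ (CARD('n) + 1)"])
      (simp_all only: power_mono add_left_mono add_nonneg_nonneg zero_le_one zero_le_power)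
  ultimately show ?thesis
    using \<psi> by (simp only: S_half_symbol_def rapid_fourier fourier_inversion test_fun_iter_partial) simp
qed

text \<open>Derivatives commute with the multiplier |\<xi>|, so the decay lemma applied to the test
  functions \<open>iter_partial \<alpha> \<psi>\<close> covers all orders.\<close>

lemma S_half_symbol_half_laplacian:
  fixes \<psi> :: "real^'n::finite \<Rightarrow> complex"
  assumes \<psi>: "test_fun \<psi>" shows "S_half_symbol (\<lambda>\<xi>. of_real (norm \<xi>) * fourier \<psi> \<xi>)"
proof -
  have "(\<lambda>\<xi>. deriv_symbols \<alpha> \<xi> * (of_real (norm \<xi>) * fourier \<psi> \<xi>)) = (\<lambda>\<xi>. of_real (norm \<xi>) * fourier (iter_partial \<alpha> \<psi>) \<xi>)" for \<alpha>
    by (simp add: fourier_iter_partial[OF \<psi>] fun_eq_iff)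
  then show ?thesis unfolding S_half_symbol_def
    using half_laplacian_decay[OF test_fun_iter_partial[OF \<psi>]] rapid_norm[OF rapid_fourier[OF \<psi>]] by simp
qed

lemma frac_laplacian_half:
  "frac_laplacian (1/2) \<psi> = inv_fourier (\<lambda>\<xi>. of_real (2 * pi) * (of_real (norm \<xi>) * fourier \<psi> \<xi>))"
  by (simp add: frac_laplacian_def inv_fourier_cmult fun_eq_iff)

text \<open>Both parities lead to the multiplier (2 pi |\<xi>|)^(d-1): for odd d it is a power of
  the symbol of the Laplacian, for even d one factor 2 pi |\<xi>| comes from the half
  Laplacian.\<close>

lemma L_op_eval:
  fixes V :: "real^'n::finite \<Rightarrow> real^'n"
  assumes meas: "\<And>j. (\<lambda>x. V x $ j) \<in> borel_measurable borel" and bd: "\<And>j x. \<bar>V x $ j\<bar> \<le> B"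
    and \<psi>: "test_fun \<psi>"
  defines "v \<equiv> \<lambda>j \<xi>. deriv_symbol j \<xi> * (of_real ((2 * pi * norm \<xi>) ^ (CARD('n) - 1)) * fourier \<psi> \<xi>)"
  shows "L_op V \<psi> = of_real (gamma_const CARD('n)) * - (\<Sum>j\<in>UNIV. LINT x|lborel. of_real (V x $ j) * inv_fourier (v j) x)"
    and "S_half_symbol (v j)"
proof -
  define d where "d = CARD('n)"
  have "d \<ge> 1" by (simp add: d_def Suc_le_eq)
  have lamp: "laplace_symbol \<xi> ^ m = of_real ((2 * pi * norm \<xi>) ^ (2 * m))" for m and \<xi> :: "real^'n"
    by (simp only: laplace_symbol_def of_real_power[symmetric] power_mult)
  have "L_op V \<psi> = of_real (gamma_const CARD('n)) * - (\<Sum>j\<in>UNIV. LINT x|lborel. of_real (V x $ j) * inv_fourier (v j) x) \<and> (\<forall>j. S_half_symbol (v j))"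
  proof (cases "odd d")
    case True
    then have d: "2 * ((d - 1) div 2) = d - 1" by simp
    have v: "(\<lambda>\<xi>. deriv_symbol j \<xi> * (laplace_symbol \<xi> ^ ((d - 1) div 2) * fourier \<psi> \<xi>)) = v j" for j
      unfolding v_def lamp d d_def[symmetric] ..
    have "(distr_neg_laplacian ^^ ((d - 1) div 2)) (distr_divergence V) \<psi> =
        - (\<Sum>j\<in>UNIV. LINT x|lborel. of_real (V x $ j) * inv_fourier (v j) x)"
      using distr_eval[OF meas bd S_half_symbol_fourier[OF \<psi>], of "(d - 1) div 2"]
      unfolding fourier_inversion[OF \<psi>] v .
    moreover have "S_half_symbol (v j)" for j
      unfolding v[symmetric] by (intro S_half_symbol_deriv_symbol S_half_symbol_laplace_symbol_power S_half_symbol_fourier \<psi>)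
    ultimately show ?thesis using True test_fun_schwartz[OF \<psi>] by (simp add: L_op_def d_def)
  next
    case False
    \<comment> \<open>For even d, necessarily at least 2, the successor accounts for the factor of
      the half Laplacian.\<close>
    have d: "Suc (2 * ((d - 2) div 2)) = d - 1"
    proof -
      have "d \<ge> 2" using False \<open>d \<ge> 1\<close> by (cases "d = 1") auto
      then show ?thesis using False by presburger
    qed
    let ?w = "\<lambda>\<xi>. of_real (2 * pi) * (of_real (norm \<xi>) * fourier \<psi> \<xi>)"
    have w: "S_half_symbol ?w" by (intro S_half_symbol_cmult S_half_symbol_half_laplacian \<psi>)
    have v: "(\<lambda>\<xi>. deriv_symbol j \<xi> * (laplace_symbol \<xi> ^ ((d - 2) div 2) * ?w \<xi>)) = v j" for j
    proof
      fix \<xi> :: "real^'n"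
      have "laplace_symbol \<xi> ^ ((d - 2) div 2) * ?w \<xi> = of_real ((2 * pi * norm \<xi>) ^ Suc (2 * ((d - 2) div 2))) * fourier \<psi> \<xi>"
        unfolding lamp power_Suc of_real_mult by (simp only: mult_ac)
      then show "deriv_symbol j \<xi> * (laplace_symbol \<xi> ^ ((d - 2) div 2) * ?w \<xi>) = v j \<xi>" unfolding v_def d d_def[symmetric] by (simp only:)
    qed
    have "(distr_neg_laplacian ^^ ((d - 2) div 2)) (distr_divergence V) (frac_laplacian (1/2) \<psi>) =
        - (\<Sum>j\<in>UNIV. LINT x|lborel. of_real (V x $ j) * inv_fourier (v j) x)"
      using distr_eval[OF meas bd w, of "(d - 2) div 2"] unfolding v frac_laplacian_half .
    moreover have "S_half_symbol (v j)" for j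
      unfolding v[symmetric] by (intro S_half_symbol_deriv_symbol S_half_symbol_laplace_symbol_power w)
    ultimately show ?thesis using False test_fun_schwartz[OF \<psi>]
      by (simp add: L_op_def d_def distr_half_laplacian_def)
  qed
  then show "L_op V \<psi> = of_real (gamma_const CARD('n)) * - (\<Sum>j\<in>UNIV. LINT x|lborel. of_real (V x $ j) * inv_fourier (v j) x)"
    "S_half_symbol (v j)" by auto
qed

text \<open>For an arbitrary probability measure the operator recovers P itself as a distribution.
  Fubini between P and Lebesgue measure reduces the claim to a point mass at z, where
  \<open>spatial_sign_pairing_sum\<close> and Fourier inversion give \<psi>(z); the minus signs of
  the divergence and of the pairing cancel.\<close>

lemma L_op_geometric_cdf:
  fixes P :: "(real^'n::finite) measure"
  assumes P: "prob_space P" "sets P = sets borel" and \<psi>: "test_fun \<psi>"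
  shows "L_op (geometric_cdf P) \<psi> = (LINT z|P. \<psi> z)"
proof -
  interpret P: prob_space P by fact
  note [measurable_cong] = P(2)
  have sp: "space P = UNIV" using sets_eq_imp_space_eq[OF P(2)] by simp
  interpret PL: pair_sigma_finite P "lborel :: (real^'n) measure" by standard
  have F: "geometric_cdf P x $ j = (LINT z|P. spatial_sign j (x - z))" for x j
    by (simp add: geometric_cdf_nth[OF P] spatial_sign_def)
  have meas: "(\<lambda>x. geometric_cdf P x $ j) \<in> borel_measurable borel" for j
    unfolding F by measurable
  have rint: "integrable P (\<lambda>z. spatial_sign j (x - z))" for j x
    by (rule P.integrable_const_bound[where B=1]) (auto simp: spatial_sign_le)
  have bd: "\<bar>geometric_cdf P x $ j\<bar> \<le> 1" for x j
  proof -
    have "norm (LINT z|P. spatial_sign j (x - z)) \<le> (LINT z|P. 1)"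
      by (rule norm_integral_le_of_bound) (auto simp: spatial_sign_le)
    then show ?thesis by (simp add: F P.prob_space)
  qed
  define v where "v = (\<lambda>j \<xi>. deriv_symbol j \<xi> * (of_real ((2 * pi * norm \<xi>) ^ (CARD('n) - 1)) * fourier \<psi> (\<xi>::real^'n)))"
  define D where "D = (\<lambda>j. inv_fourier (v j))"
  have S_half_symbol: "S_half_symbol (v j)" for j unfolding v_def by (rule L_op_eval(2)[OF meas bd \<psi>])
  have Dint: "integrable lborel (D j)" for j unfolding D_def by (rule S_half_symbol_integrable[OF S_half_symbol])
  have L: "L_op (geometric_cdf P) \<psi> = of_real (gamma_const CARD('n)) *
      - (\<Sum>j\<in>UNIV. LINT x|lborel. of_real (geometric_cdf P x $ j) * D j x)"
    unfolding D_def v_def by (rule L_op_eval(1)[OF meas bd \<psi>])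
  have I: "integrable (P \<Otimes>\<^sub>M lborel) (\<lambda>(z, x). of_real (spatial_sign j (x - z)) * D j x)" for j
  proof (rule PL.Fubini_integrable)
    have [measurable]: "D j \<in> borel_measurable borel" using Dint by simp
    show "(\<lambda>(z, x). of_real (spatial_sign j (x - z)) * D j x) \<in> borel_measurable (P \<Otimes>\<^sub>M lborel)" by measurable
    have le: "norm (of_real (spatial_sign j (x - z)) * D j x) \<le> norm (D j x)" for x z
    proof -
      have "\<bar>spatial_sign j (x - z)\<bar> * norm (D j x) \<le> 1 * norm (D j x)" by (intro mult_right_mono spatial_sign_le) simp
      then show ?thesis by (simp add: norm_mult)
    qed
    have i: "integrable lborel (\<lambda>x. of_real (spatial_sign j (x - z)) * D j x)" for z
    proof (rule Bochner_Integration.integrable_bound[OF Dint[of j]])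
      show "AE x in lborel. norm (of_real (spatial_sign j (x - z)) * D j x) \<le> norm (D j x)" by (intro AE_I2 le)
    qed measurable
    show "AE z in P. integrable lborel (\<lambda>x. case (z, x) of (z, x) \<Rightarrow> of_real (spatial_sign j (x - z)) * D j x)"
      unfolding prod.case by (intro AE_I2 i)
    show "integrable P (\<lambda>z. LINT x|lborel. norm (case (z, x) of (z, x) \<Rightarrow> of_real (spatial_sign j (x - z)) * D j x))"
      unfolding prod.case
    proof (rule P.integrable_const_bound[where B="LINT x|lborel. norm (D j x)"])
      have "(LINT x|lborel. norm (of_real (spatial_sign j (x - z)) * D j x)) \<le> (LINT x|lborel. norm (D j x))" for z
        by (intro integral_mono integrable_norm i Dint le)
      then show "AE z in P. norm (LINT x|lborel. norm (of_real (spatial_sign j (x - z)) * D j x)) \<le> (LINT x|lborel. norm (D j x))"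
        by (intro AE_I2) simp
    qed measurable
  qed
  have swap: "(LINT x|lborel. of_real (geometric_cdf P x $ j) * D j x) =
      (LINT z|P. LINT x|lborel. of_real (spatial_sign j (x - z)) * D j x)" for j
  proof -
    have "(LINT x|lborel. of_real (geometric_cdf P x $ j) * D j x) =
        (LINT x|lborel. LINT z|P. of_real (spatial_sign j (x - z)) * D j x)"
      unfolding F integral_complex_of_real[symmetric] Bochner_Integration.integral_mult_left_zero ..
    then show ?thesis using PL.Fubini_integral[OF I[of j]] by simp
  qed
  have inner: "integrable P (\<lambda>z. LINT x|lborel. of_real (spatial_sign j (x - z)) * D j x)" for j
    using PL.integrable_fst'[OF I[of j]] by simp
  have "(\<Sum>j\<in>UNIV. LINT x|lborel. of_real (geometric_cdf P x $ j) * D j x) =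
      (LINT z|P. (\<Sum>j\<in>UNIV. LINT x|lborel. of_real (spatial_sign j (x - z)) * D j x))"
    unfolding swap by (rule Bochner_Integration.integral_sum[symmetric]) (rule inner)
  also have "\<dots> = (LINT z|P. - (of_real (inv_gamma_const CARD('n)) * \<psi> z))"
  proof (rule Bochner_Integration.integral_cong[OF refl])
    fix z
    show "(\<Sum>j\<in>UNIV. LINT x|lborel. of_real (spatial_sign j (x - z)) * D j x) = - (of_real (inv_gamma_const CARD('n)) * \<psi> z)"
      using spatial_sign_pairing_sum[OF rapid_fourier[OF \<psi>], of z] Dint
      unfolding D_def v_def fourier_inversion[OF \<psi>] by blast
  qed
  also have "\<dots> = - (of_real (inv_gamma_const CARD('n)) * (LINT z|P. \<psi> z))"
    by simp
  finally have S: "(\<Sum>j\<in>UNIV. LINT x|lborel. of_real (geometric_cdf P x $ j) * D j x) =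
      - (of_real (inv_gamma_const CARD('n)) * (LINT z|P. \<psi> z))" .
  have "complex_of_real (gamma_const CARD('n)) * of_real (inv_gamma_const CARD('n)) = 1"
    using inv_gamma_const_pos[of "CARD('n)"] by (simp add: gamma_const_eq)
  then show ?thesis unfolding L S by (simp add: mult.assoc[symmetric])
qed

lemma test_fun_on_test_fun:
  assumes "\<psi> \<in> test_fun_on \<Omega>"
  shows "test_fun \<psi>" and "z \<notin> \<Omega> \<Longrightarrow> \<psi> z = 0"
proof -
  have sm: "smooth \<psi>" and K: "compact (closure {x. \<psi> x \<noteq> 0})" "closure {x. \<psi> x \<noteq> 0} \<subseteq> \<Omega>"
    using assms by (auto simp: test_fun_on_def)
  have sub: "{x. \<psi> x \<noteq> 0} \<subseteq> closure {x. \<psi> x \<noteq> 0}" by (rule closure_subset)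
  obtain R where R: "\<And>x. x \<in> closure {x. \<psi> x \<noteq> 0} \<Longrightarrow> norm x \<le> R"
    using compact_imp_bounded[OF K(1)] unfolding bounded_iff by blast
  have "\<psi> x = 0" if "norm x > R" for x
  proof (rule ccontr)
    assume "\<psi> x \<noteq> 0"
    then have "norm x \<le> R" using sub by (intro R) auto
    with that show False by simp
  qed
  with sm show "test_fun \<psi>" unfolding test_fun_def by blast
  show "z \<notin> \<Omega> \<Longrightarrow> \<psi> z = 0" using sub K(2) by auto
qed

text \<open>A test function supported in \<Omega> sees P only through its density, so the
  distribution P restricted to \<Omega> is f, and f itself, read as a complex function, is the
  continuous representative.\<close>

theorem theorem4p3:
  fixes \<Omega> :: "(real^'n::finite) set"
    and P :: "(real^'n) measure"
    and f :: "real^'n \<Rightarrow> real"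
    and k :: nat and \<beta> :: real
  assumes "open \<Omega>"
    and "prob_space P" and "sets P = sets borel"
    and "has_L1_density_over P \<Omega> f"
    and "0 < \<beta>" and "\<beta> < 1"
    and "Ck_holder_loc k \<beta> \<Omega> f"
  shows "(\<forall>j. Ck_holder_loc (CARD('n) + k) \<beta> \<Omega> (\<lambda>x. geometric_cdf P x $ j)) \<and>
         (\<exists>g. represented_on \<Omega> (L_op (geometric_cdf P)) g \<and>
              (\<forall>x\<in>\<Omega>. complex_of_real (f x) = g x))"
proof (intro conjI allI exI ballI)
  show "Ck_holder_loc (CARD('n) + k) \<beta> \<Omega> (\<lambda>x. geometric_cdf P x $ j)" for j
    by (rule geometric_cdf_regularity[OF assms])
  have "continuous_on \<Omega> f"
    using assms(7) Ck_on_continuous[of k \<Omega> f "[]"] by (simp add: Ck_holder_loc_def)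
  then have "continuous_on \<Omega> (\<lambda>x. complex_of_real (f x))" by (intro continuous_intros)
  moreover have "L_op (geometric_cdf P) \<psi> = (LINT x:\<Omega>|lborel. complex_of_real (f x) * \<psi> x)"
    if \<psi>: "\<psi> \<in> test_fun_on \<Omega>" for \<psi>
  proof -
    have "L_op (geometric_cdf P) \<psi> = (LINT z|P. \<psi> z)"
      by (rule L_op_geometric_cdf[OF assms(2,3) test_fun_on_test_fun(1)[OF \<psi>]])
    also have "\<dots> = (LINT z|lborel. (indicator \<Omega> z * f z) *\<^sub>R \<psi> z)"
      by (rule integral_density_over[OF assms(2,3,1,4) test_fun_measurable[OF test_fun_on_test_fun(1)[OF \<psi>]]
            test_fun_on_test_fun(2)[OF \<psi>]])
    also have "\<dots> = (LINT x:\<Omega>|lborel. complex_of_real (f x) * \<psi> x)"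
      unfolding set_lebesgue_integral_def by (simp add: scaleR_conv_of_real mult.assoc)
    finally show ?thesis .
  qed
  ultimately show "represented_on \<Omega> (L_op (geometric_cdf P)) (\<lambda>x. complex_of_real (f x))"
    by (simp add: represented_on_def)
  show "complex_of_real (f x) = complex_of_real (f x)" for x ..
qed

end
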